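(* Assume the standing setup (A1)--(A5), and suppose that $\kappa$ is either a Matérn-$\nu$ kernel, $\nu>0$, satisfying the polynomial spectral decay condition (i), or a squared-exponential (SE) kernel satisfying the exponential spectral decay condition (ii). At every iteration $t$ with $B_t=0$ (UR iteration) the query is $\theta_{t+1}=\arg\max_{\theta\in\Omega}\Delta_t(\theta)$; at other iterations the query may be selected by any rule satisfying (A3). Suppose additionally that the allocation-proxy smoothness condition (S) holds, that $\mathcal D_0$ contains at least $k+1$ distinct input locations, and that the allocation probability is the proxy $\widehat p_{t,k}$, i.e. $B_t\sim\mathrm{Bernoulli}(\widehat p_{t,k})$. Then there exists a random variable $\rho_\star<1$ such that, almost surely, $$\sup_{t\ge0}\widehat p_{t,k}\le\rho_\star\qquad\text{and}\qquad\liminf_{T\to\infty}N_T^{\rm UR}/T\ge1-\rho_\star>0,$$ where $N_T^{\rm UR}=\sum_{t=0}^{T-1}(1-B_t)$. Consequently, for every $\delta\in(0,1)$ there exist $C_\delta<\infty$, $c_\delta>0$ and $T_\delta<\infty$, independent of $T$, such that for all $T\ge T_\delta$ $$\mathbb E\{\mathrm{TV}(\bar\pi_T,\pi_{\mathbf X})\}\le C_\delta\,\mathscr O^{+}(T)+\delta,\qquad\text{and, if }\varsigma^2=0,\quad\mathbb E\{\mathrm{TV}(\bar\pi_T,\pi_{\mathbf X})\}\le C_\delta\,\mathscr O^{0}_{c_\delta}(T)+\delta,$$ where $\mathscr O^{+}(T)=(T+1)^{-\nu/(2\nu+d)}$ and $\mathscr O^0_c(T)=(T+1)^{-\nu/d}$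 for a Matérn-$\nu$ kernel, while $\mathscr O^{+}(T)=\{1+\log(T+1)\}^{d/2}(T+1)^{-1/2}$ and $\mathscr O^0_c(T)=\exp\{-c(T+1)^{1/(d+1)}\}$ for an SE kernel.
   Context: Standing setup. $d\ge1$ is fixed, $\lambda$ is Lebesgue measure, $\mathbb B(\theta,r)$ is the open Euclidean ball. (A1) $\Omega\subset\mathbb R^d$ is compact, convex, with nonempty interior, and there are $c_\Omega,r_\Omega>0$ with $\lambda\{\mathbb B(\theta,r)\cap\Omega\}\ge c_\Omega r^d$ for all $\theta\in\Omega$, $0<r\le r_\Omega$. (A2) $f\sim\mathcal{GP}(0,\kappa)$ on $\Omega$ with $\kappa$ positive definite. Responses are $y_i=f(\theta_i)+\varepsilon_i$, $\varepsilon_i$ iid $\mathcal N(0,\varsigma^2)$, independent of $f$ and of the algorithmic randomness. $\kappa$ and $\varsigma^2\ge0$ are fixed and known and Gaussian-process (GP) updating is exact; if $\varsigma^2=0$, redundant observations are removed before conditioning. Sequential design: after a finite initial design $\mathcal D_0$ (its input locations are chosen independently of $f$, the noises and the subsequent algorithmic randomness), active queries $\theta_1,\theta_2,\dots$ are made one at a time; $\mathcal D_t$ consists of $\mathcal D_0$ and the first $t$ active pairs $(\theta_i,y_i)$, and $\mathcal H_t=\sigma(\mathcal D_t)$. $\mathbb P_t$ is the conditional law of $f$ given $\mathcal H_t$, a GP with mean $\mu_t$, covariance $\kappa_t$ and variance $\sigma_t^2(\theta)=\kappa_t(\theta,\theta)$. (A3) The next query $\theta_{t+1}$ is measurable with respect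 to $\mathcal H_t$ and fresh algorithmic randomness independent of $f$, of the noises and of earlier algorithmic randomness. Conditionally on $\mathcal H_t$, $f$ and a posterior draw $f_t$ are iid from $\mathbb P_t$. (A4) For every $t$, $f_t$ has a unique maximiser over $\Omega$, $\mathbb P_t$-a.s. (A5) For some open $U\supset\Omega$, $\kappa$ extends to a covariance kernel on $U\times U$, $B_\kappa:=\sup_{\theta\in\Omega}\kappa(\theta,\theta)\in(0,\infty)$, and the prior GP on $U$ has a version with $C^1(U)$ sample paths a.s. With $\mathscr d_0^2(\theta,\theta')=\mathrm{Var}\{f(\theta)-f(\theta')\}$, $\mathscr d_{0,j}^2(\theta,\theta')=\mathrm{Var}\{\partial_jf(\theta)-\partial_jf(\theta')\}$ and $N(\epsilon,\Omega,\mathscr d)$ the covering number, $J_0=\int_0^{\mathrm{diam}(\Omega,\mathscr d_0)}\sqrt{\log N(\epsilon,\Omega,\mathscr d_0)}\,d\epsilon<\infty$ and $J_0^{(j)}=\int_0^{\mathrm{diam}(\Omega,\mathscr d_{0,j})}\sqrt{\log N(\epsilon,\Omega,\mathscr d_{0,j})}\,d\epsilon<\infty$, and $B_{\partial,j}=\sup_{\theta\in\Omega}\mathrm{Var}\{\partial_jf(\theta)\}<\infty$, for $1\le j\le d$. For every $t$, a.s., $\mu_t\in C^1(U)$ and $\partial_j\mu_t(\theta)=\mathbb E\{\partial_jf(\theta)\mid\mathcal H_t\}$ for all $\theta\in\Omega$, $1\le j\le d$. Branch label: at iteration $t$, before the query, $B_t\in\{0,1\}$ is drawn using fresh algorithmic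 randomness, conditionally on the pre-branch history as $\mathrm{Bernoulli}(\widehat p_{t,k})$ ($B_t=1$: BO step; $B_t=0$: UR step). Posterior laws. For continuous $g:\Omega\to\mathbb R$, $\pi(d\theta\mid g)=\exp\{g(\theta)\}\lambda(d\theta)/\mathcal Z(g)$, $\mathcal Z(g)=\int_\Omega e^{g}\,d\lambda$. The true posterior is $\pi_{\mathbf X}=\pi(\cdot\mid f)$. The expected posterior is $\bar\pi_t(A)=\int\pi(A\mid g)\,\mathbb P_t(dg)$. $\mathrm{TV}(\pi,\rho)=\sup_{A\in\mathscr B(\Omega)}|\pi(A)-\rho(A)|$. Weighted variance reduction: $\Delta_t(\theta)=\int_\Omega\frac{\kappa_t(u,\theta)^2}{\sigma_t^2(\theta)+\varsigma^2}\,\bar\pi_t(du)$, with integrand defined to be zero when both $\varsigma^2=0$ and $\sigma_t^2(\theta)=0$. Spectral decay. Let $\lambda^\lambda_{0,1}\ge\lambda^\lambda_{0,2}\ge\dots\ge0$ be the eigenvalues of the prior covariance operator $h\mapsto\int_\Omega\kappa(\cdot,u)h(u)\lambda(du)$ on $L^2(\Omega,\lambda)$. For some $A_0<\infty$: (i) $\lambda^\lambda_{0,j}\le A_0j^{-(1+2\nu/d)}$ for all $j\ge1$; (ii) for some $a_0>0$, $\lambda^\lambda_{0,j}\le A_0\exp\{-a_0j^{1/d}\}$ for all $j\ge1$. Allocation proxy. Fix an integer $k\ge1$ and $a>0$. Let $\theta_t^\dagger$ maximise $\mu_t$ over the design inputs in $\mathcal D_t$ (deterministic tie-breaking), $\mathbf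 H_t=\nabla^2\mu_t(\theta_t^\dagger)$ and $\mathbf C_t=\mathcal M\{-(\mathbf H_t+\mathbf H_t^\top)/2\}$. For each design input $\theta_i\ne\theta_t^\dagger$ in $\mathcal D_t$ put $d_{t,i}=\{(\theta_i-\theta_t^\dagger)^\top\mathbf C_t(\theta_i-\theta_t^\dagger)\}^{1/2}$; $\Delta^{\rm loc}_{t,k}$ is the mean of the $k$ smallest positive $d_{t,i}$, and $\widehat p_{t,k}=\tanh(C\Delta^{\rm loc}_{t,k}/a)$ with $C=\log(3)/2$. (S) Allocation-proxy smoothness. The prior GP has a version with a.s. $C^2(U)$ sample paths on an open $U\supset\Omega$. For each $r,s\in\{1,\dots,d\}$, $D_{rs}f=\partial_r\partial_sf$ is a centred continuous GP on $\Omega$, jointly Gaussian with finite collections of function values; with $\mathscr d_{0,rs}(\theta,\theta')^2=\mathrm{Var}\{D_{rs}f(\theta)-D_{rs}f(\theta')\}$, $\int_0^{\mathrm{diam}(\Omega,\mathscr d_{0,rs})}\sqrt{\log N(\epsilon,\Omega,\mathscr d_{0,rs})}\,d\epsilon<\infty$ and $\sup_{\theta\in\Omega}\mathrm{Var}\{D_{rs}f(\theta)\}<\infty$. Also $\partial_r\partial_s\mu_t(\theta)=\mathbb E\{D_{rs}f(\theta)\mid\mathcal H_t\}$ a.s. for $\theta\in\Omega$. The matrix $\mathbf C_t$ is positive definite, and the deterministic map $\mathcal M$ satisfies $\|\mathcal M(\mathbf H)\|_{\rm op}\le C_{\mathcal M}\{1+\|\mathbf H\|_{\rm op}\}$ for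 every symmetric $\mathbf H$ and a constant $C_{\mathcal M}<\infty$. *)

theory Defs
  imports "HOL-Probability.Probability"
begin

section \<open>Gaussian processes\<close>

definition normal_law :: "real \<Rightarrow> real \<Rightarrow> real measure" where
  "normal_law m v = (if v = 0 then return borel m else density lborel (normal_density m (sqrt v)))"

definition gaussian_process ::
  "'w measure \<Rightarrow> 'i set \<Rightarrow> ('i \<Rightarrow> 'w \<Rightarrow> real) \<Rightarrow> ('i \<Rightarrow> real) \<Rightarrow> ('i \<Rightarrow> 'i \<Rightarrow> real) \<Rightarrow> bool"
where
  "gaussian_process M I X m K \<longleftrightarrow>
     (\<forall>i\<in>I. X i \<in> borel_measurable M) \<and>
     (\<forall>i\<in>I. \<forall>j\<in>I. K i j = K j i) \<and>
     (\<forall>J c. finite J \<and> J \<subseteq> I \<longrightarrow>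
        0 \<le> (\<Sum>i\<in>J. \<Sum>j\<in>J. c i * c j * K i j) \<and>
        distr M borel (\<lambda>w. \<Sum>i\<in>J. c i * X i w) =
          normal_law (\<Sum>i\<in>J. c i * m i) (\<Sum>i\<in>J. \<Sum>j\<in>J. c i * c j * K i j))"

definition covariance_kernel :: "'a set \<Rightarrow> ('a \<Rightarrow> 'a \<Rightarrow> real) \<Rightarrow> bool" where
  "covariance_kernel A K \<longleftrightarrow>
     (\<forall>x\<in>A. \<forall>y\<in>A. K x y = K y x) \<and>
     (\<forall>J c. finite J \<and> J \<subseteq> A \<longrightarrow> 0 \<le> (\<Sum>x\<in>J. \<Sum>y\<in>J. c x * c y * K x y))"

definition positive_definite_kernel :: "'a set \<Rightarrow> ('a \<Rightarrow> 'a \<Rightarrow> real) \<Rightarrow> bool" where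
  "positive_definite_kernel A K \<longleftrightarrow>
     (\<forall>x\<in>A. \<forall>y\<in>A. K x y = K y x) \<and>
     (\<forall>J c. finite J \<and> J \<subseteq> A \<and> (\<exists>x\<in>J. c x \<noteq> 0) \<longrightarrow>
        0 < (\<Sum>x\<in>J. \<Sum>y\<in>J. c x * c y * K x y))"

text \<open>
  Exact conditioning on \<open>y i = f (x i) + noise\<close>, noise variance \<open>v\<close>, one observation at a time.
  For \<open>v = 0\<close> an input with zero current variance is redundant; as \<open>r / 0 = 0\<close>, such an
  observation leaves mean and covariance unchanged, that is, it is removed.
\<close>

primrec gp_cov :: "('a \<Rightarrow> 'a \<Rightarrow> real) \<Rightarrow> real \<Rightarrow> (nat \<Rightarrow> 'a) \<Rightarrow> nat \<Rightarrow> 'a \<Rightarrow> 'a \<Rightarrow> real" where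
  "gp_cov K v x 0 = K"
| "gp_cov K v x (Suc n) =
     (\<lambda>p q. gp_cov K v x n p q
        - gp_cov K v x n p (x n) * gp_cov K v x n (x n) q / (gp_cov K v x n (x n) (x n) + v))"

primrec gp_mean ::
  "('a \<Rightarrow> 'a \<Rightarrow> real) \<Rightarrow> real \<Rightarrow> (nat \<Rightarrow> 'a) \<Rightarrow> (nat \<Rightarrow> real) \<Rightarrow> nat \<Rightarrow> 'a \<Rightarrow> real" where
  "gp_mean K v x y 0 = (\<lambda>p. 0)"
| "gp_mean K v x y (Suc n) =
     (\<lambda>p. gp_mean K v x y n p
        + gp_cov K v x n p (x n) * (y n - gp_mean K v x y n (x n)) / (gp_cov K v x n (x n) (x n) + v))"

definition path_space :: "'a::topological_space set \<Rightarrow> ('a \<Rightarrow> real) measure" where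
  "path_space U = restrict_space (PiM U (\<lambda>_. borel)) {g. continuous_on U g}"


section \<open>Kernels and spectral decay\<close>

text \<open>Modified Bessel function of the second kind, for \<open>z > 0\<close>.\<close>

definition bessel_K :: "real \<Rightarrow> real \<Rightarrow> real" where
  "bessel_K \<nu> z = (LBINT s:{0..}. exp (- z * cosh s) * cosh (\<nu> * s))"

definition matern_kernel ::
  "real \<Rightarrow> real \<Rightarrow> real \<Rightarrow> 'a::metric_space \<Rightarrow> 'a \<Rightarrow> real" where
  "matern_kernel \<nu> s l x y =
     (if x = y then s\<^sup>2
      else let z = sqrt (2 * \<nu>) * dist x y / l
           in s\<^sup>2 * (2 powr (1 - \<nu>) / Gamma \<nu>) * z powr \<nu> * bessel_K \<nu> z)"

definition se_kernel :: "real \<Rightarrow> real \<Rightarrow> 'a::metric_space \<Rightarrow> 'a \<Rightarrow> real" where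
  "se_kernel s l x y = s\<^sup>2 * exp (- (dist x y)\<^sup>2 / (2 * l\<^sup>2))"

abbreviation lebesgue_region :: "'a::euclidean_space set \<Rightarrow> 'a measure" where
  "lebesgue_region D \<equiv> restrict_space lborel D"

definition square_integrable :: "'a measure \<Rightarrow> ('a \<Rightarrow> real) \<Rightarrow> bool" where
  "square_integrable M h \<longleftrightarrow> h \<in> borel_measurable M \<and> integrable M (\<lambda>x. (h x)\<^sup>2)"

definition covariance_operator ::
  "'a::euclidean_space set \<Rightarrow> ('a \<Rightarrow> 'a \<Rightarrow> real) \<Rightarrow> ('a \<Rightarrow> real) \<Rightarrow> 'a \<Rightarrow> real" where
  "covariance_operator D K h = (\<lambda>x. \<integral>u. K x u * h u \<partial>lebesgue_region D)"

text \<open>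
  \<open>lam 0 \<ge> lam 1 \<ge> \<dots> \<ge> 0\<close> lists the eigenvalues on \<open>L\<^sup>2(D)\<close> with multiplicity: orthonormal
  eigenfunctions \<open>e j\<close>, on whose orthogonal complement the operator vanishes.
  The list starts at index 0, so \<open>lam j\<close> is the eigenvalue of rank \<open>Suc j\<close>.
\<close>

definition eigenvalue_sequence ::
  "'a::euclidean_space set \<Rightarrow> ('a \<Rightarrow> 'a \<Rightarrow> real) \<Rightarrow> (nat \<Rightarrow> real) \<Rightarrow> bool" where
  "eigenvalue_sequence D K lam \<longleftrightarrow>
     decseq lam \<and> (\<forall>j. 0 \<le> lam j) \<and>
     (\<exists>e :: nat \<Rightarrow> 'a \<Rightarrow> real.
        (\<forall>j. square_integrable (lebesgue_region D) (e j)) \<and>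
        (\<forall>i j. (\<integral>x. e i x * e j x \<partial>lebesgue_region D) = of_bool (i = j)) \<and>
        (\<forall>j. AE x in lebesgue_region D. covariance_operator D K (e j) x = lam j * e j x) \<and>
        (\<forall>h. square_integrable (lebesgue_region D) h \<and>
             (\<forall>j. (\<integral>x. h x * e j x \<partial>lebesgue_region D) = 0) \<longrightarrow>
             (AE x in lebesgue_region D. covariance_operator D K h x = 0)))"

datatype kernel_family = Matern real | Squared_Exponential

definition kernel_assumption ::
  "kernel_family \<Rightarrow> 'a::euclidean_space set \<Rightarrow> ('a \<Rightarrow> 'a \<Rightarrow> real) \<Rightarrow> bool" where
  "kernel_assumption fam D K \<longleftrightarrow>
     (case fam of
        Matern \<nu> \<Rightarrow>
          0 < \<nu> \<and>
          (\<exists>s>0. \<exists>l>0. \<forall>x\<in>D. \<forall>y\<in>D. K x y = matern_kernel \<nu> s l x y) \<and>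
          (\<exists>lam. eigenvalue_sequence D K lam \<and>
             (\<exists>A0. \<forall>j. lam j \<le> A0 * real (Suc j) powr (- (1 + 2 * \<nu> / DIM('a)))))
      | Squared_Exponential \<Rightarrow>
          (\<exists>s>0. \<exists>l>0. \<forall>x\<in>D. \<forall>y\<in>D. K x y = se_kernel s l x y) \<and>
          (\<exists>lam. eigenvalue_sequence D K lam \<and>
             (\<exists>A0. \<exists>a0>0. \<forall>j. lam j \<le> A0 * exp (- a0 * real (Suc j) powr (1 / DIM('a))))))"

text \<open>In the rates, \<open>d\<close> is the dimension.\<close>

definition noisy_rate :: "kernel_family \<Rightarrow> nat \<Rightarrow> nat \<Rightarrow> real" where
  "noisy_rate fam d T =
     (case fam of
        Matern \<nu> \<Rightarrow> (real T + 1) powr (- \<nu> / (2 * \<nu> + d))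
      | Squared_Exponential \<Rightarrow> (1 + ln (real T + 1)) powr (d / 2) * (real T + 1) powr (- 1 / 2))"

definition noiseless_rate :: "kernel_family \<Rightarrow> nat \<Rightarrow> real \<Rightarrow> nat \<Rightarrow> real" where
  "noiseless_rate fam d c T =
     (case fam of
        Matern \<nu> \<Rightarrow> (real T + 1) powr (- \<nu> / d)
      | Squared_Exponential \<Rightarrow> exp (- c * (real T + 1) powr (1 / (d + 1))))"


section \<open>Entropy integrals and derivatives\<close>

definition covering_number :: "real \<Rightarrow> 'a set \<Rightarrow> ('a \<Rightarrow> 'a \<Rightarrow> real) \<Rightarrow> enat" where
  "covering_number r A \<rho> =
     (INF C\<in>{C. finite C \<and> C \<subseteq> A \<and> (\<forall>x\<in>A. \<exists>c\<in>C. \<rho> c x \<le> r)}. enat (card C))"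

definition entropy_integral :: "'a set \<Rightarrow> ('a \<Rightarrow> 'a \<Rightarrow> real) \<Rightarrow> ennreal" where
  "entropy_integral A \<rho> =
     (\<integral>\<^sup>+r\<in>{r. 0 < r \<and> ennreal r \<le> (SUP x\<in>A. SUP y\<in>A. ennreal (\<rho> x y))}.
        (case covering_number r A \<rho> of enat n \<Rightarrow> ennreal (sqrt (ln (real n))) | \<infinity> \<Rightarrow> \<infinity>) \<partial>lborel)"

definition canonical_metric :: "'w measure \<Rightarrow> ('w \<Rightarrow> 'a \<Rightarrow> real) \<Rightarrow> 'a \<Rightarrow> 'a \<Rightarrow> real" where
  "canonical_metric M X x y = sqrt (prob_space.variance M (\<lambda>w. X w x - X w y))"

definition partial :: "'n \<Rightarrow> (real^'n::finite \<Rightarrow> real) \<Rightarrow> real^'n \<Rightarrow> real" where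
  "partial j g x = frechet_derivative g (at x) (axis j 1)"

text \<open>The next two are meant for open \<open>U\<close>.\<close>

definition C1_on :: "(real^'n::finite) set \<Rightarrow> (real^'n \<Rightarrow> real) \<Rightarrow> bool" where
  "C1_on U g \<longleftrightarrow> g differentiable_on U \<and> (\<forall>j. continuous_on U (partial j g))"

definition C2_on :: "(real^'n::finite) set \<Rightarrow> (real^'n \<Rightarrow> real) \<Rightarrow> bool" where
  "C2_on U g \<longleftrightarrow> C1_on U g \<and> (\<forall>j. C1_on U (partial j g))"

definition hessian :: "(real^'n::finite \<Rightarrow> real) \<Rightarrow> real^'n \<Rightarrow> real^'n^'n" where
  "hessian g x = (\<chi> r s. partial r (partial s g) x)"

definition positive_definite_matrix :: "real^'n::finite^'n \<Rightarrow> bool" where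
  "positive_definite_matrix A \<longleftrightarrow> transpose A = A \<and> (\<forall>v. v \<noteq> 0 \<longrightarrow> 0 < v \<bullet> (A *v v))"


section \<open>Sequential designs\<close>

text \<open>
  Inputs and noises are numbered consecutively: indices below \<open>n_init\<close> form the initial design,
  index \<open>n_init + t\<close> is the query made at iteration \<open>t\<close>. The kernel and the paths live on the
  neighbourhood \<open>nbhd\<close> of \<open>region\<close>. \<open>alg t\<close> is the sigma-algebra of the fresh algorithmic
  randomness of iteration \<open>t\<close> (branch and query selection); \<open>post_law t w\<close> is the posterior law
  on \<open>path_space nbhd\<close> and \<open>draw t\<close> the posterior draw.
  \<open>branch t w\<close> is true for a BO step and false for a UR step.
\<close>

record ('w, 'n::finite) design =
  prb       :: "'w measure"
  region    :: "(real^'n) set"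
  nbhd      :: "(real^'n) set"
  cov_kernel :: "real^'n \<Rightarrow> real^'n \<Rightarrow> real"
  noise_var :: real
  latent    :: "'w \<Rightarrow> real^'n \<Rightarrow> real"
  noise     :: "nat \<Rightarrow> 'w \<Rightarrow> real"
  n_init    :: nat
  input     :: "nat \<Rightarrow> 'w \<Rightarrow> real^'n"
  alg       :: "nat \<Rightarrow> 'w measure"
  post_law  :: "nat \<Rightarrow> 'w \<Rightarrow> (real^'n \<Rightarrow> real) measure"
  draw      :: "nat \<Rightarrow> 'w \<Rightarrow> real^'n \<Rightarrow> real"
  branch    :: "nat \<Rightarrow> 'w \<Rightarrow> bool"

definition obs :: "('w, 'n::finite) design \<Rightarrow> nat \<Rightarrow> 'w \<Rightarrow> real" where
  "obs S i w = latent S w (input S i w) + noise S i w"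

definition generated_by :: "'w measure \<Rightarrow> 'i set \<Rightarrow> ('i \<Rightarrow> 'w \<Rightarrow> 'b::topological_space) \<Rightarrow> 'w measure"
where
  "generated_by M I X = sigma (space M) (\<Union>i\<in>I. {X i -` A \<inter> space M | A. A \<in> sets borel})"

definition history :: "('w, 'n::finite) design \<Rightarrow> nat \<Rightarrow> 'w measure" where
  "history S t = generated_by (prb S) {..<n_init S + t} (\<lambda>i w. (input S i w, obs S i w))"

definition post_mean :: "('w, 'n::finite) design \<Rightarrow> nat \<Rightarrow> 'w \<Rightarrow> real^'n \<Rightarrow> real" where
  "post_mean S t w =
     gp_mean (cov_kernel S) (noise_var S) (\<lambda>i. input S i w) (\<lambda>i. obs S i w) (n_init S + t)"

definition post_cov :: "('w, 'n::finite) design \<Rightarrow> nat \<Rightarrow> 'w \<Rightarrow> real^'n \<Rightarrow> real^'n \<Rightarrow> real" where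
  "post_cov S t w = gp_cov (cov_kernel S) (noise_var S) (\<lambda>i. input S i w) (n_init S + t)"

definition post_var :: "('w, 'n::finite) design \<Rightarrow> nat \<Rightarrow> 'w \<Rightarrow> real^'n \<Rightarrow> real" where
  "post_var S t w x = post_cov S t w x x"

definition step_sigma :: "('w, 'n::finite) design \<Rightarrow> nat \<Rightarrow> 'w measure" where
  "step_sigma S t = sigma (space (prb S)) (sets (history S t) \<union> sets (alg S t))"

definition pre_branch_history :: "('w, 'n::finite) design \<Rightarrow> nat \<Rightarrow> 'w measure" where
  "pre_branch_history S t =
     sigma (space (prb S)) (sets (history S t) \<union> (\<Union>s<t. sets (alg S s)))"

datatype source = Latent | Noise nat | Initial_Inputs | Algorithm nat

definition source_events :: "('w, 'n::finite) design \<Rightarrow> source \<Rightarrow> 'w set set" where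
  "source_events S src =
     (case src of
        Latent \<Rightarrow> sets (generated_by (prb S) (nbhd S) (\<lambda>x w. latent S w x))
      | Noise i \<Rightarrow> sets (generated_by (prb S) {i} (noise S))
      | Initial_Inputs \<Rightarrow> sets (generated_by (prb S) {..<n_init S} (input S))
      | Algorithm t \<Rightarrow> sets (alg S t))"


section \<open>Posterior laws and variance reduction\<close>

definition normaliser :: "(real^'n::finite) set \<Rightarrow> (real^'n \<Rightarrow> real) \<Rightarrow> real" where
  "normaliser D g = (\<integral>x. exp (g x) \<partial>lebesgue_region D)"

definition posterior :: "(real^'n::finite) set \<Rightarrow> (real^'n \<Rightarrow> real) \<Rightarrow> (real^'n) measure" where
  "posterior D g = density (lebesgue_region D) (\<lambda>x. ennreal (exp (g x) / normaliser D g))"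

definition expected_posterior :: "('w, 'n::finite) design \<Rightarrow> nat \<Rightarrow> 'w \<Rightarrow> (real^'n) measure" where
  "expected_posterior S t w =
     measure_of (region S) (sets (restrict_space borel (region S)))
       (\<lambda>A. \<integral>\<^sup>+g. emeasure (posterior (region S) g) A \<partial>post_law S t w)"

definition total_variation :: "'a measure \<Rightarrow> 'a measure \<Rightarrow> real" where
  "total_variation P Q = (SUP A\<in>sets P. \<bar>measure P A - measure Q A\<bar>)"

text \<open>The integrand is zero when the denominator is zero, as \<open>r / 0 = 0\<close>.\<close>

definition variance_reduction :: "('w, 'n::finite) design \<Rightarrow> nat \<Rightarrow> 'w \<Rightarrow> real^'n \<Rightarrow> real" where
  "variance_reduction S t w x =
     (\<integral>u. (post_cov S t w u x)\<^sup>2 / (post_var S t w x + noise_var S) \<partial>expected_posterior S t w)"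


section \<open>Standing assumptions\<close>

definition regular_region :: "(real^'n::finite) set \<Rightarrow> bool" where
  "regular_region D \<longleftrightarrow>
     compact D \<and> convex D \<and> interior D \<noteq> {} \<and>
     (\<exists>c>0. \<exists>r0>0. \<forall>x\<in>D. \<forall>r. 0 < r \<and> r \<le> r0 \<longrightarrow>
        c * r ^ CARD('n) \<le> measure lborel (ball x r \<inter> D))"

definition gp_observation_model :: "('w, 'n::finite) design \<Rightarrow> bool" where
  "gp_observation_model S \<longleftrightarrow>
     prob_space (prb S) \<and>
     0 \<le> noise_var S \<and>
     positive_definite_kernel (region S) (cov_kernel S) \<and>
     gaussian_process (prb S) (region S) (\<lambda>x w. latent S w x) (\<lambda>_. 0) (cov_kernel S) \<and>
     (\<forall>i. noise S i \<in> borel_measurable (prb S) \<and>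
          distr (prb S) borel (noise S i) = normal_law 0 (noise_var S)) \<and>
     (\<forall>i. input S i \<in> borel_measurable (prb S)) \<and>
     (\<forall>i. \<forall>w\<in>space (prb S). input S i w \<in> region S) \<and>
     (\<forall>i. obs S i \<in> borel_measurable (prb S)) \<and>
     (\<forall>t. subalgebra (prb S) (alg S t)) \<and>
     prob_space.indep_sets (prb S) (source_events S) UNIV"

text \<open>
  \<open>post_law\<close> is a regular conditional law of the path given the history. Events of paths are
  taken in the product sigma-algebra, so paths need only be continuous almost surely.
\<close>

definition exact_posterior :: "('w, 'n::finite) design \<Rightarrow> bool" where
  "exact_posterior S \<longleftrightarrow>
     (\<forall>t. post_law S t \<in> history S t \<rightarrow>\<^sub>M prob_algebra (path_space (nbhd S))) \<and>
     (\<forall>t. \<forall>A\<in>sets (PiM (nbhd S) (\<lambda>_. borel)). AE w in prb S.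
        real_cond_exp (prb S) (history S t)
          (indicat_real {w \<in> space (prb S). restrict (latent S w) (nbhd S) \<in> A}) w =
        measure (post_law S t w) (A \<inter> space (path_space (nbhd S)))) \<and>
     (\<forall>t. AE w in prb S.
        gaussian_process (post_law S t w) (nbhd S) (\<lambda>x g. g x) (post_mean S t w) (post_cov S t w))"

definition adaptive_queries :: "('w, 'n::finite) design \<Rightarrow> bool" where
  "adaptive_queries S \<longleftrightarrow>
     (\<forall>t. input S (n_init S + t) \<in> borel_measurable (step_sigma S t)) \<and>
     (\<forall>t. \<forall>x\<in>nbhd S. (\<lambda>w. draw S t w x) \<in> borel_measurable (prb S)) \<and>
     (\<forall>t. AE w in prb S. continuous_on (nbhd S) (draw S t w)) \<and>
     (\<forall>t. \<forall>A\<in>sets (PiM (nbhd S) (\<lambda>_. borel)). \<forall>A'\<in>sets (PiM (nbhd S) (\<lambda>_. borel)).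
        AE w in prb S.
          real_cond_exp (prb S) (history S t)
            (indicat_real {w \<in> space (prb S). restrict (latent S w) (nbhd S) \<in> A \<and>
                                              restrict (draw S t w) (nbhd S) \<in> A'}) w =
          measure (post_law S t w) (A \<inter> space (path_space (nbhd S))) *
          measure (post_law S t w) (A' \<inter> space (path_space (nbhd S))))"

definition unique_posterior_maximiser :: "('w, 'n::finite) design \<Rightarrow> bool" where
  "unique_posterior_maximiser S \<longleftrightarrow>
     (\<forall>t. AE w in prb S. AE g in post_law S t w.
        \<exists>!x. x \<in> region S \<and> (\<forall>x'\<in>region S. g x' \<le> g x))"

text \<open>
  Conditional expectations are determined only up to null sets, separately at each point; the
  derivatives of the posterior mean are therefore required to be versions of them at each point.
\<close>

definition smooth_prior :: "('w, 'n::finite) design \<Rightarrow> bool" where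
  "smooth_prior S \<longleftrightarrow>
     open (nbhd S) \<and> region S \<subseteq> nbhd S \<and>
     covariance_kernel (nbhd S) (cov_kernel S) \<and>
     bdd_above ((\<lambda>x. cov_kernel S x x) ` region S) \<and> 0 < (SUP x\<in>region S. cov_kernel S x x) \<and>
     gaussian_process (prb S) (nbhd S) (\<lambda>x w. latent S w x) (\<lambda>_. 0) (cov_kernel S) \<and>
     (AE w in prb S. C1_on (nbhd S) (latent S w)) \<and>
     (\<forall>j. \<forall>x\<in>region S. (\<lambda>w. partial j (latent S w) x) \<in> borel_measurable (prb S)) \<and>
     entropy_integral (region S) (canonical_metric (prb S) (latent S)) < \<infinity> \<and>
     (\<forall>j. entropy_integral (region S)
             (canonical_metric (prb S) (\<lambda>w. partial j (latent S w))) < \<infinity>) \<and>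
     (\<forall>j. bdd_above ((\<lambda>x. prob_space.variance (prb S) (\<lambda>w. partial j (latent S w) x)) ` region S)) \<and>
     (\<forall>t. AE w in prb S. C1_on (nbhd S) (post_mean S t w)) \<and>
     (\<forall>t j. \<forall>x\<in>region S. AE w in prb S.
        partial j (post_mean S t w) x =
          real_cond_exp (prb S) (history S t) (\<lambda>w. partial j (latent S w) x) w)"

definition standing_setup :: "('w, 'n::finite) design \<Rightarrow> bool" where
  "standing_setup S \<longleftrightarrow>
     regular_region (region S) \<and> gp_observation_model S \<and> exact_posterior S \<and>
     adaptive_queries S \<and> unique_posterior_maximiser S \<and> smooth_prior S"


section \<open>Uncertainty-reduction steps and the allocation proxy\<close>

definition ur_queries :: "('w, 'n::finite) design \<Rightarrow> bool" where
  "ur_queries S \<longleftrightarrow>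
     (\<forall>t. AE w in prb S. \<not> branch S t w \<longrightarrow>
        (\<forall>x\<in>region S.
           variance_reduction S t w x \<le> variance_reduction S t w (input S (n_init S + t) w)))"

definition ur_count :: "('w, 'n::finite) design \<Rightarrow> nat \<Rightarrow> 'w \<Rightarrow> nat" where
  "ur_count S T w = (\<Sum>t<T. 1 - of_bool (branch S t w))"

definition data :: "('w, 'n::finite) design \<Rightarrow> nat \<Rightarrow> 'w \<Rightarrow> ((real^'n) \<times> real) list" where
  "data S t w = map (\<lambda>i. (input S i w, obs S i w)) [0..<n_init S + t]"

text \<open>
  Deterministic tie-breaking: the incumbent is a fixed function \<open>sel\<close> of the data whose value
  maximises the posterior mean over the design inputs.
\<close>

definition selects_incumbent ::
  "('w, 'n::finite) design \<Rightarrow> (((real^'n) \<times> real) list \<Rightarrow> real^'n) \<Rightarrow> bool" where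
  "selects_incumbent S sel \<longleftrightarrow>
     (\<forall>t. \<forall>w\<in>space (prb S).
        sel (data S t w) \<in> (\<lambda>i. input S i w) ` {..<n_init S + t} \<and>
        (\<forall>i<n_init S + t. post_mean S t w (input S i w) \<le> post_mean S t w (sel (data S t w))))"

definition proxy_matrix ::
  "('w, 'n::finite) design \<Rightarrow> (((real^'n) \<times> real) list \<Rightarrow> real^'n) \<Rightarrow> (real^'n^'n \<Rightarrow> real^'n^'n)
   \<Rightarrow> nat \<Rightarrow> 'w \<Rightarrow> real^'n^'n" where
  "proxy_matrix S sel \<M> t w =
     (let H = hessian (post_mean S t w) (sel (data S t w))
      in \<M> (- ((1 / 2) *\<^sub>R (H + transpose H))))"

definition proxy_distance ::
  "('w, 'n::finite) design \<Rightarrow> (((real^'n) \<times> real) list \<Rightarrow> real^'n) \<Rightarrow> (real^'n^'n \<Rightarrow> real^'n^'n)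
   \<Rightarrow> nat \<Rightarrow> 'w \<Rightarrow> nat \<Rightarrow> real" where
  "proxy_distance S sel \<M> t w i =
     (let v = input S i w - sel (data S t w) in sqrt (v \<bullet> (proxy_matrix S sel \<M> t w *v v)))"

text \<open>Distances are counted once per observation index, also when an input is repeated.\<close>

definition local_spread ::
  "('w, 'n::finite) design \<Rightarrow> (((real^'n) \<times> real) list \<Rightarrow> real^'n) \<Rightarrow> (real^'n^'n \<Rightarrow> real^'n^'n)
   \<Rightarrow> nat \<Rightarrow> nat \<Rightarrow> 'w \<Rightarrow> real" where
  "local_spread S sel \<M> k t w =
     sum_list (take k (sort (filter (\<lambda>r. 0 < r)
       (map (proxy_distance S sel \<M> t w)
         (filter (\<lambda>i. input S i w \<noteq> sel (data S t w)) [0..<n_init S + t]))))) / real k"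

definition alloc_prob ::
  "('w, 'n::finite) design \<Rightarrow> (((real^'n) \<times> real) list \<Rightarrow> real^'n) \<Rightarrow> (real^'n^'n \<Rightarrow> real^'n^'n)
   \<Rightarrow> nat \<Rightarrow> real \<Rightarrow> nat \<Rightarrow> 'w \<Rightarrow> real" where
  "alloc_prob S sel \<M> k a t w = tanh ((ln 3 / 2) * local_spread S sel \<M> k t w / a)"

definition bernoulli_branching ::
  "('w, 'n::finite) design \<Rightarrow> (nat \<Rightarrow> 'w \<Rightarrow> real) \<Rightarrow> bool" where
  "bernoulli_branching S p \<longleftrightarrow>
     (\<forall>t. {w \<in> space (prb S). branch S t w} \<in> sets (step_sigma S t) \<and>
        (AE w in prb S.
           real_cond_exp (prb S) (pre_branch_history S t)
             (indicat_real {w \<in> space (prb S). branch S t w}) w = p t w))"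

definition proxy_smoothness ::
  "('w, 'n::finite) design \<Rightarrow> (((real^'n) \<times> real) list \<Rightarrow> real^'n) \<Rightarrow> (real^'n^'n \<Rightarrow> real^'n^'n)
   \<Rightarrow> bool" where
  "proxy_smoothness S sel \<M> \<longleftrightarrow>
     (AE w in prb S. C2_on (nbhd S) (latent S w)) \<and>
     (\<forall>r s.
        (AE w in prb S. continuous_on (region S) (partial r (partial s (latent S w)))) \<and>
        (\<exists>K. gaussian_process (prb S) (Inl ` region S \<union> Inr ` region S)
               (case_sum (\<lambda>x w. latent S w x) (\<lambda>x w. partial r (partial s (latent S w)) x))
               (\<lambda>_. 0) K) \<and>
        entropy_integral (region S)
          (canonical_metric (prb S) (\<lambda>w. partial r (partial s (latent S w)))) < \<infinity> \<and>
        bdd_above ((\<lambda>x. prob_space.variance (prb S)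
                          (\<lambda>w. partial r (partial s (latent S w)) x)) ` region S) \<and>
        (\<forall>t. \<forall>x\<in>region S. AE w in prb S.
           partial r (partial s (post_mean S t w)) x =
             real_cond_exp (prb S) (history S t) (\<lambda>w. partial r (partial s (latent S w)) x) w)) \<and>
     (\<forall>t. AE w in prb S. positive_definite_matrix (proxy_matrix S sel \<M> t w)) \<and>
     (\<exists>C. \<forall>H. transpose H = H \<longrightarrow> onorm ((*v) (\<M> H)) \<le> C * (1 + onorm ((*v) H)))"

end

theory Submission
  imports Defs
begin

text \<open>
  Allocation. Conditionally on the history, a mixed difference quotient of the latent field is
  Gaussian around the same quotient of the posterior mean. A posterior mean with a large Hessian
  therefore forces the event that the latent field has a large difference quotient to have
  conditional probability at least 1/2, and by the maximal inequality for the martingale of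
  conditional probabilities this happens for some iteration only with small probability. So the
  Hessians, and with them the proxy distances, are bounded over all iterations, and the allocation
  probabilities stay below some \<open>\<rho> < 1\<close>. The law of large numbers for martingale differences gives
  the frequency of the UR steps.

  Total variation. Since \<open>\<delta>\<close> is fixed before \<open>C\<^sub>\<delta>\<close> and \<open>T\<^sub>\<delta>\<close>, the bounds amount to convergence of the
  expected total variation to 0. A UR step maximises the variance reduction, and the
  reductions actually achieved are summable, so the maximal reduction tends to 0 in mean along UR
  steps; these keep conditional probability at least \<open>1 - \<rho>\<close>. Bounding the reduction at a fixed
  point from below on a small ball around it shows that the posterior variance vanishes in the limit at
  each point. Hence the latent field is measurable with respect to the limit history, and Levy's
  upward theorem, applied to the posterior density at each point, gives the convergence.
\<close>

section \<open>Levy's upward theorem in mean\<close>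

text \<open>Three obstacles shape the argument. The expected posterior weights points by a density
  without a bound uniform in \<open>t\<close> and in the data, so a variance drop that is small in
  Lebesgue average need not be small in the average that defines the reduction. Truncating the
  density at a level m helps because the mean excess over m is, by disintegration, that of the true
  posterior: it does not depend on \<open>t\<close>, and m can be fixed before \<open>t\<close>.
  Next, a UR step reveals the variance at a fixed point only through the mass that the expected
  posterior puts near this point. The mass is a conditional expectation of a positive variable, so
  it converges in mean to a limit that is positive almost surely, and this weight can be divided out
  at the end. Finally, the data on which one conditions are chosen by the algorithm itself. All
  identities therefore go through the regular conditional law, used as a kernel on path space, and
  convergence is taken in mean along a limit of the histories that contains the null events, where
  modifications on null sets are harmless.\<close>

definition limit_algebra :: "'w measure \<Rightarrow> (nat \<Rightarrow> 'w measure) \<Rightarrow> 'w measure" where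
  "limit_algebra M F = sigma (space M)
     {A \<in> sets M. \<forall>e>0. \<exists>n. \<exists>B\<in>sets (F n). measure M (sym_diff A B) < e}"

lemma (in prob_space) sigma_finite_subalgebraI: "subalgebra M G \<Longrightarrow> sigma_finite_subalgebra M G"
  by (rule finite_measure_subalgebra_is_sigma_finite)
     (simp add: finite_measure_subalgebra_def finite_measure_subalgebra_axioms_def finite_measure_axioms)

locale filtered_prob_space = prob_space +
  fixes F :: "nat \<Rightarrow> 'a measure"
  assumes subalg: "\<And>n. subalgebra M (F n)"
    and filt: "\<And>m n. m \<le> n \<Longrightarrow> sets (F m) \<subseteq> sets (F n)"
begin

lemma space_F [simp]: "space (F n) = space M"
  using subalg[of n] by (simp add: subalgebra_def)

lemma sets_F_subset: "A \<in> sets (F n) \<Longrightarrow> A \<in> sets M"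
  using subalg[of n] by (auto simp: subalgebra_def)

lemma measurable_F_mono: "f \<in> measurable (F m) N \<Longrightarrow> m \<le> n \<Longrightarrow> f \<in> measurable (F n) N"
  using filt by (intro measurable_from_subalg[of "F n" "F m"]) (auto simp: subalgebra_def)

abbreviation "approximable A \<equiv>
  A \<in> sets M \<and> (\<forall>e>0. \<exists>n. \<exists>B\<in>sets (F n). prob (sym_diff A B) < e)"

text \<open>Half of e pays for cutting the union down to finitely many sets, by continuity of the
  measure. The finitely many approximants then all lie in one algebra of the filtration, at the
  largest index involved.\<close>

lemma approximable_UN:
  assumes "\<And>i::nat. approximable (A i)"
  shows "approximable (\<Union>i. A i)"
proof (intro conjI allI impI)
  have [measurable]: "A i \<in> sets M" for i using assms by auto
  show "(\<Union>i. A i) \<in> sets M" by auto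
  fix e :: real assume "0 < e"
  have "(\<lambda>n. prob (\<Union>i\<le>n. A i)) \<longlonglongrightarrow> prob (\<Union>n. \<Union>i\<le>n. A i)"
    by (intro finite_Lim_measure_incseq) (auto simp: incseq_def intro: order_trans)
  also have "(\<Union>n. \<Union>i\<le>n. A i) = (\<Union>i. A i)" by auto
  finally have "\<forall>\<^sub>F n in sequentially. prob (\<Union>i. A i) - e/2 < prob (\<Union>i\<le>n. A i)"
    using \<open>0 < e\<close> by (intro order_tendstoD(1)) auto
  then obtain N where N: "prob (\<Union>i. A i) - e/2 < prob (\<Union>i\<le>N. A i)"
    by (auto simp: eventually_sequentially)
  \<comment> \<open>N + 1 sets have index at most N; each gets an equal share of the remaining e /
    2.\<close>
  define d where "d = e / (2 * (real N + 1))"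
  have "d > 0" using \<open>0 < e\<close> by (simp add: d_def)
  then have "\<forall>i. \<exists>n B. B \<in> sets (F n) \<and> prob (sym_diff (A i) B) < d"
    using assms by blast
  then obtain n B where nB: "\<And>i. B i \<in> sets (F (n i))" "\<And>i. prob (sym_diff (A i) (B i)) < d"
    by metis
  define m where "m = Max (n ` {..N})"
  have B: "B i \<in> sets (F m)" if "i \<le> N" for i
    using filt[of "n i" m] nB(1)[of i] that by (auto simp: m_def)
  have [measurable]: "B i \<in> sets M" for i using nB(1) sets_F_subset by blast
  define C where "C = (\<Union>i\<le>N. B i)"
  have "C \<in> sets (F m)" unfolding C_def using B by (intro sets.finite_UN) auto
  have "sym_diff (\<Union>i. A i) C \<subseteq> ((\<Union>i. A i) - (\<Union>i\<le>N. A i)) \<union> (\<Union>i\<le>N. sym_diff (A i) (B i))"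
    unfolding C_def by blast
  then have "prob (sym_diff (\<Union>i. A i) C)
      \<le> prob (((\<Union>i. A i) - (\<Union>i\<le>N. A i)) \<union> (\<Union>i\<le>N. sym_diff (A i) (B i)))"
    by (intro finite_measure_mono) auto
  also have "\<dots> \<le> prob ((\<Union>i. A i) - (\<Union>i\<le>N. A i)) + prob (\<Union>i\<le>N. sym_diff (A i) (B i))"
    by (intro measure_Un_le) auto
  also have "prob ((\<Union>i. A i) - (\<Union>i\<le>N. A i)) = prob (\<Union>i. A i) - prob (\<Union>i\<le>N. A i)"
    by (intro finite_measure_Diff) auto
  also have "prob (\<Union>i\<le>N. sym_diff (A i) (B i)) \<le> (\<Sum>i\<le>N. prob (sym_diff (A i) (B i)))"
    by (intro finite_measure_subadditive_finite) auto
  also have "\<dots> \<le> (\<Sum>i\<le>N. d)" by (intro sum_mono) (simp add: nB(2) less_imp_le)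
  also have "(\<Sum>i\<le>N. d) = e / 2" unfolding d_def by (simp add: field_simps)
  finally have "prob (sym_diff (\<Union>i. A i) C) < e" using N by linarith
  then show "\<exists>n. \<exists>B\<in>sets (F n). prob (sym_diff (\<Union>i. A i) B) < e"
    using \<open>C \<in> sets (F m)\<close> by blast
qed

lemma sigma_algebra_approximable: "sigma_algebra (space M) {A. approximable A}"
proof (unfold sigma_algebra_iff2, safe)
  fix A x assume "A \<in> sets M" "x \<in> A" then show "x \<in> space M"
    using sets.sets_into_space by blast
next
  show "\<exists>n. \<exists>B\<in>sets (F n). prob (sym_diff {} B) < e" if "0 < e" for e
    using that by (intro exI[of _ 0] bexI[of _ "{}"]) auto
next
  fix A and e :: real assume A: "A \<in> sets M" "0 < e"
    and "\<forall>e>0. \<exists>n. \<exists>B\<in>sets (F n). prob (sym_diff A B) < e"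
  then obtain n B where B: "B \<in> sets (F n)" "prob (sym_diff A B) < e" by blast
  have "sym_diff (space M - A) (space M - B) = sym_diff A B"
    using sets.sets_into_space[OF A(1)] sets.sets_into_space[OF B(1)] by auto
  moreover have "space M - B \<in> sets (F n)"
    using sets.compl_sets[OF B(1)] by simp
  ultimately show "\<exists>n. \<exists>B\<in>sets (F n). prob (sym_diff (space M - A) B) < e"
    using B(2) by (intro exI[of _ n] bexI[of _ "space M - B"]) auto
next
  fix A :: "nat \<Rightarrow> 'a set" assume "range A \<subseteq> {A. approximable A}"
  then have "\<And>i. approximable (A i)" by blast
  from approximable_UN[OF this]
  show "\<And>e. 0 < e \<Longrightarrow> \<exists>n. \<exists>B\<in>sets (F n). prob (sym_diff (\<Union> (range A)) B) < e" by simp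
qed auto

text \<open>The generating family is already closed under the operations of a sigma-algebra, so
  membership is exactly approximability. All null events of \<open>M\<close> belong to it, since the
  empty set approximates them: this is the completion, inside \<open>M\<close>, of what the
  filtration generates.\<close>

lemma sets_limit_algebra: "sets (limit_algebra M F) = {A. approximable A}"
proof -
  interpret sigma_algebra "space M" "{A. approximable A}" by (rule sigma_algebra_approximable)
  show ?thesis unfolding limit_algebra_def
    by (subst sets_measure_of) (use space_closed sigma_sets_eq in auto)
qed

lemma space_limit_algebra [simp]: "space (limit_algebra M F) = space M"
  by (simp add: limit_algebra_def space_measure_of_conv)

lemma subalgebra_limit: "subalgebra M (limit_algebra M F)"
  by (auto simp: subalgebra_def sets_limit_algebra)

lemma sets_F_limit: "sets (F n) \<subseteq> sets (limit_algebra M F)"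
proof
  fix A assume A: "A \<in> sets (F n)"
  have "\<exists>n. \<exists>B\<in>sets (F n). prob (sym_diff A B) < e" if "0 < e" for e
    using A that by (intro exI[of _ n] bexI[of _ A]) auto
  then show "A \<in> sets (limit_algebra M F)" using sets_F_subset[OF A] by (auto simp: sets_limit_algebra)
qed

lemma subalgebra_F_limit: "subalgebra (limit_algebra M F) (F n)"
  using sets_F_limit by (auto simp: subalgebra_def)

lemma measurable_F_limit: "f \<in> measurable (F n) N \<Longrightarrow> f \<in> measurable (limit_algebra M F) N"
  by (rule measurable_from_subalg[OF subalgebra_F_limit])

text \<open>Events that differ by a null set have the same approximants, so membership passes from
  preimages under \<open>X\<close> to preimages under \<open>Y\<close>.\<close>

lemma limit_algebra_AE_cong:
  fixes X Y :: "'a \<Rightarrow> 'b::topological_space"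
  assumes X: "X \<in> borel_measurable (limit_algebra M F)" and Y: "Y \<in> borel_measurable M"
    and ae: "AE w in M. X w = Y w"
  shows "Y \<in> borel_measurable (limit_algebra M F)"
proof (rule measurableI)
  fix A :: "'b set" assume A: "A \<in> sets borel"
  define S where "S = X -` A \<inter> space M"
  define T where "T = Y -` A \<inter> space M"
  have S: "S \<in> sets (limit_algebra M F)" using measurable_sets[OF X A] by (simp add: S_def)
  have T: "T \<in> sets M" using measurable_sets[OF Y A] by (simp add: T_def)
  have SM: "S \<in> sets M" using S by (simp add: sets_limit_algebra)
  have "AE w in M. w \<notin> sym_diff T S" using ae by (auto simp: S_def T_def)
  then have 0: "prob (sym_diff T S) = 0" using S SM T by (intro prob_eq_0[THEN iffD2]) auto
  have "\<exists>n. \<exists>B\<in>sets (F n). prob (sym_diff T B) < e" if "0 < e" for e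
  proof -
    obtain n B where B: "B \<in> sets (F n)" "prob (sym_diff S B) < e"
      using S \<open>0 < e\<close> by (auto simp: sets_limit_algebra)
    have BM: "B \<in> sets M" using B sets_F_subset by blast
    have "prob (sym_diff T B) \<le> prob (sym_diff T S \<union> sym_diff S B)"
      using T SM BM by (intro finite_measure_mono) auto
    also have "\<dots> \<le> prob (sym_diff T S) + prob (sym_diff S B)"
      using T SM BM by (intro measure_Un_le) auto
    finally have "prob (sym_diff T B) < e" using B(2) 0 by simp
    then show ?thesis using B(1) by blast
  qed
  then show "Y -` A \<inter> space (limit_algebra M F) \<in> sets (limit_algebra M F)"
    using T by (auto simp: sets_limit_algebra T_def)
qed auto

text \<open>Serves to show that the latent field is determined by the whole history: the posterior
  means will converge to it in mean square.\<close>

lemma limit_algebra_L2_limit: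
  fixes Z :: "'a \<Rightarrow> real"
  assumes Zn: "\<And>n. Zn n \<in> borel_measurable (F n)" and Z [measurable]: "Z \<in> borel_measurable M"
    and int: "\<And>n. integrable M (\<lambda>w. (Zn n w - Z w)\<^sup>2)"
    and lim: "(\<lambda>n. \<integral>w. (Zn n w - Z w)\<^sup>2 \<partial>M) \<longlonglongrightarrow> 0"
  shows "Z \<in> borel_measurable (limit_algebra M F)"
proof -
  obtain r where "AE w in M. (\<lambda>n. (Zn (r n) w - Z w)\<^sup>2) \<longlonglongrightarrow> 0"
    using tendsto_L1_AE_subseq[of M "\<lambda>n w. (Zn n w - Z w)\<^sup>2"] int lim by auto
  then have ae: "AE w in M. lim (\<lambda>n. Zn (r n) w) = Z w"
  proof (eventually_elim)
    case (elim w)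
    have "(\<lambda>n. sqrt ((Zn (r n) w - Z w)\<^sup>2)) \<longlonglongrightarrow> sqrt 0"
      by (intro tendsto_real_sqrt elim)
    then have "(\<lambda>n. Zn (r n) w - Z w) \<longlonglongrightarrow> 0"
      by (simp add: tendsto_rabs_zero_iff)
    then have "(\<lambda>n. Zn (r n) w) \<longlonglongrightarrow> Z w" by (simp add: LIM_zero_iff)
    then show ?case by (rule limI)
  qed
  \<comment> \<open>\<open>lim\<close> has some value at every point, also where the subsequence
    diverges, and is measurable as such; it differs from \<open>Z\<close> on a null set
    only.\<close>
  have "(\<lambda>w. lim (\<lambda>n. Zn (r n) w)) \<in> borel_measurable (limit_algebra M F)"
    by (intro borel_measurable_lim_metric measurable_F_limit[OF Zn])
  from limit_algebra_AE_cong[OF this Z ae] show ?thesis .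
qed

text \<open>Monotonicity is applied to \<open>X\<close> and to \<open>- X\<close>, both dominated by
  the absolute value, and conditioning preserves the integral.\<close>

lemma integral_abs_cond_exp_le:
  assumes G: "subalgebra M G" and X: "integrable M X"
  shows "(\<integral>w. \<bar>real_cond_exp M G X w\<bar> \<partial>M) \<le> (\<integral>w. \<bar>X w\<bar> \<partial>M)"
proof -
  interpret G: sigma_finite_subalgebra M G by (rule sigma_finite_subalgebraI[OF G])
  have 1: "AE w in M. real_cond_exp M G X w \<le> real_cond_exp M G (\<lambda>w. \<bar>X w\<bar>) w"
    by (intro G.real_cond_exp_mono) (auto intro!: X)
  have 2: "AE w in M. real_cond_exp M G (\<lambda>w. - X w) w \<le> real_cond_exp M G (\<lambda>w. \<bar>X w\<bar>) w"
    by (intro G.real_cond_exp_mono) (auto intro!: X)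
  have 3: "AE w in M. real_cond_exp M G (\<lambda>w. (-1) * X w) w = (-1) * real_cond_exp M G X w"
    by (intro G.real_cond_exp_cmult X)
  have "AE w in M. \<bar>real_cond_exp M G X w\<bar> \<le> real_cond_exp M G (\<lambda>w. \<bar>X w\<bar>) w"
    using 1 2 3 by eventually_elim auto
  then have "(\<integral>w. \<bar>real_cond_exp M G X w\<bar> \<partial>M) \<le> (\<integral>w. real_cond_exp M G (\<lambda>w. \<bar>X w\<bar>) w \<partial>M)"
    by (intro integral_mono_AE integrable_abs G.real_cond_exp_int X) auto
  then show ?thesis by (simp add: G.real_cond_exp_int X)
qed

text \<open>Induction on integrable functions over the restricted measure: the case of an indicator
  is the definition of the limit algebra, and sums and dominated limits preserve approximability in
  mean.\<close>

lemma L1_approx: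
  fixes X :: "'a \<Rightarrow> real"
  assumes "integrable M X" "X \<in> borel_measurable (limit_algebra M F)"
  shows "\<forall>e>0. \<exists>n Y. Y \<in> borel_measurable (F n) \<and> integrable M Y \<and> (\<integral>w. \<bar>X w - Y w\<bar> \<partial>M) < e"
proof -
  let ?R = "restr_to_subalg M (limit_algebra M F)"
  have "integrable ?R X" by (rule integrable_in_subalg[OF subalgebra_limit assms(2,1)])
  then show ?thesis
  proof (induct X rule: integrable_induct)
    case (base A c)
    show ?case
    proof (intro allI impI)
      fix e :: real assume "0 < e"
      have A: "approximable A" using base by (simp add: sets_restr_to_subalg[OF subalgebra_limit] sets_limit_algebra)
      \<comment> \<open>The summand 1 keeps the quotient defined when c = 0.\<close>
      have "e / (\<bar>c\<bar> + 1) > 0" using \<open>0 < e\<close> by (simp add: add_nonneg_pos)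
      then obtain n B where B: "B \<in> sets (F n)" "prob (sym_diff A B) < e / (\<bar>c\<bar> + 1)"
        using A by blast
      have BM: "B \<in> sets M" using B sets_F_subset by blast
      have "(\<integral>w. \<bar>indicator A w *\<^sub>R c - indicator B w *\<^sub>R c\<bar> \<partial>M) = (\<integral>w. \<bar>c\<bar> * indicator (sym_diff A B) w \<partial>M)"
        by (intro Bochner_Integration.integral_cong) (auto simp: indicator_def)
      also have "\<dots> = \<bar>c\<bar> * prob (sym_diff A B)" using A BM by auto
      also have "\<dots> \<le> (\<bar>c\<bar> + 1) * prob (sym_diff A B)" by (intro mult_right_mono) auto
      also have "\<dots> < e" using B(2) by (simp add: field_simps add_nonneg_pos)
      finally show "\<exists>n Y. Y \<in> borel_measurable (F n) \<and> integrable M Y \<and> (\<integral>w. \<bar>indicator A w *\<^sub>R c - Y w\<bar> \<partial>M) < e"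
        using B(1) BM by (intro exI[of _ n] exI[of _ "\<lambda>w. indicator B w *\<^sub>R c"]) (auto simp: less_top[symmetric])
    qed
  next
    case (add f g)
    have fM: "integrable M f" "integrable M g"
      using add integrable_from_subalg[OF subalgebra_limit] by auto
    show ?case
    proof (intro allI impI)
      fix e :: real assume "0 < e"
      then have "e/2 > 0" by simp
      from add(2)[rule_format, OF this] add(4)[rule_format, OF this] obtain n Y n' Y'
        where Y: "Y \<in> borel_measurable (F n)" "integrable M Y" "(\<integral>w. \<bar>f w - Y w\<bar> \<partial>M) < e/2"
        and Y': "Y' \<in> borel_measurable (F n')" "integrable M Y'" "(\<integral>w. \<bar>g w - Y' w\<bar> \<partial>M) < e/2"
        by blast
      let ?m = "max n n'"
      have "Y \<in> borel_measurable (F ?m)" "Y' \<in> borel_measurable (F ?m)"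
        by (auto intro: measurable_F_mono Y(1) Y'(1))
      moreover have "(\<integral>w. \<bar>f w + g w - (Y w + Y' w)\<bar> \<partial>M) \<le> (\<integral>w. \<bar>f w - Y w\<bar> + \<bar>g w - Y' w\<bar> \<partial>M)"
        using fM Y(2) Y'(2) by (intro integral_mono) auto
      moreover have "\<dots> < e" using fM Y Y' by (subst Bochner_Integration.integral_add) auto
      ultimately show "\<exists>n Z. Z \<in> borel_measurable (F n) \<and> integrable M Z \<and> (\<integral>w. \<bar>f w + g w - Z w\<bar> \<partial>M) < e"
        using Y(2) Y'(2) by (intro exI[of _ ?m] exI[of _ "\<lambda>w. Y w + Y' w"]) auto
    qed
  next
    case (lim f s)
    have sM: "integrable M (s i)" "integrable M f" for i
      using lim(1)[of i] lim(5) integrable_from_subalg[OF subalgebra_limit] by auto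
    have "(\<lambda>i. \<integral>w. \<bar>f w - s i w\<bar> \<partial>M) \<longlonglongrightarrow> (\<integral>w. 0 \<partial>M)"
    \<comment> \<open>The induction rule supplies approximants with modulus at most twice that of f,
      whence the factor 3.\<close>
    proof (rule integral_dominated_convergence[where w="\<lambda>w. 3 * \<bar>f w\<bar>"])
      show "AE w in M. (\<lambda>i. \<bar>f w - s i w\<bar>) \<longlonglongrightarrow> 0"
      proof (rule AE_I2)
        fix w assume "w \<in> space M"
        then have "(\<lambda>i. s i w) \<longlonglongrightarrow> f w" using lim(3) by (simp add: space_restr_to_subalg)
        then have "(\<lambda>i. \<bar>f w - s i w\<bar>) \<longlonglongrightarrow> \<bar>f w - f w\<bar>" by (intro tendsto_intros)
        then show "(\<lambda>i. \<bar>f w - s i w\<bar>) \<longlonglongrightarrow> 0" by simp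
      qed
      show "AE w in M. norm \<bar>f w - s i w\<bar> \<le> 3 * \<bar>f w\<bar>" for i
      proof (rule AE_I2)
        fix w assume "w \<in> space M"
        then have "norm (s i w) \<le> 2 * norm (f w)" using lim(4) by (simp add: space_restr_to_subalg)
        then show "norm \<bar>f w - s i w\<bar> \<le> 3 * \<bar>f w\<bar>" by simp
      qed
    qed (use sM in auto)
    then have L: "(\<lambda>i. \<integral>w. \<bar>f w - s i w\<bar> \<partial>M) \<longlonglongrightarrow> 0" by simp
    show ?case
    proof (intro allI impI)
      fix e :: real assume "0 < e"
      then have "\<forall>\<^sub>F i in sequentially. (\<integral>w. \<bar>f w - s i w\<bar> \<partial>M) < e/2"
        by (intro order_tendstoD(2)[OF L]) auto
      then obtain i where i: "(\<integral>w. \<bar>f w - s i w\<bar> \<partial>M) < e/2" by (auto simp: eventually_sequentially)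
      have "e/2 > 0" using \<open>0 < e\<close> by simp
      from lim(2)[rule_format, OF this, of i] obtain n Y
        where Y: "Y \<in> borel_measurable (F n)" "integrable M Y" "(\<integral>w. \<bar>s i w - Y w\<bar> \<partial>M) < e/2"
        by blast
      have "(\<integral>w. \<bar>f w - Y w\<bar> \<partial>M) \<le> (\<integral>w. \<bar>f w - s i w\<bar> + \<bar>s i w - Y w\<bar> \<partial>M)"
        using sM Y(2) by (intro integral_mono) auto
      also have "\<dots> < e" using sM Y i by (subst Bochner_Integration.integral_add) auto
      finally show "\<exists>n Y. Y \<in> borel_measurable (F n) \<and> integrable M Y \<and> (\<integral>w. \<bar>f w - Y w\<bar> \<partial>M) < e"
        using Y by blast
    qed
  qed
qed

text \<open>From index m on, conditioning fixes the approximant \<open>Y\<close> and contracts the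
  error \<open>X - Y\<close> in mean, so the distance is at most twice the error of
  approximation.\<close>

lemma levy_upward_L1:
  fixes X :: "'a \<Rightarrow> real"
  assumes X: "integrable M X" "X \<in> borel_measurable (limit_algebra M F)"
  shows "(\<lambda>n. \<integral>w. \<bar>real_cond_exp M (F n) X w - X w\<bar> \<partial>M) \<longlonglongrightarrow> 0"
proof (rule LIMSEQ_I)
  fix e :: real assume "0 < e"
  then have "e/2 > 0" by simp
  from L1_approx[OF X, rule_format, OF this] obtain m Y where
    Y: "Y \<in> borel_measurable (F m)" "integrable M Y" "(\<integral>w. \<bar>X w - Y w\<bar> \<partial>M) < e/2" by blast
  show "\<exists>no. \<forall>n\<ge>no. norm ((\<integral>w. \<bar>real_cond_exp M (F n) X w - X w\<bar> \<partial>M) - 0) < e"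
  proof (intro exI allI impI)
    fix n assume "m \<le> n"
    interpret G: sigma_finite_subalgebra M "F n" by (rule sigma_finite_subalgebraI[OF subalg])
    have Yn: "Y \<in> borel_measurable (F n)"
      by (rule measurable_F_mono[OF Y(1) \<open>m \<le> n\<close>])
    have "AE w in M. real_cond_exp M (F n) (\<lambda>w. X w - Y w) w = real_cond_exp M (F n) X w - real_cond_exp M (F n) Y w"
      by (intro G.real_cond_exp_diff X Y)
    moreover have "AE w in M. real_cond_exp M (F n) Y w = Y w"
      by (intro G.real_cond_exp_F_meas Y Yn)
    ultimately have "AE w in M. \<bar>real_cond_exp M (F n) X w - X w\<bar> \<le> \<bar>real_cond_exp M (F n) (\<lambda>w. X w - Y w) w\<bar> + \<bar>X w - Y w\<bar>"
      by eventually_elim auto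
    then have "(\<integral>w. \<bar>real_cond_exp M (F n) X w - X w\<bar> \<partial>M)
        \<le> (\<integral>w. \<bar>real_cond_exp M (F n) (\<lambda>w. X w - Y w) w\<bar> + \<bar>X w - Y w\<bar> \<partial>M)"
      using X Y by (intro integral_mono_AE integrable_abs Bochner_Integration.integrable_diff
        Bochner_Integration.integrable_add G.real_cond_exp_int) auto
    also have "\<dots> = (\<integral>w. \<bar>real_cond_exp M (F n) (\<lambda>w. X w - Y w) w\<bar> \<partial>M) + (\<integral>w. \<bar>X w - Y w\<bar> \<partial>M)"
      using X Y by (intro Bochner_Integration.integral_add integrable_abs Bochner_Integration.integrable_diff
         G.real_cond_exp_int) auto
    also have "\<dots> \<le> (\<integral>w. \<bar>X w - Y w\<bar> \<partial>M) + (\<integral>w. \<bar>X w - Y w\<bar> \<partial>M)"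
      using X Y by (intro add_right_mono integral_abs_cond_exp_le subalg) auto
    also have "\<dots> < e" using Y(3) by simp
    finally show "norm ((\<integral>w. \<bar>real_cond_exp M (F n) X w - X w\<bar> \<partial>M) - 0) < e" by simp
  qed
qed

text \<open>By the tower property \<open>X\<close> may be replaced by its projection on the limit
  algebra without changing any of the conditional expectations.\<close>

lemma levy_upward_L1_cond_exp:
  fixes X :: "'a \<Rightarrow> real"
  assumes X: "integrable M X"
  defines "Y \<equiv> real_cond_exp M (limit_algebra M F) X"
  shows "(\<lambda>n. \<integral>w. \<bar>real_cond_exp M (F n) X w - Y w\<bar> \<partial>M) \<longlonglongrightarrow> 0"
proof -
  interpret L: sigma_finite_subalgebra M "limit_algebra M F"
    by (rule sigma_finite_subalgebraI[OF subalgebra_limit])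
  have Y: "integrable M Y" "Y \<in> borel_measurable (limit_algebra M F)"
    unfolding Y_def by (auto intro: L.real_cond_exp_int X)
  have "(\<integral>w. \<bar>real_cond_exp M (F n) X w - Y w\<bar> \<partial>M) = (\<integral>w. \<bar>real_cond_exp M (F n) Y w - Y w\<bar> \<partial>M)" for n
  proof -
    interpret G: sigma_finite_subalgebra M "F n" by (rule sigma_finite_subalgebraI[OF subalg])
    have "AE w in M. real_cond_exp M (F n) Y w = real_cond_exp M (F n) X w"
      unfolding Y_def by (intro G.real_cond_exp_nested_subalg subalgebra_limit subalgebra_F_limit X)
    then show ?thesis using Y(1) X by (intro integral_cong_AE) (auto simp: Y_def)
  qed
  then show ?thesis using levy_upward_L1[OF Y] by simp
qed

end

section \<open>Law of large numbers for adapted events\<close>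

text \<open>Between consecutive squares the sum moves by at most 2 n, which is negligible against
  the square of n.\<close>

lemma average_tendsto_zero_of_squares:
  fixes D :: "nat \<Rightarrow> real"
  assumes bd: "\<And>t. \<bar>D t\<bar> \<le> 1"
    and sq: "(\<lambda>n. (\<Sum>t<(Suc n)\<^sup>2. D t) / real ((Suc n)\<^sup>2)) \<longlonglongrightarrow> 0"
  shows "(\<lambda>T. (\<Sum>t<T. D t) / real T) \<longlonglongrightarrow> 0"
proof (rule LIMSEQ_I)
  fix e :: real assume "0 < e"
  then have "e/2 > 0" by simp
  from LIMSEQ_D[OF sq this] obtain n0 where
    n0: "\<And>n. n \<ge> n0 \<Longrightarrow> \<bar>(\<Sum>t<(Suc n)\<^sup>2. D t) / real ((Suc n)\<^sup>2)\<bar> < e/2" by auto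
  obtain n1 :: nat where n1: "4 / e < real n1" using reals_Archimedean2 by blast
  \<comment> \<open>The successor is there because the hypothesis indexes squares by
    \<open>Suc n\<close>: the square of n is its term n - 1, which must lie beyond
    \<open>n0\<close>. The choice of \<open>n1\<close> makes 2 / n smaller than e / 2.\<close>
  define N where "N = Suc (max n0 n1)"
  show "\<exists>no. \<forall>T\<ge>no. norm ((\<Sum>t<T. D t) / real T - 0) < e"
  proof (intro exI allI impI)
    fix T :: nat assume T: "N\<^sup>2 \<le> T"
    define n where "n = nat \<lfloor>sqrt (real T)\<rfloor>"
    have n: "real n \<le> sqrt (real T)" "sqrt (real T) < real n + 1" by (auto simp: n_def)
    have "real N \<le> sqrt (real T)"
      using T by (intro real_le_rsqrt) (simp flip: of_nat_power)
    with n(2) have "N \<le> n" by linarith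
    then have n_pos: "0 < n" and nn: "n0 \<le> n - 1" "n1 \<le> n" unfolding N_def by auto
    have "(real n)\<^sup>2 \<le> real T" using power_mono[OF n(1), of 2] by simp
    then have nT: "n\<^sup>2 \<le> T" by (simp flip: of_nat_power)
    have "real T = (sqrt (real T))\<^sup>2" by simp
    also have "\<dots> \<le> (real n + 1)\<^sup>2" using n(2) by (intro power_mono) auto
    finally have T2: "real T - (real n)\<^sup>2 \<le> 2 * real n + 1" by (simp add: power2_eq_square algebra_simps)
    \<comment> \<open>T stays strictly below the next square, so 2 n + 1 improves to 2 n and the
      quotient below is exactly 2 / n.\<close>
    then have T3: "real T - (real n)\<^sup>2 \<le> 2 * real n"
    proof -
      have "T \<noteq> (n+1)\<^sup>2"
      proof
        assume "T = (n+1)\<^sup>2"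
        then have "sqrt (real T) = real n + 1" by (simp add: real_sqrt_unique)
        with n(2) show False by simp
      qed
      moreover have "T \<le> (n+1)\<^sup>2"
        using T2 by (simp add: power2_eq_square algebra_simps flip: of_nat_le_iff[where 'a=real])
      ultimately have "T \<le> n\<^sup>2 + 2 * n" by (simp add: power2_eq_square)
      then have "real T \<le> real (n\<^sup>2 + 2 * n)" by (simp only: of_nat_le_iff)
      then show ?thesis by simp
    qed
    have "{..<T} = {..<n\<^sup>2} \<union> {n\<^sup>2..<T}" using nT by auto
    then have "(\<Sum>t<T. D t) = (\<Sum>t<n\<^sup>2. D t) + (\<Sum>t\<in>{n\<^sup>2..<T}. D t)"
      by (simp add: sum.union_disjoint ivl_disj_int)
    moreover have "\<bar>\<Sum>t\<in>{n\<^sup>2..<T}. D t\<bar> \<le> (\<Sum>t\<in>{n\<^sup>2..<T}. 1)"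
      by (rule order_trans[OF sum_abs sum_mono]) (rule bd)
    moreover have "(\<Sum>t\<in>{n\<^sup>2..<T}. 1::real) = real T - (real n)\<^sup>2" using nT by (simp add: of_nat_diff)
    ultimately have S: "\<bar>\<Sum>t<T. D t\<bar> \<le> \<bar>\<Sum>t<n\<^sup>2. D t\<bar> + 2 * real n" using T3 by linarith
    have T0: "0 < real T" using nT n_pos by (metis gr_zeroI of_nat_0_less_iff not_less zero_less_power)
    have "\<bar>(\<Sum>t<T. D t) / real T\<bar> \<le> (\<bar>\<Sum>t<n\<^sup>2. D t\<bar> + 2 * real n) / real T"
      using S T0 by (simp add: divide_right_mono)
    also have "\<dots> \<le> (\<bar>\<Sum>t<n\<^sup>2. D t\<bar> + 2 * real n) / (real n)\<^sup>2"
      using n_pos T0 \<open>(real n)\<^sup>2 \<le> real T\<close> by (intro divide_left_mono) auto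
    also have "\<dots> = \<bar>\<Sum>t<n\<^sup>2. D t\<bar> / (real n)\<^sup>2 + 2 / real n"
      using n_pos by (simp add: add_divide_distrib power2_eq_square)
    also have "\<bar>\<Sum>t<n\<^sup>2. D t\<bar> / (real n)\<^sup>2 < e/2"
      using n0[OF nn(1)] n_pos by (simp del: of_nat_Suc)
    also have "2 / real n < e/2"
    proof -
      have "4 / e < real n" using n1 nn(2) by linarith
      then show ?thesis using \<open>0 < e\<close> n_pos by (simp add: field_simps)
    qed
    finally show "norm ((\<Sum>t<T. D t) / real T - 0) < e" by simp
  qed
qed

lemma (in prob_space) cond_prob_bounds:
  assumes "subalgebra M G" "A \<in> sets M"
  shows "AE w in M. 0 \<le> real_cond_exp M G (indicat_real A) w \<and> real_cond_exp M G (indicat_real A) w \<le> 1"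
proof -
  interpret G: sigma_finite_subalgebra M G
    by (rule sigma_finite_subalgebraI) (rule assms(1))
  have i: "integrable M (indicat_real A)" using assms by (auto simp: less_top[symmetric])
  have "AE w in M. real_cond_exp M G (indicat_real A) w \<ge> 0"
    by (rule G.real_cond_exp_ge_c[OF i]) auto
  moreover have "AE w in M. real_cond_exp M G (indicat_real A) w \<le> 1"
    by (rule G.real_cond_exp_le_c[OF i]) (auto simp: indicator_def)
  ultimately show ?thesis by eventually_elim auto
qed

text \<open>The differences are orthogonal, so the sum of the first T of them has second moment at
  most T. Along squares the averages have summable second moments and hence vanish almost surely;
  the bound 1 on each difference fills the gaps between squares.\<close>

lemma (in prob_space) cond_prob_slln:
  fixes G :: "nat \<Rightarrow> 'a measure" and E :: "nat \<Rightarrow> 'a set"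
  assumes sub: "\<And>t. subalgebra M (G t)"
    and mono: "\<And>s t. s \<le> t \<Longrightarrow> sets (G s) \<subseteq> sets (G t)"
    and E: "\<And>t. E t \<in> sets (G (Suc t))"
  defines "D \<equiv> \<lambda>t w. indicat_real (E t) w - real_cond_exp M (G t) (indicat_real (E t)) w"
  shows "AE w in M. (\<lambda>T. (\<Sum>t<T. D t w) / real T) \<longlonglongrightarrow> 0"
proof -
  have spG: "space (G t) = space M" for t using sub[of t] by (simp add: subalgebra_def)
  have EM: "E t \<in> sets M" for t using E[of t] sub[of "Suc t"] by (auto simp: subalgebra_def)
  have Gmono: "f \<in> borel_measurable (G s) \<Longrightarrow> s \<le> t \<Longrightarrow> f \<in> borel_measurable (G t)"
    for f :: "'a \<Rightarrow> real" and s t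
    using mono[of s t] by (intro measurable_from_subalg[of "G t" "G s"]) (auto simp: subalgebra_def spG)
  have Dm: "D t \<in> borel_measurable (G (Suc t))" for t
    unfolding D_def by (intro borel_measurable_diff borel_measurable_indicator E
      Gmono[OF borel_measurable_cond_exp, of t "Suc t"]) simp
  have [measurable]: "D t \<in> borel_measurable M" for t
    using measurable_from_subalg[OF sub Dm] .
  have Dbd: "AE w in M. \<forall>t. \<bar>D t w\<bar> \<le> 1"
  proof (subst AE_all_countable, intro allI)
    fix t show "AE w in M. \<bar>D t w\<bar> \<le> 1"
      using cond_prob_bounds[OF sub EM, of t t] by eventually_elim (auto simp: D_def indicator_def)
  qed
  define S where "S T w = (\<Sum>t<T. D t w)" for T w
  have SG: "S T \<in> borel_measurable (G T)" for T
    unfolding S_def using Dm Gmono by (intro borel_measurable_sum) (metis Suc_leI lessThan_iff)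
  have [measurable]: "S T \<in> borel_measurable M" for T
    using measurable_from_subalg[OF sub SG] .
  have Sbd: "AE w in M. \<bar>S T w\<bar> \<le> real T" for T
    using Dbd
  proof eventually_elim
    case (elim w)
    have "\<bar>S T w\<bar> \<le> (\<Sum>t<T. 1)" unfolding S_def by (rule order_trans[OF sum_abs sum_mono]) (use elim in auto)
    then show ?case by simp
  qed
  have Sint: "integrable M (\<lambda>w. S T w * h w)" if [measurable]: "h \<in> borel_measurable M" and "AE w in M. \<bar>h w\<bar> \<le> B" for T h B
  proof (rule integrable_const_bound[where B="real T * B"])
    show "AE w in M. norm (S T w * h w) \<le> real T * B"
      using Sbd[of T] that(2) by eventually_elim (simp add: abs_mult mult_mono)
  qed auto
  \<comment> \<open>\<open>S T\<close> is measurable with respect to \<open>G T\<close>, so under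
    the integral the indicator may be exchanged for its conditional probability.\<close>
  have orth: "(\<integral>w. S T w * D T w \<partial>M) = 0" for T
  proof -
    interpret G: sigma_finite_subalgebra M "G T"
      by (rule sigma_finite_subalgebraI) (rule sub)
    have i: "integrable M (\<lambda>w. S T w * indicat_real (E T) w)"
      using EM by (intro Sint[of _ 1]) (auto simp: indicator_def)
    note c = G.real_cond_exp_intg[OF i SG borel_measurable_indicator[OF EM]]
    show ?thesis unfolding D_def by (simp add: right_diff_distrib i c)
  qed
  have var: "(\<integral>w. (S T w)\<^sup>2 \<partial>M) \<le> real T" for T
  proof (induct T)
    case 0 then show ?case by (simp add: S_def)
  next
    case (Suc T)
    have "(S (Suc T) w)\<^sup>2 = (S T w * S T w + 2 * (S T w * D T w)) + (D T w)\<^sup>2" for w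
      by (simp add: S_def power2_eq_square algebra_simps)
    moreover have "integrable M (\<lambda>w. S T w * S T w)" by (intro Sint[OF _ Sbd]) auto
    moreover have "integrable M (\<lambda>w. S T w * D T w)"
      using Dbd by (intro Sint[of _ 1]) (auto elim!: eventually_mono)
    moreover have iD: "integrable M (\<lambda>w. (D T w)\<^sup>2)"
      by (rule integrable_const_bound[where B=1]) (use Dbd in \<open>auto elim!: eventually_mono simp: abs_square_le_1\<close>)
    ultimately have "(\<integral>w. (S (Suc T) w)\<^sup>2 \<partial>M) = (\<integral>w. S T w * S T w \<partial>M) + (\<integral>w. (D T w)\<^sup>2 \<partial>M)"
      by (simp add: orth)
    moreover have "(\<integral>w. (D T w)\<^sup>2 \<partial>M) \<le> (\<integral>w. 1 \<partial>M)"
      using Dbd by (intro integral_mono_AE iD) (auto elim!: eventually_mono simp: abs_square_le_1)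
    ultimately show ?case using Suc by (simp add: power2_eq_square prob_space)
  qed
  define a where "a n w = (S ((Suc n)\<^sup>2) w / real ((Suc n)\<^sup>2))\<^sup>2" for n w
  have [measurable]: "a n \<in> borel_measurable M" for n unfolding a_def by measurable
  have "(\<integral>\<^sup>+w. ennreal (a n w) \<partial>M) \<le> ennreal (1 / (real (Suc n))\<^sup>2)" for n
  proof -
    have i: "integrable M (\<lambda>w. (S ((Suc n)\<^sup>2) w)\<^sup>2)"
      unfolding power2_eq_square[of "S _ _"] by (intro Sint[OF _ Sbd]) auto
    have "(\<integral>\<^sup>+w. ennreal (a n w) \<partial>M) = ennreal (\<integral>w. a n w \<partial>M)"
      using i by (intro nn_integral_eq_integral) (auto simp: a_def power_divide)
    also have "(\<integral>w. a n w \<partial>M) = (\<integral>w. (S ((Suc n)\<^sup>2) w)\<^sup>2 \<partial>M) / (real ((Suc n)\<^sup>2))\<^sup>2"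
      by (simp add: a_def power_divide)
    also have "\<dots> \<le> real ((Suc n)\<^sup>2) / (real ((Suc n)\<^sup>2))\<^sup>2"
      by (intro divide_right_mono var) auto
    also have "\<dots> = 1 / (real (Suc n))\<^sup>2" unfolding of_nat_power by (simp add: power2_eq_square del: of_nat_Suc)
    finally show ?thesis by (simp add: ennreal_leI)
  qed
  then have "(\<Sum>n. \<integral>\<^sup>+w. ennreal (a n w) \<partial>M) \<le> (\<Sum>n. ennreal (1 / (real (Suc n))\<^sup>2))"
    by (intro suminf_le) auto
  also have "\<dots> < \<infinity>"
  proof -
    have "summable (\<lambda>n. 1 / (real (Suc n))\<^sup>2)"
      using inverse_power_summable[of 2, where 'a=real] by (subst summable_Suc_iff) (simp add: inverse_eq_divide)
    then show ?thesis by (subst suminf_ennreal2) auto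
  qed
  finally have "(\<integral>\<^sup>+w. (\<Sum>n. ennreal (a n w)) \<partial>M) \<noteq> \<infinity>"
    by (subst nn_integral_suminf) auto
  then have "AE w in M. (\<Sum>n. ennreal (a n w)) \<noteq> \<infinity>"
    by (intro nn_integral_PInf_AE) auto
  then show ?thesis
    using Dbd
  proof eventually_elim
    case (elim w)
    have "summable (\<lambda>n. a n w)"
      using elim(1) by (intro summable_suminf_not_top) (auto simp: a_def)
    then have "(\<lambda>n. a n w) \<longlonglongrightarrow> 0" by (rule summable_LIMSEQ_zero)
    then have "(\<lambda>n. sqrt (a n w)) \<longlonglongrightarrow> sqrt 0" by (rule tendsto_real_sqrt)
    then have "(\<lambda>n. \<bar>S ((Suc n)\<^sup>2) w / real ((Suc n)\<^sup>2)\<bar>) \<longlonglongrightarrow> 0"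
      unfolding a_def real_sqrt_abs by simp
    then have "(\<lambda>n. S ((Suc n)\<^sup>2) w / real ((Suc n)\<^sup>2)) \<longlonglongrightarrow> 0"
      by (rule tendsto_rabs_zero_cancel)
    then show ?case
      using elim(2) by (intro average_tendsto_zero_of_squares) (auto simp: S_def)
  qed
qed

section \<open>Disintegration along a conditional law\<close>

text \<open>The hypothesis holds for each set \<open>A\<close> outside a null set of its own. That
  is enough: both sides are integrals against measures on the product space, and these agree once
  they agree on rectangles, a generator closed under intersection.\<close>

lemma (in prob_space) disintegration:
  assumes H: "subalgebra M H" and k: "k \<in> H \<rightarrow>\<^sub>M prob_algebra N" and F: "F \<in> M \<rightarrow>\<^sub>M N"
    and eq: "\<And>A. A \<in> sets N \<Longrightarrow>
      AE w in M. real_cond_exp M H (indicat_real {w \<in> space M. F w \<in> A}) w = measure (k w) A"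
    and \<Phi>: "\<Phi> \<in> borel_measurable (H \<Otimes>\<^sub>M N)"
  shows "(\<integral>\<^sup>+w. \<Phi> (w, F w) \<partial>M) = (\<integral>\<^sup>+w. \<integral>\<^sup>+g. \<Phi> (w, g) \<partial>k w \<partial>M)"
proof -
  interpret H: sigma_finite_subalgebra M H
    by (rule sigma_finite_subalgebraI) (rule H)
  have sp: "space H = space M" using H by (simp add: subalgebra_def)
  have idH: "(\<lambda>w. w) \<in> M \<rightarrow>\<^sub>M H" using measurable_from_subalg[OF H measurable_id] by (simp add: id_def)
  have ks: "k \<in> H \<rightarrow>\<^sub>M subprob_algebra N" using k by (rule measurable_prob_algebraD)
  have kM: "k \<in> M \<rightarrow>\<^sub>M subprob_algebra N" by (rule measurable_from_subalg[OF H ks])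
  have sk: "sets (k w) = sets N" "space (k w) = space N" if "w \<in> space M" for w
    using subprob_measurableD[OF kM that] by auto
  have pk: "prob_space (k w)" if "w \<in> space M" for w
    using measurable_space[OF k] that by (auto simp: space_prob_algebra sp)
  \<comment> \<open>Joint law of the fixed first coordinate and a draw from \<open>k w\<close>;
    composing it with \<open>M\<close> gives the right-hand side.\<close>
  define \<kappa> where "\<kappa> w = distr (k w) (H \<Otimes>\<^sub>M N) (Pair w)" for w
  have \<kappa>: "\<kappa> \<in> M \<rightarrow>\<^sub>M subprob_algebra (H \<Otimes>\<^sub>M N)"
    unfolding \<kappa>_def by (rule measurable_from_subalg[OF H], rule measurable_distr2[OF _ ks]) simp
  let ?\<mu>1 = "distr M (H \<Otimes>\<^sub>M N) (\<lambda>w. (w, F w))"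
  let ?\<mu>2 = "M \<bind> \<kappa>"
  have pair: "(\<lambda>w. (w, F w)) \<in> M \<rightarrow>\<^sub>M H \<Otimes>\<^sub>M N" using idH F by measurable
  have Pw: "Pair w \<in> k w \<rightarrow>\<^sub>M H \<Otimes>\<^sub>M N" if "w \<in> space M" for w
    using measurable_Pair1'[of w H N] that sk(1)[OF that] by (simp add: sp cong: measurable_cong_sets)
  have ne: "space M \<noteq> {}" by (rule not_empty)
  have sets2: "sets ?\<mu>2 = sets (H \<Otimes>\<^sub>M N)" by (rule sets_bind) (use ne in \<open>auto simp: \<kappa>_def\<close>)
  have "?\<mu>1 = ?\<mu>2"
  proof (rule measure_eqI_generator_eq[where E="{B \<times> A |B A. B \<in> sets H \<and> A \<in> sets N}"
        and \<Omega>="space H \<times> space N" and A="\<lambda>_. space H \<times> space N"])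
    show "Int_stable {B \<times> A |B A. B \<in> sets H \<and> A \<in> sets N}" by (rule Int_stable_pair_measure_generator)
    show "{B \<times> A |B A. B \<in> sets H \<and> A \<in> sets N} \<subseteq> Pow (space H \<times> space N)"
      using sets.sets_into_space[of _ H] sets.sets_into_space[of _ N] by blast
    show "sets ?\<mu>1 = sigma_sets (space H \<times> space N) {B \<times> A |B A. B \<in> sets H \<and> A \<in> sets N}"
      by (simp add: sets_pair_measure)
    show "sets ?\<mu>2 = sigma_sets (space H \<times> space N) {B \<times> A |B A. B \<in> sets H \<and> A \<in> sets N}"
      by (simp add: sets2 sets_pair_measure)
    show "range (\<lambda>_. space H \<times> space N) \<subseteq> {B \<times> A |B A. B \<in> sets H \<and> A \<in> sets N}" by auto
    show "(\<Union>i::nat. space H \<times> space N) = space H \<times> space N" by simp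
    show "emeasure ?\<mu>1 (space H \<times> space N) \<noteq> \<infinity>" for i :: nat
    proof -
      interpret D: prob_space ?\<mu>1 by (rule prob_space_distr[OF pair])
      show ?thesis by (simp add: D.emeasure_eq_measure)
    qed
    fix X assume "X \<in> {B \<times> A |B A. B \<in> sets H \<and> A \<in> sets N}"
    then obtain B A where X: "X = B \<times> A" and B: "B \<in> sets H" and A: "A \<in> sets N" by auto
    have BM: "B \<in> sets M" using B H by (auto simp: subalgebra_def)
    have FA: "{w \<in> space M. F w \<in> A} \<in> sets M" using measurable_sets[OF F A] by (simp add: vimage_def Int_def conj_commute)
    have i: "integrable M (\<lambda>w. indicat_real B w * indicat_real {w \<in> space M. F w \<in> A} w)"
      using BM FA by (intro integrable_const_bound[where B=1]) (auto simp: indicator_def)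
    have "emeasure ?\<mu>1 X = emeasure M (B \<inter> {w \<in> space M. F w \<in> A})"
      unfolding X using B A sets.sets_into_space[OF BM]
      by (subst emeasure_distr[OF pair]) (auto intro!: arg_cong[where f="emeasure M"])
    also have "\<dots> = ennreal (\<integral>w. indicat_real B w * indicat_real {w \<in> space M. F w \<in> A} w \<partial>M)"
      using BM FA by (simp add: emeasure_eq_measure flip: indicator_inter_arith)
    also have "\<dots> = ennreal (\<integral>w. indicat_real B w * real_cond_exp M H (indicat_real {w \<in> space M. F w \<in> A}) w \<partial>M)"
      using B FA by (subst H.real_cond_exp_intg(2)[OF i]) auto
    also have "(\<integral>w. indicat_real B w * real_cond_exp M H (indicat_real {w \<in> space M. F w \<in> A}) w \<partial>M)
        = (\<integral>w. indicat_real B w * measure (k w) A \<partial>M)"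
      using eq[OF A] BM measurable_compose[OF kM measurable_measure_subprob_algebra[OF A]]
      by (intro integral_cong_AE) (auto elim!: eventually_mono)
    also have "ennreal \<dots> = (\<integral>\<^sup>+w. indicator B w * emeasure (k w) A \<partial>M)"
    proof -
      have "integrable M (\<lambda>w. indicat_real B w * measure (k w) A)"
        using BM measurable_compose[OF kM measurable_measure_subprob_algebra[OF A]] pk
        by (intro integrable_const_bound[where B=1] AE_I2)
           (auto simp: indicator_def prob_space.prob_le_1)
      then have "ennreal (\<integral>w. indicat_real B w * measure (k w) A \<partial>M) = (\<integral>\<^sup>+w. ennreal (indicat_real B w * measure (k w) A) \<partial>M)"
        by (intro nn_integral_eq_integral[symmetric]) auto
      also have "\<dots> = (\<integral>\<^sup>+w. indicator B w * emeasure (k w) A \<partial>M)"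
        using pk by (intro nn_integral_cong)
          (auto simp: indicator_def finite_measure.emeasure_eq_measure prob_space_def)
      finally show ?thesis .
    qed
    also have "\<dots> = (\<integral>\<^sup>+w. emeasure (\<kappa> w) X \<partial>M)"
    proof (rule nn_integral_cong)
      fix w assume w: "w \<in> space M"
      have "emeasure (\<kappa> w) X = emeasure (k w) (Pair w -` X \<inter> space (k w))"
        unfolding \<kappa>_def X using A B by (intro emeasure_distr Pw w) auto
      also have "Pair w -` X \<inter> space (k w) = (if w \<in> B then A else {})"
        using sets.sets_into_space[OF A] sk[OF w] by (auto simp: X)
      finally show "indicator B w * emeasure (k w) A = emeasure (\<kappa> w) X" by (simp add: indicator_def)
    qed
    also have "\<dots> = emeasure ?\<mu>2 X"
      using A B X by (intro emeasure_bind[symmetric, OF _ \<kappa>]) (auto simp: ne)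
    finally show "emeasure ?\<mu>1 X = emeasure ?\<mu>2 X" .
  qed
  then have "(\<integral>\<^sup>+x. \<Phi> x \<partial>?\<mu>1) = (\<integral>\<^sup>+x. \<Phi> x \<partial>?\<mu>2)" by simp
  also have "(\<integral>\<^sup>+x. \<Phi> x \<partial>?\<mu>1) = (\<integral>\<^sup>+w. \<Phi> (w, F w) \<partial>M)" using \<Phi> pair by (simp add: nn_integral_distr)
  also have "(\<integral>\<^sup>+x. \<Phi> x \<partial>?\<mu>2) = (\<integral>\<^sup>+w. \<integral>\<^sup>+x. \<Phi> x \<partial>\<kappa> w \<partial>M)"
    by (rule nn_integral_bind[OF \<Phi> \<kappa>])
  also have "\<dots> = (\<integral>\<^sup>+w. \<integral>\<^sup>+g. \<Phi> (w, g) \<partial>k w \<partial>M)"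
    unfolding \<kappa>_def using \<Phi> Pw by (intro nn_integral_cong nn_integral_distr) auto
  finally show ?thesis .
qed

section \<open>Gaussian families\<close>

text \<open>Covers v = 0 as well, so that degenerate posterior laws need no case of their own
  later.\<close>

lemma normal_law_eq_distr:
  assumes "0 \<le> v"
  shows "normal_law m v = distr std_normal_distribution borel (\<lambda>x. m + sqrt v * x)"
proof -
  interpret N: real_distribution std_normal_distribution by (rule real_dist_normal_dist)
  show ?thesis
  proof (cases "v = 0")
    case True
    have "distr std_normal_distribution borel (\<lambda>x. m) = return borel m"
      by (rule measure_eqI) (auto simp: emeasure_distr N.emeasure_space_1 indicator_def vimage_def)
    then show ?thesis using True by (simp add: normal_law_def)
  next
    case False
    with assms have v: "0 < v" by simp
    have "distributed std_normal_distribution lborel (\<lambda>x. x) std_normal_density"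
      by (auto simp: distributed_def distr_id2)
    then have "distributed std_normal_distribution lborel (\<lambda>x. m + sqrt v * x)
      (normal_density (m + sqrt v * 0) (\<bar>sqrt v\<bar> * 1))"
      using v by (intro N.normal_density_affine) auto
    then have "distr std_normal_distribution lborel (\<lambda>x. m + sqrt v * x) = density lborel (normal_density m (sqrt v))"
      using v by (simp add: distributed_def)
    moreover have "distr std_normal_distribution lborel (\<lambda>x. m + sqrt v * x)
        = distr std_normal_distribution borel (\<lambda>x. m + sqrt v * x)"
      by (intro distr_cong) auto
    ultimately show ?thesis using False by (simp add: normal_law_def)
  qed
qed

text \<open>The two half-lines carry equal mass by symmetry and together cover the line.\<close>

lemma std_normal_tail_half:
  "1/2 \<le> measure std_normal_distribution {0..}" "1/2 \<le> measure std_normal_distribution {..0}"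
proof -
  interpret N: real_distribution std_normal_distribution by (rule real_dist_normal_dist)
  have "distributed std_normal_distribution lborel (\<lambda>x. x) std_normal_density"
    by (auto simp: distributed_def distr_id2)
  then have "distributed std_normal_distribution lborel (\<lambda>x. 0 + (-1) * x) (normal_density (0 + (-1) * 0) (\<bar>-1\<bar> * 1))"
    by (intro N.normal_density_affine) auto
  then have D: "distr std_normal_distribution lborel (\<lambda>x. - x) = std_normal_distribution"
    by (simp add: distributed_def)
  have "measure std_normal_distribution {0..} = measure (distr std_normal_distribution lborel (\<lambda>x. - x)) {0..}"
    by (simp only: D)
  also have "\<dots> = measure std_normal_distribution {..0}"
    by (subst measure_distr) (auto intro!: arg_cong[where f="measure _"])
  finally have eq: "measure std_normal_distribution {0..} = measure std_normal_distribution {..0}" .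
  have "{0..} \<union> {..0} = (UNIV :: real set)" by auto
  then have "1 = measure std_normal_distribution ({0..} \<union> {..0})"
    using N.prob_space by simp
  also have "\<dots> \<le> measure std_normal_distribution {0..} + measure std_normal_distribution {..0}"
    by (intro measure_Un_le) auto
  finally show "1/2 \<le> measure std_normal_distribution {0..}" "1/2 \<le> measure std_normal_distribution {..0}"
    using eq by auto
qed

section \<open>Moments, cosine transform and median of a normal variable\<close>

context
  fixes M :: "'w measure" and Y :: "'w \<Rightarrow> real" and m v :: real
  assumes Y [measurable]: "Y \<in> borel_measurable M" and v: "0 \<le> v" and D: "distr M borel Y = normal_law m v"
begin

lemma normal_law_integral:
  fixes h :: "real \<Rightarrow> real"
  assumes [measurable]: "h \<in> borel_measurable borel"
  shows "(\<integral>w. h (Y w) \<partial>M) = (\<integral>x. h (m + sqrt v * x) \<partial>std_normal_distribution)"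
    and "integrable M (\<lambda>w. h (Y w)) \<longleftrightarrow> integrable std_normal_distribution (\<lambda>x. h (m + sqrt v * x))"
proof -
  have D': "distr M borel Y = distr std_normal_distribution borel (\<lambda>x. m + sqrt v * x)"
    using D normal_law_eq_distr[OF v] by simp
  have "(\<integral>w. h (Y w) \<partial>M) = (\<integral>x. h x \<partial>distr M borel Y)" by (simp add: integral_distr)
  also have "\<dots> = (\<integral>x. h (m + sqrt v * x) \<partial>std_normal_distribution)"
    unfolding D' by (simp add: integral_distr)
  finally show "(\<integral>w. h (Y w) \<partial>M) = (\<integral>x. h (m + sqrt v * x) \<partial>std_normal_distribution)" .
  have "integrable M (\<lambda>w. h (Y w)) \<longleftrightarrow> integrable (distr M borel Y) h" by (simp add: integrable_distr_eq)
  also have "\<dots> \<longleftrightarrow> integrable std_normal_distribution (\<lambda>x. h (m + sqrt v * x))"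
    unfolding D' by (simp add: integrable_distr_eq)
  finally show "integrable M (\<lambda>w. h (Y w)) \<longleftrightarrow> integrable std_normal_distribution (\<lambda>x. h (m + sqrt v * x))" .
qed

lemma normal_law_second_moment: "integrable M (\<lambda>w. (Y w)\<^sup>2)" "(\<integral>w. (Y w)\<^sup>2 \<partial>M) = m\<^sup>2 + v"
  and normal_law_first_moment: "integrable M Y" "(\<integral>w. Y w \<partial>M) = m"
proof -
  interpret N: real_distribution std_normal_distribution by (rule real_dist_normal_dist)
  have i1: "integrable std_normal_distribution (\<lambda>x. x)" "(\<integral>x. x \<partial>std_normal_distribution) = 0"
    using integrable_std_normal_distribution_moment[of 1] integral_std_normal_distribution_moment_odd[of 1] by auto
  have i2: "integrable std_normal_distribution (\<lambda>x. x\<^sup>2)" "(\<integral>x. x\<^sup>2 \<partial>std_normal_distribution) = 1"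
    using std_normal_distribution_even_moments[of 1] by auto
  have e: "(m + sqrt v * x)\<^sup>2 = m\<^sup>2 + (2 * m * sqrt v * x + v * x\<^sup>2)" for x
    using v by (simp add: power2_sum power_mult_distrib)
  have ie: "integrable std_normal_distribution (\<lambda>x. m\<^sup>2 + (2 * m * sqrt v * x + v * x\<^sup>2))"
    by (intro Bochner_Integration.integrable_add integrable_mult_right i1 i2 N.integrable_const)
  have "(\<integral>x. m\<^sup>2 + (2 * m * sqrt v * x + v * x\<^sup>2) \<partial>std_normal_distribution)
      = (\<integral>x. m\<^sup>2 \<partial>std_normal_distribution) + ((\<integral>x. 2 * m * sqrt v * x \<partial>std_normal_distribution)
        + (\<integral>x. v * x\<^sup>2 \<partial>std_normal_distribution))"
    by (subst Bochner_Integration.integral_add Bochner_Integration.integral_add,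
        intro Bochner_Integration.integrable_add integrable_mult_right i1 i2 N.integrable_const,
        intro Bochner_Integration.integrable_add integrable_mult_right i1 i2 N.integrable_const,
        subst Bochner_Integration.integral_add,
        intro integrable_mult_right i1, intro integrable_mult_right i2, rule refl)
  also have "\<dots> = m\<^sup>2 + v"
    unfolding integral_mult_right_zero i1 i2 using N.prob_space by simp
  finally have Ie: "(\<integral>x. m\<^sup>2 + (2 * m * sqrt v * x + v * x\<^sup>2) \<partial>std_normal_distribution) = m\<^sup>2 + v" .
  show "integrable M (\<lambda>w. (Y w)\<^sup>2)"
    unfolding normal_law_integral(2)[of "\<lambda>x. x\<^sup>2", simplified] e by (rule ie)
  show "(\<integral>w. (Y w)\<^sup>2 \<partial>M) = m\<^sup>2 + v"
    unfolding normal_law_integral(1)[of "\<lambda>x. x\<^sup>2", simplified] e by (rule Ie)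
  have ie: "integrable std_normal_distribution (\<lambda>x. m + sqrt v * x)"
    by (intro Bochner_Integration.integrable_add integrable_mult_right i1 N.integrable_const)
  show "integrable M Y"
    unfolding normal_law_integral(2)[of "\<lambda>x. x", simplified] by (rule ie)
  have "(\<integral>x. m + sqrt v * x \<partial>std_normal_distribution)
      = (\<integral>x. m \<partial>std_normal_distribution) + (\<integral>x. sqrt v * x \<partial>std_normal_distribution)"
    by (intro Bochner_Integration.integral_add integrable_mult_right i1 N.integrable_const)
  also have "\<dots> = m"
    unfolding integral_mult_right_zero i1 using N.prob_space by simp
  finally show "(\<integral>w. Y w \<partial>M) = m"
    unfolding normal_law_integral(1)[of "\<lambda>x. x", simplified] .
qed

text \<open>Real part of the characteristic function of the standard normal law at
  \<open>sqrt v\<close>.\<close>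

lemma normal_law_cos: "m = 0 \<Longrightarrow> (\<integral>w. cos (Y w) \<partial>M) = exp (- v / 2)"
proof -
  interpret N: real_distribution std_normal_distribution by (rule real_dist_normal_dist)
  assume "m = 0"
  then have "(\<integral>w. cos (Y w) \<partial>M) = (\<integral>x. cos (sqrt v * x) \<partial>std_normal_distribution)"
    by (subst normal_law_integral(1)) auto
  also have "\<dots> = Re (char std_normal_distribution (sqrt v))"
    unfolding char_def by (subst integral_Re[symmetric]) (auto intro: N.integrable_iexp simp: Re_exp)
  also have "\<dots> = exp (- v / 2)" using v by (simp add: char_std_normal_distribution)
  finally show ?thesis .
qed

text \<open>The mean is a median: the half-line from m away from 0 has mass at least 1/2, and on it
  the modulus is at least that of m. The bound does not depend on the variance.\<close>

lemma normal_law_tail_half: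
  assumes "c < \<bar>m\<bar>"
  shows "1/2 \<le> measure M {w \<in> space M. c < \<bar>Y w\<bar>}"
proof -
  interpret N: real_distribution std_normal_distribution by (rule real_dist_normal_dist)
  have "measure M {w \<in> space M. c < \<bar>Y w\<bar>} = measure (distr M borel Y) {x. c < \<bar>x\<bar>}"
    by (subst measure_distr) (auto intro!: arg_cong[where f="measure _"])
  also have "\<dots> = measure std_normal_distribution {x. c < \<bar>m + sqrt v * x\<bar>}"
    unfolding D normal_law_eq_distr[OF v] by (subst measure_distr) (auto simp: vimage_def)
  also have "\<dots> \<ge> 1/2"
  proof (cases "0 \<le> m")
    case True
    have "{0..} \<subseteq> {x. c < \<bar>m + sqrt v * x\<bar>}"
    proof
      fix x :: real assume "x \<in> {0..}"
      then have "0 \<le> sqrt v * x" using v by simp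
      then show "x \<in> {x. c < \<bar>m + sqrt v * x\<bar>}" using assms True by auto
    qed
    then show ?thesis
      by (intro order_trans[OF std_normal_tail_half(1)] N.finite_measure_mono) auto
  next
    case False
    have "{..0} \<subseteq> {x. c < \<bar>m + sqrt v * x\<bar>}"
    proof
      fix x :: real assume "x \<in> {..0}"
      then have "sqrt v * x \<le> 0" using v by (simp add: mult_nonneg_nonpos)
      then show "x \<in> {x. c < \<bar>m + sqrt v * x\<bar>}" using assms False by auto
    qed
    then show ?thesis
      by (intro order_trans[OF std_normal_tail_half(2)] N.finite_measure_mono) auto
  qed
  finally show ?thesis .
qed

end

text \<open>In \<open>gaussian_process\<close> a combination runs over a set of indices, but the
  points \<open>p a\<close> may coincide: in a mixed quotient with r = s and h = k the two middle
  points do. Coefficients at equal points are collected in \<open>c\<close>.\<close>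

lemma gaussian_process_combination:
  fixes b :: "'b \<Rightarrow> real"
  assumes gp: "gaussian_process M I X m K" and A: "finite A" "p ` A \<subseteq> I"
  shows "\<exists>v\<ge>0. distr M borel (\<lambda>w. \<Sum>a\<in>A. b a * X (p a) w) = normal_law (\<Sum>a\<in>A. b a * m (p a)) v"
proof -
  define c where "c i = (\<Sum>a | a \<in> A \<and> p a = i. b a)" for i
  have "(\<Sum>i\<in>p ` A. c i * h i) = (\<Sum>a\<in>A. b a * h (p a))" for h :: "_ \<Rightarrow> real"
  proof -
    have "(\<Sum>i\<in>p ` A. c i * h i) = (\<Sum>i\<in>p ` A. \<Sum>a | a \<in> A \<and> p a = i. b a * h (p a))"
      unfolding c_def by (intro sum.cong) (auto simp: sum_distrib_right)
    also have "\<dots> = (\<Sum>a\<in>A. b a * h (p a))" using A(1) by (rule sum.image_gen[symmetric])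
    finally show ?thesis .
  qed
  moreover have "finite (p ` A)" "p ` A \<subseteq> I" using A by auto
  moreover have "0 \<le> (\<Sum>i\<in>p ` A. \<Sum>j\<in>p ` A. c i * c j * K i j)"
      "distr M borel (\<lambda>w. \<Sum>i\<in>p ` A. c i * X i w) =
        normal_law (\<Sum>i\<in>p ` A. c i * m i) (\<Sum>i\<in>p ` A. \<Sum>j\<in>p ` A. c i * c j * K i j)"
    using gp calculation(2,3) unfolding gaussian_process_def by blast+
  ultimately show ?thesis by auto
qed

section \<open>The mean-square closed span of a centred Gaussian family\<close>

locale gaussian_family = prob_space +
  fixes X :: "'i \<Rightarrow> 'a \<Rightarrow> real" and U :: "'i set" and K :: "'i \<Rightarrow> 'i \<Rightarrow> real"
  assumes gp: "gaussian_process M U X (\<lambda>_. 0) K"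
begin

definition lincomb :: "'i set \<Rightarrow> ('i \<Rightarrow> real) \<Rightarrow> 'a \<Rightarrow> real" where
  "lincomb J c w = (\<Sum>i\<in>J. c i * X i w)"

text \<open>
  The closure is taken in mean square, so that limits of limits (second derivatives of the paths)
  stay inside. On it pointwise convergence implies convergence of second moments, because
  \<open>E cos Z = exp (- E Z\<^sup>2 / 2)\<close>.
\<close>

definition gauss_span :: "('a \<Rightarrow> real) set" where
  "gauss_span = {Z. Z \<in> borel_measurable M \<and> integrable M (\<lambda>w. (Z w)\<^sup>2) \<and>
     (\<forall>e>0. \<exists>J c. finite J \<and> J \<subseteq> U \<and> (\<integral>w. (Z w - lincomb J c w)\<^sup>2 \<partial>M) < e)}"

lemma X_measurable: "x \<in> U \<Longrightarrow> X x \<in> borel_measurable M"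
  using gp by (auto simp: gaussian_process_def)

lemma lincomb_measurable: "J \<subseteq> U \<Longrightarrow> lincomb J c \<in> borel_measurable M"
  unfolding lincomb_def[abs_def] using X_measurable by (intro borel_measurable_sum borel_measurable_times) auto

lemma lincomb_gaussian:
  assumes "finite J" "J \<subseteq> U"
  shows "integrable M (\<lambda>w. (lincomb J c w)\<^sup>2)"
    and "(\<integral>w. cos (lincomb J c w) \<partial>M) = exp (- (\<integral>w. (lincomb J c w)\<^sup>2 \<partial>M) / 2)"
proof -
  obtain v where v: "0 \<le> v" "distr M borel (lincomb J c) = normal_law 0 v"
    using gaussian_process_combination[OF gp assms(1), of id c] assms(2) by (auto simp: lincomb_def[abs_def])
  note L = lincomb_measurable[OF assms(2)] v
  show "integrable M (\<lambda>w. (lincomb J c w)\<^sup>2)" by (rule normal_law_second_moment[OF L])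
  show "(\<integral>w. cos (lincomb J c w) \<partial>M) = exp (- (\<integral>w. (lincomb J c w)\<^sup>2 \<partial>M) / 2)"
    using normal_law_second_moment(2)[OF L] normal_law_cos[OF L] by simp
qed

lemma square_integrable_add:
  fixes Z W :: "'a \<Rightarrow> real"
  assumes [measurable]: "Z \<in> borel_measurable M" "W \<in> borel_measurable M"
    and "integrable M (\<lambda>w. (Z w)\<^sup>2)" "integrable M (\<lambda>w. (W w)\<^sup>2)"
  shows "integrable M (\<lambda>w. (a * Z w + b * W w)\<^sup>2)" "integrable M (\<lambda>w. Z w * W w)" "integrable M Z"
proof -
  have le: "(x + y)\<^sup>2 \<le> 2 * x\<^sup>2 + 2 * y\<^sup>2" for x y :: real
    using sum_squares_bound[of x y] by (simp add: power2_sum)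
  show "integrable M (\<lambda>w. (a * Z w + b * W w)\<^sup>2)"
  proof (rule Bochner_Integration.integrable_bound[where f="\<lambda>w. 2 * (a\<^sup>2 * (Z w)\<^sup>2) + 2 * (b\<^sup>2 * (W w)\<^sup>2)"])
    show "AE w in M. norm ((a * Z w + b * W w)\<^sup>2) \<le> norm (2 * (a\<^sup>2 * (Z w)\<^sup>2) + 2 * (b\<^sup>2 * (W w)\<^sup>2))"
      by (rule AE_I2) (use le in \<open>simp flip: power_mult_distrib\<close>)
  qed (use assms in auto)
  have le2: "\<bar>x * y\<bar> \<le> x\<^sup>2 + y\<^sup>2" for x y :: real
  proof -
    have "2 * (\<bar>x\<bar> * \<bar>y\<bar>) \<le> x\<^sup>2 + y\<^sup>2" using sum_squares_bound[of "\<bar>x\<bar>" "\<bar>y\<bar>"] by (simp add: mult.assoc)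
    moreover have "0 \<le> \<bar>x\<bar> * \<bar>y\<bar>" by simp
    ultimately show ?thesis unfolding abs_mult by linarith
  qed
  show "integrable M (\<lambda>w. Z w * W w)"
  proof (rule Bochner_Integration.integrable_bound[where f="\<lambda>w. (Z w)\<^sup>2 + (W w)\<^sup>2"])
    show "AE w in M. norm (Z w * W w) \<le> norm ((Z w)\<^sup>2 + (W w)\<^sup>2)"
      by (rule AE_I2) (use le2 in simp)
  qed (use assms in auto)
  have le1: "\<bar>x\<bar> \<le> 1 + x\<^sup>2" for x :: real
    using sum_squares_bound[of "\<bar>x\<bar>" 1] by simp
  show "integrable M Z"
  proof (rule Bochner_Integration.integrable_bound[where f="\<lambda>w. 1 + (Z w)\<^sup>2"])
    show "AE w in M. norm (Z w) \<le> norm (1 + (Z w)\<^sup>2)"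
      by (rule AE_I2) (use le1 in simp)
  qed (use assms in auto)
qed

lemma gauss_spanD:
  assumes "Z \<in> gauss_span"
  shows "Z \<in> borel_measurable M" "integrable M (\<lambda>w. (Z w)\<^sup>2)"
  using assms by (auto simp: gauss_span_def)

lemma X_gauss_span: "x \<in> U \<Longrightarrow> X x \<in> gauss_span"
proof -
  assume x: "x \<in> U"
  have e: "lincomb {x} (\<lambda>_. 1) = X x" by (simp add: lincomb_def[abs_def])
  have "integrable M (\<lambda>w. (X x w)\<^sup>2)" using lincomb_gaussian(1)[of "{x}" "\<lambda>_. 1"] x by (simp add: e)
  moreover have "\<exists>J c. finite J \<and> J \<subseteq> U \<and> (\<integral>w. (X x w - lincomb J c w)\<^sup>2 \<partial>M) < d" if "0 < d" for d
    using x that by (intro exI[of _ "{x}"] exI[of _ "\<lambda>_. 1"]) (simp add: e)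
  ultimately show ?thesis using X_measurable[OF x] by (auto simp: gauss_span_def)
qed

lemma gauss_span_add:
  assumes Z: "Z \<in> gauss_span" and W: "W \<in> gauss_span"
  shows "(\<lambda>w. a * Z w + b * W w) \<in> gauss_span"
proof -
  note [measurable] = gauss_spanD(1)[OF Z] gauss_spanD(1)[OF W]
  have "\<exists>J c. finite J \<and> J \<subseteq> U \<and> (\<integral>w. (a * Z w + b * W w - lincomb J c w)\<^sup>2 \<partial>M) < e" if "0 < e" for e
  proof -
    \<comment> \<open>From (x + y)^2 \<le> 2 x^2 + 2 y^2, used below; the 1 keeps the denominator
      positive when a and b vanish.\<close>
    define d where "d = e / (2 * a\<^sup>2 + 2 * b\<^sup>2 + 1)"
    have den: "0 < 2 * a\<^sup>2 + 2 * b\<^sup>2 + 1" by (simp add: add_nonneg_pos)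
    have "0 < d" using that den by (simp add: d_def)
    then obtain J c J' c' where J: "finite J" "J \<subseteq> U" "(\<integral>w. (Z w - lincomb J c w)\<^sup>2 \<partial>M) < d"
      and J': "finite J'" "J' \<subseteq> U" "(\<integral>w. (W w - lincomb J' c' w)\<^sup>2 \<partial>M) < d"
      using Z W unfolding gauss_span_def by blast
    \<comment> \<open>A coefficient counts as 0 outside its own index set, so both combinations live
      on the union.\<close>
    define c'' where "c'' i = a * (if i \<in> J then c i else 0) + b * (if i \<in> J' then c' i else 0)" for i
    have eq: "lincomb (J \<union> J') c'' w = a * lincomb J c w + b * lincomb J' c' w" for w
    proof -
      have "lincomb (J \<union> J') c'' w = (\<Sum>i\<in>J \<union> J'. a * (if i \<in> J then c i * X i w else 0))
          + (\<Sum>i\<in>J \<union> J'. b * (if i \<in> J' then c' i * X i w else 0))"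
        unfolding lincomb_def c''_def sum.distrib[symmetric] by (intro sum.cong) (auto simp: algebra_simps)
      also have "(\<Sum>i\<in>J \<union> J'. a * (if i \<in> J then c i * X i w else 0)) = a * lincomb J c w"
        using J J' by (simp add: lincomb_def sum.If_cases Int_absorb1 flip: sum_distrib_left)
      also have "(\<Sum>i\<in>J \<union> J'. b * (if i \<in> J' then c' i * X i w else 0)) = b * lincomb J' c' w"
        using J J' by (simp add: lincomb_def sum.If_cases Int_absorb1 flip: sum_distrib_left)
      finally show ?thesis .
    qed
    note [measurable] = lincomb_measurable[OF J(2)] lincomb_measurable[OF J'(2)]
    have i1: "integrable M (\<lambda>w. (Z w - lincomb J c w)\<^sup>2)"
      using square_integrable_add(1)[of Z "lincomb J c" 1 "-1"] gauss_spanD[OF Z] lincomb_gaussian(1)[OF J(1,2)] by simp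
    have i2: "integrable M (\<lambda>w. (W w - lincomb J' c' w)\<^sup>2)"
      using square_integrable_add(1)[of W "lincomb J' c'" 1 "-1"] gauss_spanD[OF W] lincomb_gaussian(1)[OF J'(1,2)] by simp
    have i3: "integrable M (\<lambda>w. (a * (Z w - lincomb J c w) + b * (W w - lincomb J' c' w))\<^sup>2)"
      by (intro square_integrable_add(1) i1 i2) auto
    have le: "(x + y)\<^sup>2 \<le> 2 * x\<^sup>2 + 2 * y\<^sup>2" for x y :: real
      using sum_squares_bound[of x y] by (simp add: power2_sum)
    have "(\<integral>w. (a * Z w + b * W w - lincomb (J \<union> J') c'' w)\<^sup>2 \<partial>M)
        = (\<integral>w. (a * (Z w - lincomb J c w) + b * (W w - lincomb J' c' w))\<^sup>2 \<partial>M)"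
      by (simp add: eq algebra_simps)
    also have "\<dots> \<le> (\<integral>w. 2 * a\<^sup>2 * (Z w - lincomb J c w)\<^sup>2 + 2 * b\<^sup>2 * (W w - lincomb J' c' w)\<^sup>2 \<partial>M)"
    proof (rule integral_mono[OF i3])
      show "(a * (Z w - lincomb J c w) + b * (W w - lincomb J' c' w))\<^sup>2
          \<le> 2 * a\<^sup>2 * (Z w - lincomb J c w)\<^sup>2 + 2 * b\<^sup>2 * (W w - lincomb J' c' w)\<^sup>2" for w
        using le[of "a * (Z w - lincomb J c w)" "b * (W w - lincomb J' c' w)"]
        unfolding power_mult_distrib by simp
    qed (use i1 i2 in auto)
    also have "\<dots> = 2 * a\<^sup>2 * (\<integral>w. (Z w - lincomb J c w)\<^sup>2 \<partial>M) + 2 * b\<^sup>2 * (\<integral>w. (W w - lincomb J' c' w)\<^sup>2 \<partial>M)"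
      using i1 i2 by simp
    also have "\<dots> \<le> 2 * a\<^sup>2 * d + 2 * b\<^sup>2 * d"
      using J(3) J'(3) by (intro add_mono mult_left_mono) auto
    also have "\<dots> < (2 * a\<^sup>2 + 2 * b\<^sup>2 + 1) * d" using \<open>0 < d\<close> by (simp add: algebra_simps)
    also have "\<dots> = e" using den by (simp add: d_def)
    finally show ?thesis using J J' by (intro exI[of _ "J \<union> J'"] exI[of _ c'']) auto
  qed
  moreover have "integrable M (\<lambda>w. (a * Z w + b * W w)\<^sup>2)"
    by (rule square_integrable_add(1)[OF gauss_spanD(1)[OF Z] gauss_spanD(1)[OF W] gauss_spanD(2)[OF Z] gauss_spanD(2)[OF W]])
  ultimately show ?thesis unfolding gauss_span_def by simp
qed

lemma gauss_span_diff: "Z \<in> gauss_span \<Longrightarrow> W \<in> gauss_span \<Longrightarrow> (\<lambda>w. Z w - W w) \<in> gauss_span"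
  using gauss_span_add[of Z W 1 "-1"] by simp

lemma gauss_span_zero: "(\<lambda>w. 0) \<in> gauss_span"
proof -
  have "\<exists>J c. finite J \<and> J \<subseteq> U \<and> (\<integral>w. (0 - lincomb J c w)\<^sup>2 \<partial>M) < e" if "0 < e" for e
    using that by (intro exI[of _ "{}"] exI) (simp add: lincomb_def)
  then show ?thesis by (auto simp: gauss_span_def)
qed

lemma gauss_span_scale: "Z \<in> gauss_span \<Longrightarrow> (\<lambda>w. a * Z w) \<in> gauss_span"
  using gauss_span_add[OF _ gauss_span_zero, of Z a 0] by simp

lemma gauss_span_sum: "finite A \<Longrightarrow> (\<And>a. a \<in> A \<Longrightarrow> Z a \<in> gauss_span) \<Longrightarrow> (\<lambda>w. \<Sum>a\<in>A. Z a w) \<in> gauss_span"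
proof (induct A rule: finite_induct)
  case empty then show ?case using gauss_span_zero by simp
next
  case (insert a A)
  then show ?case using gauss_span_add[of "Z a" "\<lambda>w. \<Sum>a\<in>A. Z a w" 1 1] by simp
qed

text \<open>The difference of the two sides is the variance of the modulus.\<close>

lemma abs_integral_le_L2:
  fixes Z :: "'a \<Rightarrow> real"
  assumes [measurable]: "Z \<in> borel_measurable M" and "integrable M (\<lambda>w. (Z w)\<^sup>2)"
  shows "(\<integral>w. \<bar>Z w\<bar> \<partial>M)\<^sup>2 \<le> (\<integral>w. (Z w)\<^sup>2 \<partial>M)"
proof -
  have i: "integrable M Z" using square_integrable_add(3)[of Z Z] assms by auto
  have "0 \<le> (\<integral>w. (\<bar>Z w\<bar> - (\<integral>w. \<bar>Z w\<bar> \<partial>M))\<^sup>2 \<partial>M)" by simp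
  also have "\<dots> = (\<integral>w. (Z w)\<^sup>2 \<partial>M) - (\<integral>w. \<bar>Z w\<bar> \<partial>M)\<^sup>2"
    using variance_eq[of "\<lambda>w. \<bar>Z w\<bar>"] i assms by simp
  finally show ?thesis by simp
qed

text \<open>The identity holds for finite combinations and survives the mean-square limit:
  \<open>cos\<close> is 1-Lipschitz, so the left side is continuous for convergence in mean, and the
  second moment is continuous for convergence in mean square.\<close>

lemma gauss_span_cos:
  assumes Z: "Z \<in> gauss_span"
  shows "(\<integral>w. cos (Z w) \<partial>M) = exp (- (\<integral>w. (Z w)\<^sup>2 \<partial>M) / 2)"
proof -
  note [measurable] = gauss_spanD(1)[OF Z]
  have "\<forall>n. \<exists>J c. finite J \<and> J \<subseteq> U \<and> (\<integral>w. (Z w - lincomb J c w)\<^sup>2 \<partial>M) < 1 / real (Suc n)"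
    using Z by (auto simp: gauss_span_def simp del: of_nat_Suc)
  then obtain J c where J: "\<And>n. finite (J n)" "\<And>n. J n \<subseteq> U"
    and lt: "\<And>n. (\<integral>w. (Z w - lincomb (J n) (c n) w)\<^sup>2 \<partial>M) < 1 / real (Suc n)" by metis
  define L where "L n = lincomb (J n) (c n)" for n
  have L [measurable]: "L n \<in> borel_measurable M" for n unfolding L_def by (rule lincomb_measurable[OF J(2)])
  have L2: "integrable M (\<lambda>w. (L n w)\<^sup>2)" for n unfolding L_def by (rule lincomb_gaussian[OF J])
  have d2: "integrable M (\<lambda>w. (Z w - L n w)\<^sup>2)" for n
    using square_integrable_add(1)[of Z "L n" 1 "-1"] gauss_spanD[OF Z] L2 by simp
  have dd: "(\<lambda>n. \<integral>w. (Z w - L n w)\<^sup>2 \<partial>M) \<longlonglongrightarrow> 0"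
    by (rule real_tendsto_sandwich[OF _ _ tendsto_const LIMSEQ_inverse_real_of_nat])
       (use lt in \<open>auto simp: L_def inverse_eq_divide less_imp_le\<close>)
  have d1: "(\<lambda>n. \<integral>w. \<bar>Z w - L n w\<bar> \<partial>M) \<longlonglongrightarrow> 0"
  proof -
    have "(\<lambda>n. (\<integral>w. \<bar>Z w - L n w\<bar> \<partial>M)\<^sup>2) \<longlonglongrightarrow> 0"
      by (rule real_tendsto_sandwich[OF _ _ tendsto_const dd])
         (use abs_integral_le_L2[OF _ d2] in auto)
    then have "(\<lambda>n. sqrt ((\<integral>w. \<bar>Z w - L n w\<bar> \<partial>M)\<^sup>2)) \<longlonglongrightarrow> sqrt 0"
      by (rule tendsto_real_sqrt)
    then show ?thesis unfolding real_sqrt_abs real_sqrt_zero by (rule tendsto_rabs_zero_cancel)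
  qed
  have cl: "\<bar>cos x - cos y\<bar> \<le> \<bar>x - y\<bar>" for x y :: real
  proof -
    have "\<bar>cos x - cos y\<bar> = 2 * \<bar>sin ((x + y) / 2)\<bar> * \<bar>sin ((y - x) / 2)\<bar>"
      by (simp add: cos_diff_cos abs_mult)
    also have "\<dots> \<le> 2 * 1 * \<bar>(y - x) / 2\<bar>"
      by (intro mult_mono abs_sin_x_le_abs_x) (auto simp: abs_le_iff)
    finally show ?thesis by (simp add: abs_minus_commute)
  qed
  have icos: "integrable M (\<lambda>w. cos (Y w))" if [measurable]: "Y \<in> borel_measurable M" for Y :: "'a \<Rightarrow> real"
    by (rule integrable_const_bound[where B=1]) auto
  have i1: "integrable M (\<lambda>w. Z w - L n w)" for n
    using square_integrable_add(3)[of "\<lambda>w. Z w - L n w" Z] d2 gauss_spanD(2)[OF Z] by auto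
  have "(\<lambda>n. (\<integral>w. cos (Z w) \<partial>M) - (\<integral>w. cos (L n w) \<partial>M)) \<longlonglongrightarrow> 0"
  proof (rule Lim_null_comparison[OF _ d1], rule always_eventually, rule allI)
    fix n
    have "norm ((\<integral>w. cos (Z w) \<partial>M) - (\<integral>w. cos (L n w) \<partial>M)) = \<bar>\<integral>w. cos (Z w) - cos (L n w) \<partial>M\<bar>"
      by (simp add: icos)
    also have "\<dots> \<le> (\<integral>w. \<bar>cos (Z w) - cos (L n w)\<bar> \<partial>M)" by (rule integral_abs_bound)
    also have "\<dots> \<le> (\<integral>w. \<bar>Z w - L n w\<bar> \<partial>M)"
      by (rule integral_mono[OF _ integrable_abs[OF i1] cl])
         (intro integrable_abs Bochner_Integration.integrable_diff icos; measurable)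
    finally show "norm ((\<integral>w. cos (Z w) \<partial>M) - (\<integral>w. cos (L n w) \<partial>M)) \<le> (\<integral>w. \<bar>Z w - L n w\<bar> \<partial>M)" .
  qed
  then have "(\<lambda>n. (\<integral>w. cos (Z w) \<partial>M) - ((\<integral>w. cos (Z w) \<partial>M) - (\<integral>w. cos (L n w) \<partial>M))) \<longlonglongrightarrow> (\<integral>w. cos (Z w) \<partial>M) - 0"
    by (intro tendsto_intros)
  then have c1: "(\<lambda>n. \<integral>w. cos (L n w) \<partial>M) \<longlonglongrightarrow> (\<integral>w. cos (Z w) \<partial>M)" by simp
  \<comment> \<open>Weighted arithmetic-geometric mean inequality: with a small weight on
    \<open>Z\<close> the first term is small uniformly in n, and for that weight the second term
    tends to 0.\<close>
  have L1: "(\<lambda>n. \<integral>w. Z w * (Z w - L n w) \<partial>M) \<longlonglongrightarrow> 0"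
  proof -
    have zi: "integrable M (\<lambda>w. Z w * (Z w - L n w))" for n
      by (rule square_integrable_add(2)) (use gauss_spanD[OF Z] d2 in auto)
    have bd: "\<bar>\<integral>w. Z w * (Z w - L n w) \<partial>M\<bar> \<le> e / 2 * (\<integral>w. (Z w)\<^sup>2 \<partial>M) + 1 / (2 * e) * (\<integral>w. (Z w - L n w)\<^sup>2 \<partial>M)"
      if "0 < e" for e n
    proof -
      have "\<bar>x * y\<bar> \<le> e / 2 * x\<^sup>2 + 1 / (2 * e) * y\<^sup>2" for x y :: real
      proof -
        have "0 \<le> (e * \<bar>x\<bar> - \<bar>y\<bar>)\<^sup>2 / (2 * e)" using that by simp
        also have "\<dots> = e / 2 * x\<^sup>2 + 1 / (2 * e) * y\<^sup>2 - \<bar>x * y\<bar>"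
          using that by (simp add: power2_eq_square abs_mult field_simps)
        finally show ?thesis by simp
      qed
      then have "(\<integral>w. \<bar>Z w * (Z w - L n w)\<bar> \<partial>M) \<le> (\<integral>w. e / 2 * (Z w)\<^sup>2 + 1 / (2 * e) * (Z w - L n w)\<^sup>2 \<partial>M)"
        using zi gauss_spanD[OF Z] d2 by (intro integral_mono) auto
      also have "\<dots> = e / 2 * (\<integral>w. (Z w)\<^sup>2 \<partial>M) + 1 / (2 * e) * (\<integral>w. (Z w - L n w)\<^sup>2 \<partial>M)"
        using gauss_spanD[OF Z] d2 by simp
      finally show ?thesis by (rule order_trans[OF integral_abs_bound])
    qed
    show ?thesis
    proof (rule LIMSEQ_I)
      fix r :: real assume r: "0 < r"
      define V where "V = (\<integral>w. (Z w)\<^sup>2 \<partial>M)"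
      have V: "0 \<le> V" by (simp add: V_def)
      \<comment> \<open>This e makes the first term smaller than r / 2; a mean-square distance below
        r e does the same for the second.\<close>
      define e where "e = r / (V + 1)"
      have e: "0 < e" using r V by (simp add: e_def)
      have "e / 2 * V < r / 2" using V r by (simp add: e_def field_simps)
      have "0 < r * e" using r e by simp
      then obtain no where no: "\<And>n. n \<ge> no \<Longrightarrow> norm ((\<integral>w. (Z w - L n w)\<^sup>2 \<partial>M) - 0) < r * e"
        using LIMSEQ_D[OF dd] by blast
      show "\<exists>no. \<forall>n\<ge>no. norm ((\<integral>w. Z w * (Z w - L n w) \<partial>M) - 0) < r"
      proof (intro exI allI impI)
        fix n assume "n \<ge> no"
        from no[OF this] have "1 / (2 * e) * (\<integral>w. (Z w - L n w)\<^sup>2 \<partial>M) < r / 2"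
          using e by (simp add: field_simps)
        with bd[OF e, of n] \<open>e / 2 * V < r / 2\<close>
        show "norm ((\<integral>w. Z w * (Z w - L n w) \<partial>M) - 0) < r" by (simp add: V_def)
      qed
    qed
  qed
  have "(\<integral>w. (L n w)\<^sup>2 \<partial>M) = (\<integral>w. (Z w)\<^sup>2 \<partial>M) - 2 * (\<integral>w. Z w * (Z w - L n w) \<partial>M) + (\<integral>w. (Z w - L n w)\<^sup>2 \<partial>M)" for n
  proof -
    have zi: "integrable M (\<lambda>w. Z w * (Z w - L n w))"
      by (rule square_integrable_add(2)) (use gauss_spanD[OF Z] d2 in auto)
    have "(\<integral>w. (L n w)\<^sup>2 \<partial>M) = (\<integral>w. (Z w)\<^sup>2 - 2 * (Z w * (Z w - L n w)) + (Z w - L n w)\<^sup>2 \<partial>M)"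
      by (intro Bochner_Integration.integral_cong) (auto simp: power2_eq_square algebra_simps)
    then show ?thesis using zi gauss_spanD[OF Z] d2 by simp
  qed
  moreover have "(\<lambda>n. (\<integral>w. (Z w)\<^sup>2 \<partial>M) - 2 * (\<integral>w. Z w * (Z w - L n w) \<partial>M) + (\<integral>w. (Z w - L n w)\<^sup>2 \<partial>M))
      \<longlonglongrightarrow> (\<integral>w. (Z w)\<^sup>2 \<partial>M) - 2 * 0 + 0"
    by (intro tendsto_intros L1 dd)
  ultimately have "(\<lambda>n. \<integral>w. (L n w)\<^sup>2 \<partial>M) \<longlonglongrightarrow> (\<integral>w. (Z w)\<^sup>2 \<partial>M)" by simp
  then have "(\<lambda>n. exp (- (\<integral>w. (L n w)\<^sup>2 \<partial>M) / 2)) \<longlonglongrightarrow> exp (- (\<integral>w. (Z w)\<^sup>2 \<partial>M) / 2)"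
    by (intro tendsto_intros) auto
  moreover have "exp (- (\<integral>w. (L n w)\<^sup>2 \<partial>M) / 2) = (\<integral>w. cos (L n w) \<partial>M)" for n
    unfolding L_def by (rule lincomb_gaussian(2)[OF J, symmetric])
  ultimately show ?thesis using c1 LIMSEQ_unique by simp
qed

text \<open>The passage to the limit is made for the bounded function \<open>cos\<close>, by
  dominated convergence; the second moment is then recovered by taking logarithms.\<close>

lemma gauss_span_norm_limit:
  assumes Zn: "\<And>n. Zn n \<in> gauss_span" and Z: "Z \<in> gauss_span"
    and lim: "\<And>w. w \<in> space M \<Longrightarrow> (\<lambda>n. Zn n w) \<longlonglongrightarrow> Z w"
  shows "(\<lambda>n. \<integral>w. (Zn n w)\<^sup>2 \<partial>M) \<longlonglongrightarrow> (\<integral>w. (Z w)\<^sup>2 \<partial>M)"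
proof -
  note [measurable] = gauss_spanD(1)[OF Zn] gauss_spanD(1)[OF Z]
  have "(\<lambda>n. \<integral>w. cos (Zn n w) \<partial>M) \<longlonglongrightarrow> (\<integral>w. cos (Z w) \<partial>M)"
    by (rule integral_dominated_convergence[where w="\<lambda>_. 1"]) (auto intro!: AE_I2 tendsto_cos lim)
  then have "(\<lambda>n. exp (- (\<integral>w. (Zn n w)\<^sup>2 \<partial>M) / 2)) \<longlonglongrightarrow> exp (- (\<integral>w. (Z w)\<^sup>2 \<partial>M) / 2)"
    by (simp only: gauss_span_cos[OF Zn] gauss_span_cos[OF Z])
  then have "(\<lambda>n. ln (exp (- (\<integral>w. (Zn n w)\<^sup>2 \<partial>M) / 2))) \<longlonglongrightarrow> ln (exp (- (\<integral>w. (Z w)\<^sup>2 \<partial>M) / 2))"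
    by (rule tendsto_ln) simp
  then have "(\<lambda>n. (- 2) * (- (\<integral>w. (Zn n w)\<^sup>2 \<partial>M) / 2)) \<longlonglongrightarrow> (- 2) * (- (\<integral>w. (Z w)\<^sup>2 \<partial>M) / 2)"
    unfolding ln_exp by (intro tendsto_mult tendsto_const)
  then show ?thesis by simp
qed

text \<open>Polarisation: the sum and the difference of two members of the span are again
  members.\<close>

lemma gauss_span_inner_limit:
  assumes Zn: "\<And>n. Zn n \<in> gauss_span" and Z: "Z \<in> gauss_span" and Wn: "\<And>n. Wn n \<in> gauss_span" and W: "W \<in> gauss_span"
    and limZ: "\<And>w. w \<in> space M \<Longrightarrow> (\<lambda>n. Zn n w) \<longlonglongrightarrow> Z w"
    and limW: "\<And>w. w \<in> space M \<Longrightarrow> (\<lambda>n. Wn n w) \<longlonglongrightarrow> W w"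
  shows "(\<lambda>n. \<integral>w. Zn n w * Wn n w \<partial>M) \<longlonglongrightarrow> (\<integral>w. Z w * W w \<partial>M)"
proof -
  have pol: "(\<integral>w. P w * Q w \<partial>M) = ((\<integral>w. (1 * P w + 1 * Q w)\<^sup>2 \<partial>M) - (\<integral>w. (1 * P w + (-1) * Q w)\<^sup>2 \<partial>M)) / 4"
    if P: "P \<in> gauss_span" and Q: "Q \<in> gauss_span" for P Q
  proof -
    have "(\<integral>w. (1 * P w + 1 * Q w)\<^sup>2 \<partial>M) - (\<integral>w. (1 * P w + (-1) * Q w)\<^sup>2 \<partial>M)
        = (\<integral>w. (1 * P w + 1 * Q w)\<^sup>2 - (1 * P w + (-1) * Q w)\<^sup>2 \<partial>M)"
      by (rule Bochner_Integration.integral_diff[symmetric]; rule gauss_spanD(2)[OF gauss_span_add[OF P Q]])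
    also have "\<dots> = (\<integral>w. 4 * (P w * Q w) \<partial>M)"
      by (intro Bochner_Integration.integral_cong) (auto simp: power2_eq_square algebra_simps)
    finally show ?thesis by simp
  qed
  have "(\<lambda>n. ((\<integral>w. (1 * Zn n w + 1 * Wn n w)\<^sup>2 \<partial>M) - (\<integral>w. (1 * Zn n w + (-1) * Wn n w)\<^sup>2 \<partial>M)) / 4)
      \<longlonglongrightarrow> ((\<integral>w. (1 * Z w + 1 * W w)\<^sup>2 \<partial>M) - (\<integral>w. (1 * Z w + (-1) * W w)\<^sup>2 \<partial>M)) / 4"
    by (intro tendsto_divide tendsto_diff tendsto_const gauss_span_norm_limit gauss_span_add Zn Z Wn W
        tendsto_add tendsto_mult limZ limW) auto
  then show ?thesis by (simp only: pol[OF Zn Wn] pol[OF Z W])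
qed

text \<open>The limit is not yet known to lie in \<open>gauss_span\<close>, but differences along
  two index sequences tend to 0, which does. If the Cauchy property failed, such differences would
  keep a second moment of at least e.\<close>

lemma gauss_span_L2_cauchy:
  assumes Zn: "\<And>n. Zn n \<in> gauss_span"
    and lim: "\<And>w. w \<in> space M \<Longrightarrow> (\<lambda>n. Zn n w) \<longlonglongrightarrow> Z w" and "0 < e"
  shows "\<exists>N. \<forall>n\<ge>N. \<forall>m\<ge>N. (\<integral>w. (Zn n w - Zn m w)\<^sup>2 \<partial>M) < e"
proof (rule ccontr)
  assume "\<not> ?thesis"
  then have "\<forall>N. \<exists>n m. n \<ge> N \<and> m \<ge> N \<and> e \<le> (\<integral>w. (Zn n w - Zn m w)\<^sup>2 \<partial>M)" by (auto simp: not_less)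
  then obtain n m where nm: "\<And>N. n N \<ge> N" "\<And>N. m N \<ge> N"
    and ge: "\<And>N. e \<le> (\<integral>w. (Zn (n N) w - Zn (m N) w)\<^sup>2 \<partial>M)" by metis
  have n: "filterlim n at_top sequentially" and m: "filterlim m at_top sequentially"
    using nm by (auto intro: filterlim_at_top_mono[OF filterlim_ident] always_eventually)
  have "(\<lambda>N. \<integral>w. (Zn (n N) w - Zn (m N) w)\<^sup>2 \<partial>M) \<longlonglongrightarrow> (\<integral>w. 0\<^sup>2 \<partial>M)"
  proof (rule gauss_span_norm_limit[OF gauss_span_diff[OF Zn Zn] gauss_span_zero])
    fix w assume "w \<in> space M"
    then have "(\<lambda>N. Zn (n N) w - Zn (m N) w) \<longlonglongrightarrow> Z w - Z w"
      by (intro tendsto_diff filterlim_compose[OF lim n] filterlim_compose[OF lim m])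
    then show "(\<lambda>N. Zn (n N) w - Zn (m N) w) \<longlonglongrightarrow> 0" by simp
  qed
  then have "(\<lambda>N. \<integral>w. (Zn (n N) w - Zn (m N) w)\<^sup>2 \<partial>M) \<longlonglongrightarrow> 0" by simp
  then have "e \<le> 0" by (rule LIMSEQ_le_const) (use ge in auto)
  then show False using \<open>0 < e\<close> by simp
qed

text \<open>The Cauchy property together with Fatou's lemma turns pointwise limits into mean-square
  limits.\<close>

lemma gauss_span_limit:
  assumes Zn: "\<And>n. Zn n \<in> gauss_span"
    and lim: "\<And>w. w \<in> space M \<Longrightarrow> (\<lambda>n. Zn n w) \<longlonglongrightarrow> Z w"
  shows "Z \<in> gauss_span"
proof -
  note [measurable] = gauss_spanD(1)[OF Zn]
  have [measurable]: "Z \<in> borel_measurable M" by (rule borel_measurable_LIMSEQ_real[OF lim]) auto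
  have close: "\<exists>n. integrable M (\<lambda>w. (Z w - Zn n w)\<^sup>2) \<and> (\<integral>w. (Z w - Zn n w)\<^sup>2 \<partial>M) < e" if "0 < e" for e
  proof -
    have "0 < e/2" using that by simp
    from gauss_span_L2_cauchy[of Zn Z, OF Zn lim this]
    obtain N where N: "\<And>n m. n \<ge> N \<Longrightarrow> m \<ge> N \<Longrightarrow> (\<integral>w. (Zn n w - Zn m w)\<^sup>2 \<partial>M) < e/2"
      by blast
    have "(\<integral>\<^sup>+w. ennreal ((Z w - Zn N w)\<^sup>2) \<partial>M) = (\<integral>\<^sup>+w. liminf (\<lambda>m. ennreal ((Zn m w - Zn N w)\<^sup>2)) \<partial>M)"
    proof (rule nn_integral_cong)
      fix w assume "w \<in> space M"
      then have "(\<lambda>m. ennreal ((Zn m w - Zn N w)\<^sup>2)) \<longlonglongrightarrow> ennreal ((Z w - Zn N w)\<^sup>2)"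
        by (intro tendsto_ennrealI tendsto_power tendsto_diff tendsto_const lim)
      then show "ennreal ((Z w - Zn N w)\<^sup>2) = liminf (\<lambda>m. ennreal ((Zn m w - Zn N w)\<^sup>2))"
        by (rule lim_imp_Liminf[OF trivial_limit_sequentially, symmetric])
    qed
    also have "\<dots> \<le> liminf (\<lambda>m. \<integral>\<^sup>+w. ennreal ((Zn m w - Zn N w)\<^sup>2) \<partial>M)"
      by (rule nn_integral_liminf) auto
    also have "\<dots> \<le> ennreal (e/2)"
    proof (rule Liminf_le[OF _ eventually_sequentiallyI[of N]])
      fix m assume "N \<le> m"
      have "(\<integral>\<^sup>+w. ennreal ((Zn m w - Zn N w)\<^sup>2) \<partial>M) = ennreal (\<integral>w. (Zn m w - Zn N w)\<^sup>2 \<partial>M)"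
        by (rule nn_integral_eq_integral[OF gauss_spanD(2)[OF gauss_span_diff[OF Zn Zn]]]) auto
      also have "\<dots> \<le> ennreal (e/2)" using N[of m N] \<open>N \<le> m\<close> by (intro ennreal_leI) auto
      finally show "(\<integral>\<^sup>+w. ennreal ((Zn m w - Zn N w)\<^sup>2) \<partial>M) \<le> ennreal (e/2)" .
    qed simp
    finally have le: "(\<integral>\<^sup>+w. ennreal ((Z w - Zn N w)\<^sup>2) \<partial>M) \<le> ennreal (e/2)" .
    then have int: "integrable M (\<lambda>w. (Z w - Zn N w)\<^sup>2)"
      by (intro integrableI_bounded) (auto intro: le_less_trans)
    have "ennreal (\<integral>w. (Z w - Zn N w)\<^sup>2 \<partial>M) \<le> ennreal (e/2)"
      using le by (subst nn_integral_eq_integral[OF int, symmetric]) auto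
    then have "(\<integral>w. (Z w - Zn N w)\<^sup>2 \<partial>M) \<le> e/2" using that by (subst (asm) ennreal_le_iff) auto
    then show ?thesis using int that by (intro exI[of _ N]) auto
  qed
  obtain n where n: "integrable M (\<lambda>w. (Z w - Zn n w)\<^sup>2)" using close[of 1] by auto
  have "integrable M (\<lambda>w. (1 * (Z w - Zn n w) + 1 * Zn n w)\<^sup>2)"
    by (rule square_integrable_add(1)) (use n gauss_spanD(2)[OF Zn] in auto)
  then have Z2: "integrable M (\<lambda>w. (Z w)\<^sup>2)" by simp
  have "\<exists>J c. finite J \<and> J \<subseteq> U \<and> (\<integral>w. (Z w - lincomb J c w)\<^sup>2 \<partial>M) < e" if "0 < e" for e
  proof -
    \<comment> \<open>Quarters, since passing through \<open>Zn n\<close> doubles both squared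
      distances.\<close>
    have e4: "0 < e/4" using that by simp
    from close[OF e4] obtain n
      where n: "integrable M (\<lambda>w. (Z w - Zn n w)\<^sup>2)" "(\<integral>w. (Z w - Zn n w)\<^sup>2 \<partial>M) < e/4" by blast
    from e4 obtain J c where J: "finite J" "J \<subseteq> U" "(\<integral>w. (Zn n w - lincomb J c w)\<^sup>2 \<partial>M) < e/4"
      using Zn[of n] unfolding gauss_span_def by blast
    note [measurable] = lincomb_measurable[OF J(2)]
    have i2: "integrable M (\<lambda>w. (Zn n w - lincomb J c w)\<^sup>2)"
      using square_integrable_add(1)[of "Zn n" "lincomb J c" 1 "-1"] gauss_spanD[OF Zn] lincomb_gaussian(1)[OF J(1,2)] by simp
    have i3: "integrable M (\<lambda>w. (Z w - lincomb J c w)\<^sup>2)"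
      using square_integrable_add(1)[of Z "lincomb J c" 1 "-1"] Z2 lincomb_gaussian(1)[OF J(1,2)] by simp
    have le: "(x - z)\<^sup>2 \<le> 2 * (x - y)\<^sup>2 + 2 * (y - z)\<^sup>2" for x y z :: real
    proof -
      have "(x - z)\<^sup>2 + ((x - y) - (y - z))\<^sup>2 = 2 * (x - y)\<^sup>2 + 2 * (y - z)\<^sup>2"
        by (simp add: power2_eq_square algebra_simps)
      then show ?thesis using zero_le_power2[of "(x - y) - (y - z)"] by linarith
    qed
    have "(\<integral>w. (Z w - lincomb J c w)\<^sup>2 \<partial>M) \<le> (\<integral>w. 2 * (Z w - Zn n w)\<^sup>2 + 2 * (Zn n w - lincomb J c w)\<^sup>2 \<partial>M)"
      by (rule integral_mono[OF i3 _ le]) (use n i2 in auto)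
    also have "\<dots> = 2 * (\<integral>w. (Z w - Zn n w)\<^sup>2 \<partial>M) + 2 * (\<integral>w. (Zn n w - lincomb J c w)\<^sup>2 \<partial>M)"
      using n i2 by simp
    also have "\<dots> < e" using n J by simp
    finally show ?thesis using J by blast
  qed
  then show ?thesis using Z2 unfolding gauss_span_def by simp
qed

text \<open>Polarisation with all coefficients equal to 1, so that second moments of sums over index
  sets are all that enters. For x = y the two-point set collapses, hence the case
  distinction.\<close>

lemma covariance_eq:
  assumes "x \<in> U" "y \<in> U"
  shows "(\<integral>w. X x w * X y w \<partial>M) = K x y"
proof -
  have sym: "K x y = K y x" using gp assms by (auto simp: gaussian_process_def)
  have D: "0 \<le> (\<Sum>i\<in>J. \<Sum>j\<in>J. K i j) \<and>
      distr M borel (\<lambda>w. \<Sum>i\<in>J. X i w) = normal_law 0 (\<Sum>i\<in>J. \<Sum>j\<in>J. K i j)"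
    if "finite J" "J \<subseteq> U" for J
    using gp[unfolded gaussian_process_def, THEN conjunct2, THEN conjunct2, rule_format, of J "\<lambda>_. 1"] that
    by simp
  have sq: "(\<integral>w. (\<Sum>i\<in>J. X i w)\<^sup>2 \<partial>M) = (\<Sum>i\<in>J. \<Sum>j\<in>J. K i j)" if J: "finite J" "J \<subseteq> U" for J
  proof -
    have "(\<lambda>w. \<Sum>i\<in>J. X i w) \<in> borel_measurable M" using J X_measurable by (intro borel_measurable_sum) auto
    from normal_law_second_moment(2)[OF this] D[OF J] show ?thesis by auto
  qed
  show ?thesis
  proof (cases "x = y")
    case True
    then show ?thesis using sq[of "{x}"] assms by (simp add: power2_eq_square)
  next
    case False
    have sp: "X x \<in> gauss_span" "X y \<in> gauss_span" using assms X_gauss_span by auto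
    note sx = gauss_spanD[OF sp(1)] and sy = gauss_spanD[OF sp(2)]
    have i: "integrable M (\<lambda>w. X x w * X y w)"
      by (rule square_integrable_add(2)[OF sx(1) sy(1) sx(2) sy(2)])
    have "(\<integral>w. (\<Sum>i\<in>{x,y}. X i w)\<^sup>2 \<partial>M) = (\<integral>w. (X x w)\<^sup>2 + 2 * (X x w * X y w) + (X y w)\<^sup>2 \<partial>M)"
      using False by (intro Bochner_Integration.integral_cong) (auto simp: power2_eq_square algebra_simps)
    also have "\<dots> = (\<integral>w. (X x w)\<^sup>2 \<partial>M) + 2 * (\<integral>w. X x w * X y w \<partial>M) + (\<integral>w. (X y w)\<^sup>2 \<partial>M)"
      using sx(2) sy(2) i by simp
    finally show ?thesis using sq[of "{x,y}"] sq[of "{x}"] sq[of "{y}"] assms False sym by simp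
  qed
qed

end

section \<open>Differentiability of the covariance of a smooth Gaussian field\<close>

lemma frechet_derivative_partial:
  fixes f :: "real^'n::finite \<Rightarrow> real"
  assumes "f differentiable (at x)"
  shows "frechet_derivative f (at x) h = (\<Sum>j\<in>UNIV. h $ j * partial j f x)"
proof -
  have l: "linear (frechet_derivative f (at x))"
    by (rule linear_frechet_derivative[OF assms])
  have "frechet_derivative f (at x) h = frechet_derivative f (at x) (\<Sum>j\<in>UNIV. (h $ j) *\<^sub>R axis j 1)"
    using basis_expansion[of h] by (simp add: scalar_mult_eq_scaleR)
  also have "\<dots> = (\<Sum>j\<in>UNIV. h $ j * partial j f x)"
    by (simp add: linear_sum[OF l] linear_cmul[OF l] partial_def)
  finally show ?thesis .
qed

text \<open>Sequential form of differentiability, as limits in \<open>gauss_span\<close> are limits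
  of sequences.\<close>

lemma differentiable_remainder:
  fixes f :: "real^'n::finite \<Rightarrow> real"
  assumes d: "f differentiable (at x)" and y: "y \<longlonglongrightarrow> x" "\<And>n. y n \<noteq> x"
  shows "(\<lambda>n. (f (y n) - f x - (\<Sum>j\<in>UNIV. (y n - x) $ j * partial j f x)) / norm (y n - x)) \<longlonglongrightarrow> 0"
proof -
  have "(f has_derivative frechet_derivative f (at x)) (at x)"
    using d by (simp add: frechet_derivative_works)
  then have "((\<lambda>y. (1 / norm (y - x)) *\<^sub>R (f y - (f x + frechet_derivative f (at x) (y - x)))) \<longlongrightarrow> 0) (at x)"
    unfolding has_derivative_within by blast
  then have "((\<lambda>y. (1 / norm (y - x)) *\<^sub>R (f y - (f x + frechet_derivative f (at x) (y - x)))) \<circ> y) \<longlonglongrightarrow> 0"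
    using y unfolding tendsto_at_iff_sequentially by auto
  then show ?thesis
    by (simp add: o_def frechet_derivative_partial[OF d] field_simps)
qed

lemma partial_eqI:
  fixes f :: "real^'n::finite \<Rightarrow> real"
  assumes "(f has_derivative (\<lambda>h. \<Sum>j\<in>UNIV. h $ j * D j)) (at x)"
  shows "partial j f x = D j"
proof -
  have "frechet_derivative f (at x) = (\<lambda>h. \<Sum>j\<in>UNIV. h $ j * D j)"
    using frechet_derivative_at[OF assms] by simp
  then show ?thesis by (simp add: partial_def axis_def if_distrib[of "\<lambda>c. c * _"] cong: if_cong)
qed

context gaussian_family
begin

text \<open>Limit of difference quotients along a sequence that stays in \<open>V\<close>, where
  membership in the span is known.\<close>

lemma gauss_span_partial:
  fixes \<phi> :: "real^'n::finite \<Rightarrow> 'a \<Rightarrow> real"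
  assumes V: "open V" "x \<in> V" and sp: "\<And>x. x \<in> V \<Longrightarrow> \<phi> x \<in> gauss_span"
    and d: "\<And>w. w \<in> space M \<Longrightarrow> (\<lambda>x. \<phi> x w) differentiable (at x)"
  shows "(\<lambda>w. partial j (\<lambda>x. \<phi> x w) x) \<in> gauss_span"
proof -
  obtain \<epsilon> where \<epsilon>: "0 < \<epsilon>" "ball x \<epsilon> \<subseteq> V" using V by (meson openE)
  define t where "t n = \<epsilon> / 2 / real (Suc n)" for n
  define y where "y n = x + t n *\<^sub>R axis j 1" for n :: nat
  have t: "0 < t n" "t n < \<epsilon>" for n
  proof -
    show "0 < t n" using \<epsilon>(1) by (simp add: t_def)
    have "t n \<le> \<epsilon> / 2 / 1" unfolding t_def using \<epsilon>(1) by (intro divide_left_mono) auto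
    then show "t n < \<epsilon>" using \<epsilon>(1) by simp
  qed
  have tl: "t \<longlonglongrightarrow> 0"
    using LIMSEQ_Suc[OF lim_const_over_n[of "\<epsilon> / 2"]] by (simp add: t_def[abs_def])
  have nrm: "norm (y n - x) = t n" for n using t(1)[of n] by (simp add: y_def)
  have yV: "y n \<in> V" for n using t[of n] \<epsilon>(2) by (auto simp: y_def dist_norm)
  have yx: "y n \<noteq> x" for n using nrm[of n] t(1)[of n] by auto
  have yl: "y \<longlonglongrightarrow> x"
    unfolding y_def[abs_def] by (rule tendsto_eq_intros tl refl)+ simp
  show ?thesis
  proof (rule gauss_span_limit)
    show "(\<lambda>w. inverse (t n) * (\<phi> (y n) w - \<phi> x w)) \<in> gauss_span" for n
      by (intro gauss_span_scale gauss_span_diff sp yV V)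
    fix w assume w: "w \<in> space M"
    have "(\<lambda>n. (\<phi> (y n) w - \<phi> x w - (\<Sum>i\<in>UNIV. (y n - x) $ i * partial i (\<lambda>x. \<phi> x w) x)) / norm (y n - x)
        + partial j (\<lambda>x. \<phi> x w) x) \<longlonglongrightarrow> 0 + partial j (\<lambda>x. \<phi> x w) x"
      by (intro tendsto_add tendsto_const differentiable_remainder[OF d[OF w] yl yx])
    moreover have "(\<Sum>i\<in>UNIV. (y n - x) $ i * partial i (\<lambda>x. \<phi> x w) x) = t n * partial j (\<lambda>x. \<phi> x w) x" for n
      by (simp add: y_def axis_def if_distrib[of "\<lambda>c. c * _"] if_distrib[of "\<lambda>c. _ * c"] cong: if_cong)
    moreover have "(\<phi> (y n) w - \<phi> x w - t n * partial j (\<lambda>x. \<phi> x w) x) / t n + partial j (\<lambda>x. \<phi> x w) x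
       = inverse (t n) * (\<phi> (y n) w - \<phi> x w)" for n
      using t(1)[of n] by (simp add: field_simps)
    ultimately show "(\<lambda>n. inverse (t n) * (\<phi> (y n) w - \<phi> x w)) \<longlonglongrightarrow> partial j (\<lambda>x. \<phi> x w) x"
      by (simp add: nrm)
  qed
qed

text \<open>The remainder quotients lie in \<open>gauss_span\<close> and tend to 0 on every path;
  \<open>gauss_span_inner_limit\<close> then plays the part of a dominating function in
  differentiation under the integral.\<close>

lemma expectation_has_derivative:
  fixes \<phi> :: "real^'n::finite \<Rightarrow> 'a \<Rightarrow> real"
  assumes V: "open V" "x \<in> V" and sp: "\<And>x. x \<in> V \<Longrightarrow> \<phi> x \<in> gauss_span"
    and d: "\<And>w. w \<in> space M \<Longrightarrow> (\<lambda>x. \<phi> x w) differentiable (at x)" and W: "W \<in> gauss_span"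
  shows "((\<lambda>x. \<integral>w. \<phi> x w * W w \<partial>M) has_derivative
    (\<lambda>h. \<Sum>j\<in>UNIV. h $ j * (\<integral>w. partial j (\<lambda>x. \<phi> x w) x * W w \<partial>M))) (at x)"
    (is "(?g has_derivative ?D) (at x)")
proof -
  have "(?g has_derivative ?D) (at x within V)"
    unfolding has_derivative_within
  proof (intro conjI)
    show "bounded_linear ?D"
      by (intro bounded_linear_sum bounded_linear_mult_left[THEN bounded_linear_compose] bounded_linear_vec_nth)
    have p: "(\<lambda>w. partial j (\<lambda>x. \<phi> x w) x) \<in> gauss_span" for j by (rule gauss_span_partial[OF V sp d])
    show "((\<lambda>y. (1 / norm (y - x)) *\<^sub>R (?g y - (?g x + ?D (y - x)))) \<longlongrightarrow> 0) (at x within V)"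
      unfolding tendsto_at_iff_sequentially o_def
    proof (intro allI impI)
      fix y assume y: "\<forall>i. y i \<in> V - {x}" "y \<longlonglongrightarrow> x"
      define R where "R n w = inverse (norm (y n - x)) *
        (\<phi> (y n) w - \<phi> x w - (\<Sum>j\<in>UNIV. (y n - x) $ j * partial j (\<lambda>x. \<phi> x w) x))" for n w
      have S: "(\<lambda>w. \<Sum>j\<in>UNIV. (y n - x) $ j * partial j (\<lambda>x. \<phi> x w) x) \<in> gauss_span" for n
        by (intro gauss_span_sum gauss_span_scale p) auto
      have R: "R n \<in> gauss_span" for n
        unfolding R_def by (intro gauss_span_scale gauss_span_diff sp V S) (use y in auto)
      have "(\<lambda>n. \<integral>w. R n w * W w \<partial>M) \<longlonglongrightarrow> (\<integral>w. 0 * W w \<partial>M)"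
      proof (rule gauss_span_inner_limit[OF R gauss_span_zero W W])
        fix w assume "w \<in> space M"
        from differentiable_remainder[OF d[OF this] y(2)] y(1)
        show "(\<lambda>n. R n w) \<longlonglongrightarrow> 0" by (simp add: R_def field_simps)
      qed auto
      moreover have "(\<integral>w. R n w * W w \<partial>M) = (1 / norm (y n - x)) *\<^sub>R (?g (y n) - (?g x + ?D (y n - x)))" for n
      proof -
        have i: "integrable M (\<lambda>w. P w * W w)" if "P \<in> gauss_span" for P
          by (rule square_integrable_add(2)[OF gauss_spanD(1)[OF that] gauss_spanD(1)[OF W] gauss_spanD(2)[OF that] gauss_spanD(2)[OF W]])
        have yn: "\<phi> (y n) \<in> gauss_span" "\<phi> x \<in> gauss_span" using y V sp by auto
        have "R n w * W w = inverse (norm (y n - x)) * ((\<phi> (y n) w * W w - \<phi> x w * W w) -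
            (\<Sum>j\<in>UNIV. (y n - x) $ j * (partial j (\<lambda>x. \<phi> x w) x * W w)))" for w
          unfolding R_def by (simp add: left_diff_distrib sum_distrib_right mult.assoc)
        then have "(\<integral>w. R n w * W w \<partial>M) = inverse (norm (y n - x)) * (\<integral>w. (\<phi> (y n) w * W w - \<phi> x w * W w) -
            (\<Sum>j\<in>UNIV. (y n - x) $ j * (partial j (\<lambda>x. \<phi> x w) x * W w)) \<partial>M)"
          by simp
        also have "\<dots> = inverse (norm (y n - x)) * (((\<integral>w. \<phi> (y n) w * W w \<partial>M) - (\<integral>w. \<phi> x w * W w \<partial>M)) -
            (\<Sum>j\<in>UNIV. (y n - x) $ j * (\<integral>w. partial j (\<lambda>x. \<phi> x w) x * W w \<partial>M)))"
          using i[OF yn(1)] i[OF yn(2)] i[OF p] by simp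
        finally show ?thesis by (simp add: divide_inverse diff_diff_eq)
      qed
      ultimately show "(\<lambda>n. (1 / norm (y n - x)) *\<^sub>R (?g (y n) - (?g x + ?D (y n - x)))) \<longlonglongrightarrow> 0" by simp
    qed
  qed
  then show ?thesis unfolding at_within_open[OF V(2,1)] .
qed

end

locale gaussian_field = gaussian_family M X U K
  for M :: "'a measure" and X :: "real^'n::finite \<Rightarrow> 'a \<Rightarrow> real" and U K +
  assumes open_U: "open U" and C2: "\<And>w. w \<in> space M \<Longrightarrow> C2_on U (\<lambda>x. X x w)"
begin

lemma path_differentiable: "w \<in> space M \<Longrightarrow> x \<in> U \<Longrightarrow> (\<lambda>x. X x w) differentiable (at x)"
  using C2[of w] open_U unfolding C2_on_def C1_on_def differentiable_on_def by (metis at_within_open)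

lemma path_partial_differentiable:
  "w \<in> space M \<Longrightarrow> x \<in> U \<Longrightarrow> (\<lambda>x. partial j (\<lambda>x. X x w) x) differentiable (at x)"
  using C2[of w] open_U unfolding C2_on_def C1_on_def differentiable_on_def by (metis at_within_open)

lemma path_continuous: "w \<in> space M \<Longrightarrow> continuous_on U (\<lambda>x. X x w)"
  by (intro differentiable_imp_continuous_on) (use C2 in \<open>auto simp: C2_on_def C1_on_def\<close>)

text \<open>Continuity of the paths passes to mixed second moments by
  \<open>gauss_span_inner_limit\<close>.\<close>

lemma kernel_continuous: "continuous_on (U \<times> U) (\<lambda>(x, y). K x y)"
  unfolding continuous_on_sequentially
proof (intro allI ballI impI, elim conjE)
  fix z :: "nat \<Rightarrow> (real^'n) \<times> (real^'n)" and a
  assume a: "a \<in> U \<times> U" "\<forall>n. z n \<in> U \<times> U" "z \<longlonglongrightarrow> a"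
  have z: "fst (z n) \<in> U" "snd (z n) \<in> U" "fst a \<in> U" "snd a \<in> U" for n using a by (auto simp: mem_Times_iff)
  have l: "(\<lambda>n. fst (z n)) \<longlonglongrightarrow> fst a" "(\<lambda>n. snd (z n)) \<longlonglongrightarrow> snd a"
    using a(3) by (auto intro: tendsto_intros)
  have c: "(\<lambda>n. X (u n) w) \<longlonglongrightarrow> X b w" if "w \<in> space M" "\<And>n. u n \<in> U" "b \<in> U" "u \<longlonglongrightarrow> b" for u b w
    using path_continuous[OF that(1)] that unfolding continuous_on_sequentially o_def by blast
  have "(\<lambda>n. \<integral>w. X (fst (z n)) w * X (snd (z n)) w \<partial>M) \<longlonglongrightarrow> (\<integral>w. X (fst a) w * X (snd a) w \<partial>M)"
    by (intro gauss_span_inner_limit X_gauss_span z c l)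
  then show "((\<lambda>(x, y). K x y) \<circ> z) \<longlonglongrightarrow> (\<lambda>(x, y). K x y) a"
    using z by (simp add: covariance_eq o_def case_prod_beta)
qed

lemma kernel_differentiable:
  assumes y: "y \<in> U" and x: "x \<in> U"
  shows "(\<lambda>x. K x y) differentiable (at x)"
    and "partial j (\<lambda>x. K x y) x = (\<integral>w. partial j (\<lambda>x. X x w) x * X y w \<partial>M)"
proof -
  have "((\<lambda>x. \<integral>w. X x w * X y w \<partial>M) has_derivative
    (\<lambda>h. \<Sum>j\<in>UNIV. h $ j * (\<integral>w. partial j (\<lambda>x. X x w) x * X y w \<partial>M))) (at x)"
    by (rule expectation_has_derivative[OF open_U x X_gauss_span path_differentiable[OF _ x] X_gauss_span[OF y]])
  then have D: "((\<lambda>x. K x y) has_derivative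
    (\<lambda>h. \<Sum>j\<in>UNIV. h $ j * (\<integral>w. partial j (\<lambda>x. X x w) x * X y w \<partial>M))) (at x)"
    by (rule has_derivative_transform_within_open[OF _ open_U x]) (simp add: covariance_eq y)
  then show "(\<lambda>x. K x y) differentiable (at x)" by (auto simp: differentiable_def)
  show "partial j (\<lambda>x. K x y) x = (\<integral>w. partial j (\<lambda>x. X x w) x * X y w \<partial>M)"
    by (rule partial_eqI[OF D])
qed

text \<open>The first derivatives of the paths lie in \<open>gauss_span\<close> themselves, so
  differentiation under the expectation can be repeated. One argument of the kernel is enough: a
  posterior mean is a combination of kernel sections at the design inputs.\<close>

lemma kernel_partial_differentiable:
  assumes y: "y \<in> U" and x: "x \<in> U"
  shows "partial j (\<lambda>x. K x y) differentiable (at x)"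
proof -
  have "((\<lambda>x. \<integral>w. partial j (\<lambda>x. X x w) x * X y w \<partial>M) has_derivative
    (\<lambda>h. \<Sum>i\<in>UNIV. h $ i * (\<integral>w. partial i (\<lambda>x. partial j (\<lambda>x. X x w) x) x * X y w \<partial>M))) (at x)"
    by (rule expectation_has_derivative[OF open_U x
          gauss_span_partial[OF open_U _ X_gauss_span path_differentiable] path_partial_differentiable[OF _ x] X_gauss_span[OF y]])
  then have "(partial j (\<lambda>x. K x y) has_derivative
    (\<lambda>h. \<Sum>i\<in>UNIV. h $ i * (\<integral>w. partial i (\<lambda>x. partial j (\<lambda>x. X x w) x) x * X y w \<partial>M))) (at x)"
    by (rule has_derivative_transform_within_open[OF _ open_U x]) (simp add: kernel_differentiable(2) y)
  then show ?thesis by (auto simp: differentiable_def)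
qed

end

section \<open>Exact Gaussian updating\<close>

lemma borel_measurable_kernel_comp:
  fixes K :: "'a::euclidean_space \<Rightarrow> 'a \<Rightarrow> real"
  assumes K: "continuous_on (U \<times> U) (\<lambda>(x, y). K x y)" and U: "U \<in> sets borel"
    and [measurable]: "p \<in> borel_measurable N" "q \<in> borel_measurable N"
    and pq: "\<And>w. w \<in> space N \<Longrightarrow> p w \<in> U" "\<And>w. w \<in> space N \<Longrightarrow> q w \<in> U"
  shows "(\<lambda>w. K (p w) (q w)) \<in> borel_measurable N"
proof -
  have "(\<lambda>w. (p w, q w)) \<in> N \<rightarrow>\<^sub>M restrict_space borel (U \<times> U)"
    using pq by (intro measurable_restrict_space2) auto
  from measurable_compose[OF this borel_measurable_continuous_on_restrict[OF K]]
  show ?thesis by simp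
qed

text \<open>The points \<open>p\<close> and \<open>q\<close> are random, and arbitrary in the
  induction, because the recursion evaluates the previous kernel at the random input
  \<open>x n\<close>.\<close>

lemma borel_measurable_gp_cov:
  fixes K :: "'a::euclidean_space \<Rightarrow> 'a \<Rightarrow> real"
  assumes K: "continuous_on (U \<times> U) (\<lambda>(x, y). K x y)" and U: "U \<in> sets borel"
    and x: "\<And>i. i < n \<Longrightarrow> x i \<in> borel_measurable N" "\<And>i w. i < n \<Longrightarrow> w \<in> space N \<Longrightarrow> x i w \<in> U"
    and "p \<in> borel_measurable N" "q \<in> borel_measurable N"
    and "\<And>w. w \<in> space N \<Longrightarrow> p w \<in> U" "\<And>w. w \<in> space N \<Longrightarrow> q w \<in> U"
  shows "(\<lambda>w. gp_cov K v (\<lambda>i. x i w) n (p w) (q w)) \<in> borel_measurable N"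
  using x assms(5-)
proof (induct n arbitrary: p q)
  case 0
  show ?case unfolding gp_cov.simps by (rule borel_measurable_kernel_comp[OF K U 0(3-6)])
next
  case (Suc n)
  have IH: "(\<lambda>w. gp_cov K v (\<lambda>i. x i w) n (p w) (q w)) \<in> borel_measurable N"
    if "p \<in> borel_measurable N" "q \<in> borel_measurable N"
     "\<And>w. w \<in> space N \<Longrightarrow> p w \<in> U" "\<And>w. w \<in> space N \<Longrightarrow> q w \<in> U" for p q
    by (rule Suc(1)) (use Suc(2,3) that in auto)
  have xn: "x n \<in> borel_measurable N" "\<And>w. w \<in> space N \<Longrightarrow> x n w \<in> U" using Suc(2,3) by auto
  show ?case unfolding gp_cov.simps
    by (intro borel_measurable_diff borel_measurable_divide borel_measurable_times borel_measurable_add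
        borel_measurable_const IH xn Suc(4-))
qed

text \<open>Weaker than \<open>C2_on\<close>: existence of the second derivatives is what the
  covariance argument delivers and what \<open>mixed_quotient_gt\<close> consumes.\<close>

definition twice_differentiable_on :: "(real^'n::finite) set \<Rightarrow> (real^'n \<Rightarrow> real) \<Rightarrow> bool" where
  "twice_differentiable_on U f \<longleftrightarrow>
     (\<forall>x\<in>U. f differentiable (at x) \<and> (\<forall>j. partial j f differentiable (at x)))"

lemma partial_linear:
  fixes f g :: "real^'n::finite \<Rightarrow> real"
  assumes "f differentiable (at x)" "g differentiable (at x)"
  shows "partial j (\<lambda>x. a * f x + b * g x) x = a * partial j f x + b * partial j g x"
proof -
  have "(f has_derivative frechet_derivative f (at x)) (at x)" "(g has_derivative frechet_derivative g (at x)) (at x)"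
    using assms by (simp_all add: frechet_derivative_works)
  then have "((\<lambda>x. a * f x + b * g x) has_derivative
      (\<lambda>h. a * frechet_derivative f (at x) h + b * frechet_derivative g (at x) h)) (at x)"
    by (intro has_derivative_add has_derivative_mult_right)
  from frechet_derivative_at[OF this] show ?thesis by (simp add: partial_def fun_eq_iff)
qed

lemma twice_differentiable_on_linear:
  fixes f g :: "real^'n::finite \<Rightarrow> real"
  assumes U: "open U" and f: "twice_differentiable_on U f" and g: "twice_differentiable_on U g"
  shows "twice_differentiable_on U (\<lambda>x. a * f x + b * g x)"
  unfolding twice_differentiable_on_def
proof (intro ballI conjI allI)
  fix x assume x: "x \<in> U"
  show "(\<lambda>x. a * f x + b * g x) differentiable (at x)"
    using f g x by (auto simp: twice_differentiable_on_def)
  fix j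
  have "(\<lambda>x. a * partial j f x + b * partial j g x) differentiable (at x)"
    using f g x by (auto simp: twice_differentiable_on_def)
  then obtain D where "((\<lambda>x. a * partial j f x + b * partial j g x) has_derivative D) (at x)"
    by (auto simp: differentiable_def)
  then have "(partial j (\<lambda>x. a * f x + b * g x) has_derivative D) (at x)"
    by (rule has_derivative_transform_within_open[OF _ U x])
       (use f g in \<open>auto simp: twice_differentiable_on_def partial_linear\<close>)
  then show "partial j (\<lambda>x. a * f x + b * g x) differentiable (at x)" by (auto simp: differentiable_def)
qed

lemma twice_differentiable_on_zero: "twice_differentiable_on U (\<lambda>x. 0)"
  by (auto simp: twice_differentiable_on_def partial_def[abs_def])

lemma twice_differentiable_on_gp_cov:
  fixes K :: "real^'n::finite \<Rightarrow> real^'n \<Rightarrow> real"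
  assumes U: "open U" and K: "\<And>q. q \<in> U \<Longrightarrow> twice_differentiable_on U (\<lambda>p. K p q)"
    and x: "\<And>i. i < n \<Longrightarrow> x i \<in> U" and q: "q \<in> U"
  shows "twice_differentiable_on U (\<lambda>p. gp_cov K v x n p q)"
  using x q
proof (induct n arbitrary: q)
  case 0 then show ?case using K by simp
next
  case (Suc n)
  let ?c = "gp_cov K v x n"
  have "twice_differentiable_on U (\<lambda>p. 1 * ?c p q + (- ?c (x n) q / (?c (x n) (x n) + v)) * ?c p (x n))"
    by (intro twice_differentiable_on_linear[OF U] Suc) (use Suc(2) in auto)
  then show ?case by (simp add: mult.commute)
qed

lemma twice_differentiable_on_gp_mean:
  fixes K :: "real^'n::finite \<Rightarrow> real^'n \<Rightarrow> real"
  assumes U: "open U" and K: "\<And>q. q \<in> U \<Longrightarrow> twice_differentiable_on U (\<lambda>p. K p q)"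
    and x: "\<And>i. i < n \<Longrightarrow> x i \<in> U"
  shows "twice_differentiable_on U (gp_mean K v x y n)"
  using x
proof (induct n)
  case 0 then show ?case by (simp add: twice_differentiable_on_zero)
next
  case (Suc n)
  let ?c = "gp_cov K v x n"
  have "twice_differentiable_on U (\<lambda>p. 1 * gp_mean K v x y n p +
      ((y n - gp_mean K v x y n (x n)) / (?c (x n) (x n) + v)) * ?c p (x n))"
    by (intro twice_differentiable_on_linear[OF U] Suc twice_differentiable_on_gp_cov[OF U K])
       (use Suc(2) in auto)
  then show ?case by (simp add: mult.commute)
qed

lemma (in gaussian_field) kernel_twice_differentiable:
  "y \<in> U \<Longrightarrow> twice_differentiable_on U (\<lambda>x. K x y)"
  unfolding twice_differentiable_on_def
  using kernel_differentiable(1) kernel_partial_differentiable by auto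

section \<open>Mixed difference quotients\<close>

text \<open>Base point and step lengths form one argument, so that the quotient becomes a continuous
  function on a parameter set with a countable dense subset.\<close>

definition mixed_quotient ::
  "'n \<Rightarrow> 'n \<Rightarrow> (real^'n::finite) \<times> real \<times> real \<Rightarrow> (real^'n \<Rightarrow> real) \<Rightarrow> real" where
  "mixed_quotient r s z g = (case z of (x, h, k) \<Rightarrow>
     (g (x + h *\<^sub>R axis r 1 + k *\<^sub>R axis s 1) - g (x + h *\<^sub>R axis r 1)
        - g (x + k *\<^sub>R axis s 1) + g x) / (h * k))"

lemma partial_has_real_derivative:
  fixes f :: "real^'n::finite \<Rightarrow> real"
  assumes "f differentiable (at (x + t *\<^sub>R axis j 1))"
  shows "((\<lambda>t. f (x + t *\<^sub>R axis j 1)) has_real_derivative partial j f (x + t *\<^sub>R axis j 1)) (at t)"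
proof -
  let ?D = "frechet_derivative f (at (x + t *\<^sub>R axis j 1))"
  have D: "(f has_derivative ?D) (at (x + t *\<^sub>R axis j 1))" using assms by (simp add: frechet_derivative_works)
  have l: "linear ?D" by (rule linear_frechet_derivative[OF assms])
  have "((\<lambda>t. f (x + t *\<^sub>R axis j 1)) has_derivative (\<lambda>u. ?D (u *\<^sub>R axis j 1))) (at t)"
    by (rule has_derivative_compose[where f="\<lambda>t. x + t *\<^sub>R axis j 1" and g=f and f'="\<lambda>u. u *\<^sub>R axis j 1", OF _ D]) (auto intro!: derivative_eq_intros)
  then show ?thesis
    by (simp add: has_field_derivative_def partial_def linear_cmul[OF l] mult.commute[of _ "?D _"])
qed

lemma partial_quotient_gt:
  fixes f :: "real^'n::finite \<Rightarrow> real"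
  assumes f: "f differentiable (at x)" and m: "m < \<bar>partial j f x\<bar>" and U: "open U" "x \<in> U" and "0 < \<epsilon>"
  shows "\<exists>h. 0 < h \<and> h < \<epsilon> \<and> x + h *\<^sub>R axis j 1 \<in> U \<and> m < \<bar>(f (x + h *\<^sub>R axis j 1) - f x) / h\<bar>"
proof -
  have "((\<lambda>t. f (x + t *\<^sub>R axis j 1)) has_real_derivative partial j f x) (at 0)"
    using partial_has_real_derivative[of f x 0 j] f by simp
  then have "((\<lambda>h. (f (x + h *\<^sub>R axis j 1) - f x) / h) \<longlongrightarrow> partial j f x) (at 0)"
    by (simp add: DERIV_def)
  then have "((\<lambda>h. \<bar>(f (x + h *\<^sub>R axis j 1) - f x) / h\<bar>) \<longlongrightarrow> \<bar>partial j f x\<bar>) (at_right 0)"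
    by (intro tendsto_rabs) (rule filterlim_mono[OF _ order_refl at_le], auto)
  then have "\<forall>\<^sub>F h in at_right 0. m < \<bar>(f (x + h *\<^sub>R axis j 1) - f x) / h\<bar>"
    using m by (rule order_tendstoD)
  moreover have "\<forall>\<^sub>F h in at_right 0. x + h *\<^sub>R axis j 1 \<in> U"
  proof (rule topological_tendstoD[OF _ U(1)])
    show "((\<lambda>h. x + h *\<^sub>R axis j 1) \<longlongrightarrow> x) (at_right 0)" by (auto intro!: tendsto_eq_intros)
  qed (use U in auto)
  moreover have "\<forall>\<^sub>F h in at_right 0. 0 < h \<and> h < \<epsilon>"
    using \<open>0 < \<epsilon>\<close> by (auto simp: eventually_at_right_field)
  ultimately have "\<forall>\<^sub>F h in at_right 0. 0 < h \<and> h < \<epsilon> \<and> x + h *\<^sub>R axis j 1 \<in> U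
      \<and> m < \<bar>(f (x + h *\<^sub>R axis j 1) - f x) / h\<bar>"
    by eventually_elim auto
  then show ?thesis using eventually_happens[of _ "at_right (0::real)"] by fastforce
qed

text \<open>Two rounds of \<open>partial_quotient_gt\<close>: one in direction r for
  \<open>partial s f\<close>, and one in direction s for the difference quotient of f in direction
  r, whose s-derivative the first round has made large.\<close>

lemma mixed_quotient_gt:
  fixes f :: "real^'n::finite \<Rightarrow> real"
  assumes f: "twice_differentiable_on U f" and m: "m < \<bar>partial r (partial s f) x\<bar>"
    and U: "open U" "x \<in> U" and "0 < \<epsilon>"
  shows "\<exists>h k. 0 < h \<and> h < \<epsilon> \<and> 0 < k \<and> k < \<epsilon> \<and> m < \<bar>mixed_quotient r s (x, h, k) f\<bar>"
proof -
  have "partial s f differentiable (at x)" using f U by (auto simp: twice_differentiable_on_def)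
  from partial_quotient_gt[OF this m U \<open>0 < \<epsilon>\<close>] obtain h where h: "0 < h" "h < \<epsilon>" "x + h *\<^sub>R axis r 1 \<in> U"
    and gt: "m < \<bar>(partial s f (x + h *\<^sub>R axis r 1) - partial s f x) / h\<bar>" by blast
  define g where "g y = inverse h * f (h *\<^sub>R axis r 1 + y) + (- inverse h) * f y" for y
  have d: "f differentiable (at (h *\<^sub>R axis r 1 + x))" "f differentiable (at x)"
    using f U h by (auto simp: twice_differentiable_on_def add.commute)
  obtain D where D: "(f has_derivative D) (at (h *\<^sub>R axis r 1 + x))" using d(1) by (auto simp: differentiable_def)
  have "((\<lambda>y. f (h *\<^sub>R axis r 1 + y)) has_derivative D) (at x)"
    by (rule has_derivative_compose[where f="\<lambda>y. h *\<^sub>R axis r 1 + y" and g=f and f'="\<lambda>y. y", OF _ D]) (auto intro!: derivative_eq_intros)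
  then have d': "(\<lambda>y. f (h *\<^sub>R axis r 1 + y)) differentiable (at x)"
    and p': "partial s (\<lambda>y. f (h *\<^sub>R axis r 1 + y)) x = partial s f (h *\<^sub>R axis r 1 + x)"
    using frechet_derivative_at[OF D] by (auto simp: differentiable_def partial_def dest: frechet_derivative_at)
  have dg: "g differentiable (at x)" unfolding g_def[abs_def] using d' d(2) by auto
  have "partial s g x = (partial s f (x + h *\<^sub>R axis r 1) - partial s f x) / h"
    unfolding g_def[abs_def] partial_linear[OF d' d(2)] p' by (simp add: add.commute divide_inverse algebra_simps)
  with gt have "m < \<bar>partial s g x\<bar>" by simp
  from partial_quotient_gt[OF dg this U \<open>0 < \<epsilon>\<close>] obtain k where k: "0 < k" "k < \<epsilon>"
    "m < \<bar>(g (x + k *\<^sub>R axis s 1) - g x) / k\<bar>" by blast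
  moreover have "(g (x + k *\<^sub>R axis s 1) - g x) / k = mixed_quotient r s (x, h, k) f"
    using h k by (simp add: g_def mixed_quotient_def field_simps)
  ultimately show ?thesis using h by auto
qed

text \<open>\<open>D'\<close> is the Minkowski sum of \<open>D\<close> with a closed ball of radius
  d. With two steps each below d / 2 the displacement stays within d, so all corners of the
  quotients lie in \<open>D'\<close>.\<close>

lemma compact_neighbourhood:
  fixes D :: "(real^'n::finite) set"
  assumes "compact D" "open U" "D \<subseteq> U"
  obtains \<epsilon> D' where "0 < \<epsilon>" "compact D'" "D' \<subseteq> U"
    "\<And>x h k r s. x \<in> D \<Longrightarrow> 0 \<le> h \<Longrightarrow> h < \<epsilon> \<Longrightarrow> 0 \<le> k \<Longrightarrow> k < \<epsilon> \<Longrightarrow> x + h *\<^sub>R axis r 1 + k *\<^sub>R axis s 1 \<in> D'"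
proof -
  obtain d where d: "0 < d" "(\<Union>x\<in>D. cball x d) \<subseteq> U"
    using compact_subset_open_imp_cball_epsilon_subset[OF assms] by blast
  define D' where "D' = {x + y | x y. x \<in> D \<and> y \<in> cball 0 d}"
  have "compact D'" unfolding D'_def using assms(1) by (intro compact_sums) auto
  moreover have "D' \<subseteq> U"
  proof
    fix z assume "z \<in> D'"
    then obtain x y where "z = x + y" "x \<in> D" "y \<in> cball 0 d" by (auto simp: D'_def)
    then have "x \<in> D" "z \<in> cball x d" by (auto simp: dist_norm)
    then have "z \<in> (\<Union>x\<in>D. cball x d)" by blast
    then show "z \<in> U" using d(2) by (rule rev_subsetD)
  qed
  moreover have "x + h *\<^sub>R axis r 1 + k *\<^sub>R axis s 1 \<in> D'"
    if "x \<in> D" "0 \<le> h" "h < d / 2" "0 \<le> k" "k < d / 2" for x h k r s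
  proof -
    have "norm (h *\<^sub>R axis r 1 + k *\<^sub>R axis s (1::real)) \<le> h + k"
      using norm_triangle_ineq[of "h *\<^sub>R axis r 1" "k *\<^sub>R axis s (1::real)"] that by simp
    then have "h *\<^sub>R axis r 1 + k *\<^sub>R axis s (1::real) \<in> cball 0 d"
      using that unfolding mem_cball dist_0_norm by linarith
    then show ?thesis unfolding D'_def using that(1) by (auto simp: add.assoc)
  qed
  ultimately show ?thesis using d(1) by (intro that[of "d/2" D']) auto
qed

text \<open>Two applications of the mean value theorem turn the quotient into
  \<open>partial s (partial r f)\<close> at an intermediate point; this function is continuous,
  hence bounded on the compact set, and the bound serves all step lengths.\<close>

lemma mixed_quotient_bounded:
  fixes f :: "real^'n::finite \<Rightarrow> real"
  assumes f: "C2_on U f" and U: "open U" and D': "compact D'" "D' \<subseteq> U"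
  obtains B where "\<And>x h k. 0 < h \<Longrightarrow> 0 < k \<Longrightarrow>
    (\<And>u v. 0 \<le> u \<Longrightarrow> u \<le> h \<Longrightarrow> 0 \<le> v \<Longrightarrow> v \<le> k \<Longrightarrow> x + u *\<^sub>R axis r 1 + v *\<^sub>R axis s 1 \<in> D') \<Longrightarrow>
    \<bar>mixed_quotient r s (x, h, k) f\<bar> \<le> B"
proof -
  have d: "f differentiable (at y)" "partial r f differentiable (at y)" if "y \<in> D'" for y
    using f U D' that unfolding C2_on_def C1_on_def differentiable_on_def by (metis at_within_open subsetD)+
  have "continuous_on D' (partial s (partial r f))"
    by (rule continuous_on_subset[OF _ D'(2)]) (use f in \<open>auto simp: C2_on_def C1_on_def\<close>)
  then have "bounded (partial s (partial r f) ` D')"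
    using D' by (intro compact_imp_bounded compact_continuous_image)
  then obtain B where B: "\<And>y. y \<in> D' \<Longrightarrow> \<bar>partial s (partial r f) y\<bar> \<le> B"
    by (auto simp: bounded_iff)
  show ?thesis
  proof (rule that[of B])
    fix x h k assume h: "0 < h" and k: "0 < k"
      and in': "\<And>u v. 0 \<le> u \<Longrightarrow> u \<le> h \<Longrightarrow> 0 \<le> v \<Longrightarrow> v \<le> k \<Longrightarrow> x + u *\<^sub>R axis r 1 + v *\<^sub>R axis s 1 \<in> D'"
    define \<phi> where "\<phi> u = f ((x + k *\<^sub>R axis s 1) + u *\<^sub>R axis r 1) - f (x + u *\<^sub>R axis r 1)" for u
    have i1: "(x + k *\<^sub>R axis s 1) + u *\<^sub>R axis r 1 \<in> D'" "x + u *\<^sub>R axis r 1 \<in> D'" if "0 \<le> u" "u \<le> h" for u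
      using in'[OF that, of k] in'[OF that, of 0] k by (auto simp: add_ac)
    have "\<exists>z>0. z < h \<and> \<phi> h - \<phi> 0 = (h - 0) * (partial r f ((x + k *\<^sub>R axis s 1) + z *\<^sub>R axis r 1) - partial r f (x + z *\<^sub>R axis r 1))"
      unfolding \<phi>_def using h
      by (intro MVT2 DERIV_diff partial_has_real_derivative d i1) auto
    then obtain z where z: "0 < z" "z < h"
      and e1: "\<phi> h - \<phi> 0 = h * (partial r f ((x + k *\<^sub>R axis s 1) + z *\<^sub>R axis r 1) - partial r f (x + z *\<^sub>R axis r 1))"
      by auto
    define \<psi> where "\<psi> v = partial r f ((x + z *\<^sub>R axis r 1) + v *\<^sub>R axis s 1)" for v
    have "\<exists>y>0. y < k \<and> \<psi> k - \<psi> 0 = (k - 0) * partial s (partial r f) ((x + z *\<^sub>R axis r 1) + y *\<^sub>R axis s 1)"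
      unfolding \<psi>_def using k z
      by (intro MVT2 partial_has_real_derivative d in') auto
    then obtain y where y: "0 < y" "y < k"
      and e2: "\<psi> k - \<psi> 0 = k * partial s (partial r f) ((x + z *\<^sub>R axis r 1) + y *\<^sub>R axis s 1)" by auto
    have "\<phi> h - \<phi> 0 = h * (k * partial s (partial r f) ((x + z *\<^sub>R axis r 1) + y *\<^sub>R axis s 1))"
      unfolding e1 e2[symmetric] by (simp add: \<psi>_def add_ac)
    moreover have "mixed_quotient r s (x, h, k) f = (\<phi> h - \<phi> 0) / (h * k)"
      by (simp add: mixed_quotient_def \<phi>_def add_ac)
    ultimately have "mixed_quotient r s (x, h, k) f = partial s (partial r f) ((x + z *\<^sub>R axis r 1) + y *\<^sub>R axis s 1)"
      using h k by simp
    then show "\<bar>mixed_quotient r s (x, h, k) f\<bar> \<le> B" using B in' z y by simp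
  qed
qed

section \<open>Posterior densities and their mixtures\<close>

text \<open>Replacing x by the first point of a dense sequence within 1 / (n + 1) leaves countably
  many sections, each of them measurable; continuity in x gives the limit.\<close>

lemma borel_measurable_caratheodory:
  fixes G :: "'w \<Rightarrow> 'b::euclidean_space \<Rightarrow> real"
  assumes m: "\<And>x. x \<in> D \<Longrightarrow> (\<lambda>w. G w x) \<in> borel_measurable N"
    and c: "\<And>w. w \<in> space N \<Longrightarrow> continuous_on D (G w)"
  shows "(\<lambda>z. G (fst z) (snd z)) \<in> borel_measurable (N \<Otimes>\<^sub>M restrict_space lborel D)"
proof (cases "D = {}")
  case True
  then have "space (N \<Otimes>\<^sub>M restrict_space lborel D) = {}" by (simp add: space_pair_measure space_restrict_space)
  then show ?thesis by (simp add: measurable_def)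
next
  case False
  obtain T where T: "countable T" "T \<subseteq> D" "D \<subseteq> closure T" by (rule separable)
  with False have "T \<noteq> {}" by auto
  define d where "d = from_nat_into T"
  have d: "d i \<in> D" for i using from_nat_into[OF \<open>T \<noteq> {}\<close>, of i] T(2) by (auto simp: d_def)
  define idx where "idx n x = (LEAST i. dist (d i) x < 1 / real (Suc n))" for n :: nat and x
  have idx: "dist (d (idx n x)) x < 1 / real (Suc n)" if "x \<in> D" for n x
  proof -
    have "\<exists>y\<in>T. dist y x < 1 / real (Suc n)"
      using T(3) that closure_approachable[of x T] by (auto simp del: of_nat_Suc)
    then have "\<exists>i. dist (d i) x < 1 / real (Suc n)"
      using from_nat_into_surj[OF T(1)] by (metis d_def)
    then show ?thesis unfolding idx_def by (rule LeastI_ex)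
  qed
  let ?L = "restrict_space lborel D"
  have snd_m: "snd \<in> borel_measurable (N \<Otimes>\<^sub>M ?L)"
    by (rule measurable_compose[OF measurable_snd]) (simp add: measurable_restrict_space1)
  show ?thesis
  proof (rule borel_measurable_LIMSEQ_real)
    show "(\<lambda>z. G (fst z) (d (idx n (snd z)))) \<in> borel_measurable (N \<Otimes>\<^sub>M ?L)" for n
    proof (rule measurable_compose_countable[where f="\<lambda>i z. G (fst z) (d i)"])
      show "(\<lambda>z. G (fst z) (d i)) \<in> borel_measurable (N \<Otimes>\<^sub>M ?L)" for i
        by (rule measurable_compose[OF measurable_fst m[OF d]])
      show "(\<lambda>z. idx n (snd z)) \<in> (N \<Otimes>\<^sub>M ?L) \<rightarrow>\<^sub>M count_space UNIV"
          unfolding idx_def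
      proof (rule measurable_Least)
        fix i
        have "(\<lambda>z. dist (d i) (snd z)) \<in> borel_measurable (N \<Otimes>\<^sub>M ?L)"
          by (intro borel_measurable_dist snd_m borel_measurable_const)
        then show "Measurable.pred (N \<Otimes>\<^sub>M ?L) (\<lambda>z. dist (d i) (snd z) < 1 / real (Suc n))"
          by measurable
      qed
    qed
    fix z assume "z \<in> space (N \<Otimes>\<^sub>M ?L)"
    then have z: "fst z \<in> space N" "snd z \<in> D" by (auto simp: space_pair_measure space_restrict_space)
    have "(\<lambda>n. d (idx n (snd z))) \<longlonglongrightarrow> snd z"
    proof (rule metric_tendsto_imp_tendsto[OF LIMSEQ_inverse_real_of_nat], rule always_eventually, rule allI)
      fix n show "dist (d (idx n (snd z))) (snd z) \<le> dist (inverse (real (Suc n))) 0"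
        using idx[OF z(2), of n] by (simp add: inverse_eq_divide del: of_nat_Suc)
    qed
    then show "(\<lambda>n. G (fst z) (d (idx n (snd z)))) \<longlonglongrightarrow> G (fst z) (snd z)"
      using c[OF z(1), unfolded continuous_on_sequentially, rule_format, of "snd z" "\<lambda>n. d (idx n (snd z))"] d z(2)
      by (simp add: o_def)
  qed
qed

lemma sets_lebesgue_region: "sets (lebesgue_region D) = sets (restrict_space borel D)"
  by (simp add: sets_restrict_space)

lemma finite_measure_lebesgue_region:
  fixes D :: "'b::euclidean_space set"
  assumes "compact D"
  shows "finite_measure (lebesgue_region D)"
proof -
  have "emeasure lborel D < \<infinity>" using emeasure_bounded_finite[OF compact_imp_bounded[OF assms]] .
  then show ?thesis
    using assms by (intro finite_measureI) (simp add: space_restrict_space emeasure_restrict_space borel_compact less_top)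
qed

definition post_density :: "(real^'n::finite) set \<Rightarrow> (real^'n \<Rightarrow> real) \<Rightarrow> real^'n \<Rightarrow> real" where
  "post_density D g x = exp (g x) / normaliser D g"

lemma posterior_eq: "posterior D g = density (lebesgue_region D) (\<lambda>x. ennreal (post_density D g x))"
  by (simp add: posterior_def post_density_def)

lemma continuous_on_region_integrable:
  fixes D :: "(real^'n::finite) set" and h :: "real^'n \<Rightarrow> real"
  assumes D: "compact D" and h: "continuous_on D h"
  shows "integrable (lebesgue_region D) h"
proof -
  interpret finite_measure "lebesgue_region D" by (rule finite_measure_lebesgue_region[OF D])
  obtain B where B: "\<And>x. x \<in> D \<Longrightarrow> norm (h x) \<le> B"
    using compact_imp_bounded[OF compact_continuous_image[OF h D]] by (auto simp: bounded_iff)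
  show ?thesis
  proof (rule integrable_const_bound[where B=B])
    show "AE x in lebesgue_region D. norm (h x) \<le> B"
      by (rule AE_I2) (use B in \<open>auto simp: space_restrict_space\<close>)
    show "h \<in> borel_measurable (lebesgue_region D)"
      using borel_measurable_continuous_on_restrict[OF h] by (simp cong: measurable_cong_sets add: sets_lebesgue_region)
  qed
qed

lemma normaliser_pos:
  fixes D :: "(real^'n::finite) set"
  assumes D: "compact D" "0 < measure lborel D" and g: "continuous_on D g"
  shows "0 < normaliser D g"
proof -
  interpret finite_measure "lebesgue_region D" by (rule finite_measure_lebesgue_region[OF D(1)])
  obtain B where B: "\<And>x. x \<in> D \<Longrightarrow> norm (g x) \<le> B"
    using compact_imp_bounded[OF compact_continuous_image[OF g D(1)]] by (auto simp: bounded_iff)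
  have mD: "measure (lebesgue_region D) D = measure lborel D"
    using D(1) by (intro measure_restrict_space) (auto simp: borel_compact)
  have "0 < exp (- B) * measure lborel D" using D(2) by simp
  also have "\<dots> = (\<integral>x. exp (- B) \<partial>lebesgue_region D)" using mD by (simp add: space_restrict_space)
  also have "\<dots> \<le> normaliser D g"
    unfolding normaliser_def
  proof (rule integral_mono)
    show "integrable (lebesgue_region D) (\<lambda>x. exp (g x))"
      by (intro continuous_on_region_integrable D continuous_intros g)
    fix x assume "x \<in> space (lebesgue_region D)"
    then have "x \<in> D" by (simp add: space_restrict_space)
    from B[OF this] show "exp (- B) \<le> exp (g x)" by auto
  qed simp
  finally show ?thesis .
qed

text \<open>The family \<open>G\<close> is abstract because it is instantiated in several ways: by
  the random paths, by the identity on path space, and by a constant family over the one-point space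
  when a single continuous function is meant.\<close>

context
  fixes D :: "(real^'n::finite) set" and N :: "'w measure" and G :: "'w \<Rightarrow> real^'n \<Rightarrow> real"
  assumes D: "compact D" "0 < measure lborel D"
    and m: "\<And>x. x \<in> D \<Longrightarrow> (\<lambda>w. G w x) \<in> borel_measurable N"
    and c: "\<And>w. w \<in> space N \<Longrightarrow> continuous_on D (G w)"
begin

lemma borel_measurable_post_density:
  "(\<lambda>z. post_density D (G (fst z)) (snd z)) \<in> borel_measurable (N \<Otimes>\<^sub>M lebesgue_region D)"
  "x \<in> D \<Longrightarrow> (\<lambda>w. post_density D (G w) x) \<in> borel_measurable N"
proof -
  interpret L: finite_measure "lebesgue_region D" by (rule finite_measure_lebesgue_region[OF D(1)])
  note [measurable] = borel_measurable_caratheodory[OF m c]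
  have nm [measurable]: "(\<lambda>w. normaliser D (G w)) \<in> borel_measurable N"
    unfolding normaliser_def by (rule L.borel_measurable_lebesgue_integral) (simp add: case_prod_beta)
  show "(\<lambda>z. post_density D (G (fst z)) (snd z)) \<in> borel_measurable (N \<Otimes>\<^sub>M lebesgue_region D)"
    unfolding post_density_def by measurable
  show "(\<lambda>w. post_density D (G w) x) \<in> borel_measurable N" if "x \<in> D"
    unfolding post_density_def using m[OF that] by measurable
qed

lemma post_density_pos: "w \<in> space N \<Longrightarrow> 0 < post_density D (G w) x"
  unfolding post_density_def using normaliser_pos[OF D c] by simp

lemma post_density_measurable_x:
  "w \<in> space N \<Longrightarrow> post_density D (G w) \<in> borel_measurable (lebesgue_region D)"
  using measurable_compose[OF measurable_Pair1' borel_measurable_post_density(1), of w] by simp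

lemma post_density_integral:
  assumes w: "w \<in> space N"
  shows "integrable (lebesgue_region D) (post_density D (G w))"
    "(\<integral>x. post_density D (G w) x \<partial>lebesgue_region D) = 1"
    "(\<integral>\<^sup>+x. ennreal (post_density D (G w) x) \<partial>lebesgue_region D) = 1"
proof -
  have "integrable (lebesgue_region D) (\<lambda>x. exp (G w x))"
    by (intro continuous_on_region_integrable D continuous_intros c w)
  then show i: "integrable (lebesgue_region D) (post_density D (G w))"
    unfolding post_density_def[abs_def] by simp
  show I: "(\<integral>x. post_density D (G w) x \<partial>lebesgue_region D) = 1"
    unfolding post_density_def using normaliser_pos[OF D c[OF w]] by (simp add: normaliser_def)
  show "(\<integral>\<^sup>+x. ennreal (post_density D (G w) x) \<partial>lebesgue_region D) = 1"
    using nn_integral_eq_integral[OF i] post_density_pos[OF w] I by (simp add: less_imp_le)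
qed

lemma posterior_kernel: "(\<lambda>w. posterior D (G w)) \<in> N \<rightarrow>\<^sub>M subprob_algebra (restrict_space borel D)"
proof (rule measurable_subprob_algebra)
  interpret L: finite_measure "lebesgue_region D" by (rule finite_measure_lebesgue_region[OF D(1)])
  fix w assume w: "w \<in> space N"
  show s: "sets (posterior D (G w)) = sets (restrict_space borel D)"
    by (simp add: posterior_def sets_lebesgue_region)
  have "prob_space (posterior D (G w))"
  proof (rule prob_spaceI)
    have "emeasure (posterior D (G w)) (space (posterior D (G w)))
        = (\<integral>\<^sup>+x. ennreal (post_density D (G w) x) * indicator (space (lebesgue_region D)) x \<partial>lebesgue_region D)"
      using post_density_measurable_x[OF w] unfolding posterior_eq by (simp add: emeasure_density)
    also have "\<dots> = (\<integral>\<^sup>+x. ennreal (post_density D (G w) x) \<partial>lebesgue_region D)"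
      by (intro nn_integral_cong) auto
    finally show "emeasure (posterior D (G w)) (space (posterior D (G w))) = 1"
      using post_density_integral(3)[OF w] by simp
  qed
  then show "subprob_space (posterior D (G w))" by (rule prob_space_imp_subprob_space)
next
  interpret L: finite_measure "lebesgue_region D" by (rule finite_measure_lebesgue_region[OF D(1)])
  fix A assume "A \<in> sets (restrict_space borel D)"
  then have [measurable]: "A \<in> sets (lebesgue_region D)" by (simp add: sets_lebesgue_region)
  note [measurable] = borel_measurable_post_density(1)
  have "(\<lambda>w. \<integral>\<^sup>+x. ennreal (post_density D (G w) x) * indicator A x \<partial>lebesgue_region D) \<in> borel_measurable N"
    by (rule L.borel_measurable_nn_integral) (simp add: case_prod_beta)
  moreover have "emeasure (posterior D (G w)) A = (\<integral>\<^sup>+x. ennreal (post_density D (G w) x) * indicator A x \<partial>lebesgue_region D)"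
    if "w \<in> space N" for w
    unfolding posterior_def using post_density_measurable_x[OF that]
    by (subst emeasure_density) (auto simp: post_density_def[abs_def])
  ultimately show "(\<lambda>w. emeasure (posterior D (G w)) A) \<in> borel_measurable N"
    by (simp cong: measurable_cong)
qed

end

lemma path_space_coordinate: "x \<in> U \<Longrightarrow> (\<lambda>g. g x) \<in> borel_measurable (path_space U)"
  unfolding path_space_def by (intro measurable_restrict_space1 measurable_component_singleton)

lemma path_space_continuous: "g \<in> space (path_space U) \<Longrightarrow> continuous_on U g"
  by (simp add: path_space_def space_restrict_space)

lemma measurable_into_path_space:
  assumes "\<And>x. x \<in> U \<Longrightarrow> (\<lambda>w. X w x) \<in> borel_measurable M" "\<And>w. w \<in> space M \<Longrightarrow> continuous_on U (X w)"
  shows "(\<lambda>w. restrict (X w) U) \<in> M \<rightarrow>\<^sub>M path_space U"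
  unfolding path_space_def
proof (rule measurable_restrict_space2)
  show "(\<lambda>w. restrict (X w) U) \<in> M \<rightarrow>\<^sub>M Pi\<^sub>M U (\<lambda>_. borel)"
    by (rule measurable_restrict) (rule assms(1))
  show "(\<lambda>w. restrict (X w) U) \<in> space M \<rightarrow> {g. continuous_on U g}"
    using assms(2) by (auto cong: continuous_on_cong)
qed

section \<open>Mixtures of posteriors over a law on path space\<close>

definition mixture_posterior :: "(real^'n::finite) set \<Rightarrow> (real^'n \<Rightarrow> real) measure \<Rightarrow> (real^'n) measure" where
  "mixture_posterior D P = measure_of D (sets (restrict_space borel D)) (\<lambda>A. \<integral>\<^sup>+g. emeasure (posterior D g) A \<partial>P)"

lemma expected_posterior_eq: "expected_posterior S t w = mixture_posterior (region S) (post_law S t w)"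
  by (simp add: expected_posterior_def mixture_posterior_def)

text \<open>Kept in \<open>ennreal\<close> because at a single point the average of the densities
  may be infinite.\<close>

definition mixture_density :: "(real^'n::finite) set \<Rightarrow> (real^'n \<Rightarrow> real) measure \<Rightarrow> real^'n \<Rightarrow> ennreal" where
  "mixture_density D P x = (\<integral>\<^sup>+g. ennreal (post_density D g x) \<partial>P)"

text \<open>A crude form without the factor 1/2, obtained set by set from the triangle
  inequality.\<close>

lemma total_variation_density_le:
  fixes p q :: "'b \<Rightarrow> real"
  assumes p: "integrable L p" "\<And>x. x \<in> space L \<Longrightarrow> 0 \<le> p x"
    and q: "integrable L q" "\<And>x. x \<in> space L \<Longrightarrow> 0 \<le> q x"
    and P: "P = density L (\<lambda>x. ennreal (p x))" and Q: "Q = density L (\<lambda>x. ennreal (q x))"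
  shows "total_variation P Q \<le> (\<integral>x. \<bar>p x - q x\<bar> \<partial>L)"
  unfolding total_variation_def
proof (rule cSUP_least)
  show "sets P \<noteq> {}" by auto
  fix A assume "A \<in> sets P"
  then have A [measurable]: "A \<in> sets L" by (simp add: P)
  have i: "integrable L (\<lambda>x. h x * indicator A x)" if "integrable L h" for h :: "'b \<Rightarrow> real"
    using integrable_mult_indicator[OF A that] by (simp add: mult.commute)
  have meas: "measure (density L (\<lambda>x. ennreal (h x))) A = (\<integral>x. h x * indicator A x \<partial>L)"
    if "integrable L h" "\<And>x. x \<in> space L \<Longrightarrow> 0 \<le> h x" for h :: "'b \<Rightarrow> real"
  proof -
    have "emeasure (density L (\<lambda>x. ennreal (h x))) A = (\<integral>\<^sup>+x. ennreal (h x * indicator A x) \<partial>L)"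
      using that by (subst emeasure_density) (auto intro!: nn_integral_cong simp: indicator_def)
    also have "\<dots> = ennreal (\<integral>x. h x * indicator A x \<partial>L)"
      using that by (intro nn_integral_eq_integral i AE_I2) auto
    finally show ?thesis using that by (simp add: measure_def integral_nonneg_AE indicator_def)
  qed
  have mp: "measure (density L (\<lambda>x. ennreal (p x))) A = (\<integral>x. p x * indicator A x \<partial>L)"
    by (rule meas) (use p in auto)
  have mq: "measure (density L (\<lambda>x. ennreal (q x))) A = (\<integral>x. q x * indicator A x \<partial>L)"
    by (rule meas) (use q in auto)
  have "\<bar>measure P A - measure Q A\<bar> = \<bar>\<integral>x. p x * indicator A x - q x * indicator A x \<partial>L\<bar>"
    unfolding P Q mp mq using i p q by simp
  also have "\<dots> \<le> (\<integral>x. \<bar>p x * indicator A x - q x * indicator A x\<bar> \<partial>L)" by (rule integral_abs_bound)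
  also have "\<dots> \<le> (\<integral>x. \<bar>p x - q x\<bar> \<partial>L)"
    using i p q by (intro integral_mono) (auto simp: indicator_def)
  finally show "\<bar>measure P A - measure Q A\<bar> \<le> (\<integral>x. \<bar>p x - q x\<bar> \<partial>L)" .
qed

context
  fixes D U :: "(real^'n::finite) set" and P :: "(real^'n \<Rightarrow> real) measure"
  assumes D: "compact D" "0 < measure lborel D" and DU: "D \<subseteq> U"
    and P: "P \<in> space (prob_algebra (path_space U))"
begin

lemma mixture_prob: "prob_space P" and sets_mixture: "sets P = sets (path_space U)"
  and space_mixture: "space P = space (path_space U)"
  using P by (auto simp: space_prob_algebra dest: sets_eq_imp_space_eq)

lemma path_coordinate: "x \<in> D \<Longrightarrow> (\<lambda>g. g x) \<in> borel_measurable P"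
  using path_space_coordinate[of x U] DU by (auto cong: measurable_cong_sets simp: sets_mixture)

lemma path_continuous_D: "g \<in> space P \<Longrightarrow> continuous_on D g"
  using path_space_continuous[of g U] DU by (auto simp: space_mixture intro: continuous_on_subset)

lemmas path_posterior_kernel = posterior_kernel[where G="\<lambda>g. g", OF D path_coordinate path_continuous_D]
lemmas path_density_measurable = borel_measurable_post_density[where G="\<lambda>g. g", OF D path_coordinate path_continuous_D]
lemmas path_density_integral = post_density_integral[where G="\<lambda>g. g", OF D path_coordinate path_continuous_D]

text \<open>\<open>measure_of\<close> yields the intended measure only if its set function is
  countably additive; the monadic composition provides this.\<close>

lemma mixture_eq_bind: "mixture_posterior D P = P \<bind> posterior D"
proof -
  interpret P: prob_space P by (rule mixture_prob)
  have sets: "sets (P \<bind> posterior D) = sets (restrict_space borel D)"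
    by (rule sets_bind) (use P.not_empty in \<open>auto simp: posterior_def sets_lebesgue_region\<close>)
  have space: "space (P \<bind> posterior D) = D" using sets_eq_imp_space_eq[OF sets] by (simp add: space_restrict_space)
  have "mixture_posterior D P = measure_of D (sets (restrict_space borel D)) (emeasure (P \<bind> posterior D))"
    unfolding mixture_posterior_def
  proof (rule measure_of_eq)
    show sub: "sets (restrict_space borel D) \<subseteq> Pow D"
      using sets.space_closed[of "restrict_space borel D"] by (simp add: space_restrict_space)
    fix A assume "A \<in> sigma_sets D (sets (restrict_space borel D))"
    then have "A \<in> sets (restrict_space borel D)"
      using sets.sigma_sets_eq[of "restrict_space borel D"] by (simp add: space_restrict_space)
    then show "(\<integral>\<^sup>+g. emeasure (posterior D g) A \<partial>P) = emeasure (P \<bind> posterior D) A"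
      by (intro emeasure_bind[symmetric, OF _ path_posterior_kernel] P.not_empty)
  qed
  also have "\<dots> = P \<bind> posterior D"
    using measure_of_of_measure[of "P \<bind> posterior D"] by (simp add: sets space)
  finally show ?thesis .
qed

lemma sets_mixture_posterior: "sets (mixture_posterior D P) = sets (lebesgue_region D)"
  unfolding mixture_eq_bind
  by (subst sets_bind) (use prob_space.not_empty[OF mixture_prob] in \<open>auto simp: posterior_def\<close>)

lemma space_mixture_posterior: "space (mixture_posterior D P) = D"
  using sets_eq_imp_space_eq[OF sets_mixture_posterior] by (simp add: space_restrict_space)

lemma nn_integral_mixture_posterior:
  assumes h: "h \<in> borel_measurable (lebesgue_region D)"
  shows "(\<integral>\<^sup>+x. h x \<partial>mixture_posterior D P)
    = (\<integral>\<^sup>+g. \<integral>\<^sup>+x. ennreal (post_density D g x) * h x \<partial>lebesgue_region D \<partial>P)"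
proof -
  have h': "h \<in> borel_measurable (restrict_space borel D)"
    using h by (simp cong: measurable_cong_sets add: sets_lebesgue_region)
  have "(\<integral>\<^sup>+x. h x \<partial>mixture_posterior D P) = (\<integral>\<^sup>+g. \<integral>\<^sup>+x. h x \<partial>posterior D g \<partial>P)"
    unfolding mixture_eq_bind by (rule nn_integral_bind[OF h' path_posterior_kernel])
  also have "\<dots> = (\<integral>\<^sup>+g. \<integral>\<^sup>+x. ennreal (post_density D g x) * h x \<partial>lebesgue_region D \<partial>P)"
  proof (rule nn_integral_cong)
    fix g assume g: "g \<in> space P"
    have "post_density D g \<in> borel_measurable (lebesgue_region D)"
      using path_density_integral(1)[OF _ _ g] by auto
    then show "(\<integral>\<^sup>+x. h x \<partial>posterior D g) = (\<integral>\<^sup>+x. ennreal (post_density D g x) * h x \<partial>lebesgue_region D)"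
      unfolding posterior_def using h
      by (subst nn_integral_density) (auto simp: post_density_def[abs_def])
  qed
  finally show ?thesis .
qed

lemma emeasure_mixture_posterior_space: "emeasure (mixture_posterior D P) D = 1"
proof -
  have "emeasure (mixture_posterior D P) D = (\<integral>\<^sup>+x. 1 \<partial>mixture_posterior D P)"
    by (simp add: space_mixture_posterior)
  also have "\<dots> = (\<integral>\<^sup>+g. \<integral>\<^sup>+x. ennreal (post_density D g x) \<partial>lebesgue_region D \<partial>P)"
    by (subst nn_integral_mixture_posterior) auto
  also have "\<dots> = (\<integral>\<^sup>+g. 1 \<partial>P)"
    by (intro nn_integral_cong path_density_integral(3)) auto
  also have "\<dots> = 1" using prob_space.emeasure_space_1[OF mixture_prob] by simp
  finally show ?thesis .
qed

lemma prob_space_mixture_posterior: "prob_space (mixture_posterior D P)"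
  using emeasure_mixture_posterior_space by (intro prob_spaceI) (simp add: space_mixture_posterior)

lemma mixture_density_measurable: "mixture_density D P \<in> borel_measurable (lebesgue_region D)"
proof -
  interpret P: prob_space P by (rule mixture_prob)
  have "(\<lambda>z. post_density D (snd z) (fst z)) \<in> borel_measurable (lebesgue_region D \<Otimes>\<^sub>M P)"
    using measurable_compose[OF measurable_pair_swap' path_density_measurable(1)] by (simp add: case_prod_beta)
  then show ?thesis unfolding mixture_density_def[abs_def]
    by (intro P.borel_measurable_nn_integral) (simp add: case_prod_beta)
qed

text \<open>Tonelli exchanges the average over paths with the integral over the region.\<close>

lemma mixture_posterior_density: "mixture_posterior D P = density (lebesgue_region D) (mixture_density D P)"
proof (rule measure_eqI)
  show "sets (mixture_posterior D P) = sets (density (lebesgue_region D) (mixture_density D P))"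
    by (simp add: sets_mixture_posterior)
  interpret P: prob_space P by (rule mixture_prob)
  interpret L: finite_measure "lebesgue_region D" by (rule finite_measure_lebesgue_region[OF D(1)])
  interpret LP: pair_sigma_finite P "lebesgue_region D" ..
  fix A assume "A \<in> sets (mixture_posterior D P)"
  then have A [measurable]: "A \<in> sets (lebesgue_region D)" by (simp add: sets_mixture_posterior)
  note [measurable] = path_density_measurable(1)
  have "emeasure (mixture_posterior D P) A = (\<integral>\<^sup>+x. indicator A x \<partial>mixture_posterior D P)"
    by (simp add: sets_mixture_posterior)
  also have "\<dots> = (\<integral>\<^sup>+g. \<integral>\<^sup>+x. ennreal (post_density D g x) * indicator A x \<partial>lebesgue_region D \<partial>P)"
    by (rule nn_integral_mixture_posterior) simp
  also have "\<dots> = (\<integral>\<^sup>+x. \<integral>\<^sup>+g. ennreal (post_density D g x) * indicator A x \<partial>P \<partial>lebesgue_region D)"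
    by (rule LP.Fubini'[symmetric]) (simp add: case_prod_beta)
  also have "\<dots> = (\<integral>\<^sup>+x. mixture_density D P x * indicator A x \<partial>lebesgue_region D)"
    unfolding mixture_density_def using path_density_measurable(2)
    by (intro nn_integral_cong nn_integral_multc) (auto simp: space_restrict_space)
  also have "\<dots> = emeasure (density (lebesgue_region D) (mixture_density D P)) A"
    using mixture_density_measurable by (simp add: emeasure_density)
  finally show "emeasure (mixture_posterior D P) A = emeasure (density (lebesgue_region D) (mixture_density D P)) A" .
qed

lemma total_variation_mixture_le:
  assumes f: "continuous_on D f"
  shows "ennreal (total_variation (mixture_posterior D P) (posterior D f))
    \<le> (\<integral>\<^sup>+x. ennreal \<bar>enn2real (mixture_density D P x) - post_density D f x\<bar> \<partial>lebesgue_region D)"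
proof -
  note [measurable] = mixture_density_measurable
  have I: "(\<integral>\<^sup>+x. mixture_density D P x \<partial>lebesgue_region D) = 1"
    using emeasure_mixture_posterior_space unfolding mixture_posterior_density
    by (subst (asm) emeasure_density) (auto simp: space_restrict_space sets_restrict_space indicator_def
         cong: nn_integral_cong_simp intro!: image_eqI[of _ _ UNIV])
  \<comment> \<open>Total mass 1 forces the density to be finite almost everywhere, so
    \<open>enn2real\<close> alters it on a null set only.\<close>
  then have fin: "AE x in lebesgue_region D. mixture_density D P x \<noteq> \<infinity>"
    by (intro nn_integral_PInf_AE) auto
  have ae: "AE x in lebesgue_region D. mixture_density D P x = ennreal (enn2real (mixture_density D P x))"
    using fin by eventually_elim (simp add: less_top)
  have "(\<integral>\<^sup>+x. ennreal (enn2real (mixture_density D P x)) \<partial>lebesgue_region D) = 1"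
    using I nn_integral_cong_AE[OF ae] by simp
  then have i: "integrable (lebesgue_region D) (\<lambda>x. enn2real (mixture_density D P x))"
    by (intro integrableI_nonneg) auto
  have q: "integrable (lebesgue_region D) (post_density D f)" "\<And>x. 0 \<le> post_density D f x"
    using post_density_integral(1)[where N="count_space UNIV" and G="\<lambda>_::unit. f" and D=D]
      post_density_pos[where N="count_space UNIV" and G="\<lambda>_::unit. f" and D=D] D f
    by (auto intro: less_imp_le)
  have "total_variation (mixture_posterior D P) (posterior D f)
      \<le> (\<integral>x. \<bar>enn2real (mixture_density D P x) - post_density D f x\<bar> \<partial>lebesgue_region D)"
  proof (rule total_variation_density_le[OF i _ q])
    show "mixture_posterior D P = density (lebesgue_region D) (\<lambda>x. ennreal (enn2real (mixture_density D P x)))"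
      unfolding mixture_posterior_density by (rule density_cong[OF _ _ ae]) auto
    show "posterior D f = density (lebesgue_region D) (\<lambda>x. ennreal (post_density D f x))"
      by (simp add: posterior_def post_density_def[abs_def])
  qed auto
  then have "ennreal (total_variation (mixture_posterior D P) (posterior D f))
      \<le> ennreal (\<integral>x. \<bar>enn2real (mixture_density D P x) - post_density D f x\<bar> \<partial>lebesgue_region D)"
    by (rule ennreal_leI)
  also have "\<dots> = (\<integral>\<^sup>+x. ennreal \<bar>enn2real (mixture_density D P x) - post_density D f x\<bar> \<partial>lebesgue_region D)"
    by (intro nn_integral_eq_integral[symmetric] integrable_abs Bochner_Integration.integrable_diff i q) auto
  finally show ?thesis .
qed

end

text \<open>Disintegration tested against events of \<open>H\<close> characterises the conditional
  expectation. The integral under \<open>k w\<close> may be infinite for w in a null set, which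
  \<open>enn2real\<close> repairs.\<close>

lemma (in prob_space) cond_exp_kernel:
  assumes H: "subalgebra M H" and k: "k \<in> H \<rightarrow>\<^sub>M prob_algebra N" and F: "F \<in> M \<rightarrow>\<^sub>M N"
    and eq: "\<And>A. A \<in> sets N \<Longrightarrow>
      AE w in M. real_cond_exp M H (indicat_real {w \<in> space M. F w \<in> A}) w = measure (k w) A"
    and h: "h \<in> borel_measurable N" "\<And>g. g \<in> space N \<Longrightarrow> 0 \<le> h g" and int: "integrable M (\<lambda>w. h (F w))"
  shows "AE w in M. real_cond_exp M H (\<lambda>w. h (F w)) w = enn2real (\<integral>\<^sup>+g. ennreal (h g) \<partial>k w)"
proof -
  interpret H: sigma_finite_subalgebra M H
    by (rule sigma_finite_subalgebraI) (rule H)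
  let ?r = "\<lambda>w. \<integral>\<^sup>+g. ennreal (h g) \<partial>k w"
  have ks: "k \<in> H \<rightarrow>\<^sub>M subprob_algebra N" using k by (rule measurable_prob_algebraD)
  have rH: "?r \<in> borel_measurable H"
    using h(1) by (intro measurable_compose[OF ks nn_integral_measurable_subprob_algebra]) simp
  have rM [measurable]: "?r \<in> borel_measurable M" by (rule measurable_from_subalg[OF H rH])
  have dis: "(\<integral>\<^sup>+w. indicator B w * ennreal (h (F w)) \<partial>M) = (\<integral>\<^sup>+w. indicator B w * ?r w \<partial>M)"
    if B: "B \<in> sets H" for B
  proof -
    have "(\<lambda>z. indicator B (fst z) * ennreal (h (snd z))) \<in> borel_measurable (H \<Otimes>\<^sub>M N)"
      using B h(1) by measurable
    from disintegration[OF H k F eq this]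
    have "(\<integral>\<^sup>+w. indicator B w * ennreal (h (F w)) \<partial>M) = (\<integral>\<^sup>+w. \<integral>\<^sup>+g. indicator B w * ennreal (h g) \<partial>k w \<partial>M)"
      by simp
    also have "\<dots> = (\<integral>\<^sup>+w. indicator B w * ?r w \<partial>M)"
    proof (rule nn_integral_cong, rule nn_integral_cmult)
      fix w assume "w \<in> space M"
      then have "w \<in> space H" using H by (simp add: subalgebra_def)
      from subprob_measurableD(2)[OF ks this]
      show "(\<lambda>g. ennreal (h g)) \<in> borel_measurable (k w)" using h(1) by (simp cong: measurable_cong_sets)
    qed
    finally show ?thesis .
  qed
  have hF: "0 \<le> h (F w)" if "w \<in> space M" for w using h(2) measurable_space[OF F that] by auto
  have "(\<integral>\<^sup>+w. ?r w \<partial>M) = (\<integral>\<^sup>+w. ennreal (h (F w)) \<partial>M)"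
  proof -
    have "space M \<in> sets H" using H sets.top[of H] by (simp add: subalgebra_def)
    from dis[OF this] show ?thesis by (simp cong: nn_integral_cong)
  qed
  also have "\<dots> < \<infinity>" using int hF by (subst nn_integral_eq_integral) auto
  finally have fin: "(\<integral>\<^sup>+w. ?r w \<partial>M) < \<infinity>" .
  then have "AE w in M. ?r w \<noteq> \<infinity>" by (intro nn_integral_PInf_AE) auto
  then have ae: "AE w in M. ?r w = ennreal (enn2real (?r w))" by eventually_elim (simp add: less_top)
  have i: "integrable M (\<lambda>w. enn2real (?r w))"
    using fin nn_integral_cong_AE[OF ae] by (intro integrableI_nonneg) auto
  show ?thesis
  proof (rule H.real_cond_exp_charact[OF _ int i])
    show "(\<lambda>w. enn2real (?r w)) \<in> borel_measurable H" using rH by measurable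
    fix B assume B: "B \<in> sets H"
    then have [measurable]: "B \<in> sets M" using H by (auto simp: subalgebra_def)
    have e1: "(\<integral>\<^sup>+w. ennreal (indicator B w * h (F w)) \<partial>M) = ennreal (\<integral>w. indicator B w * h (F w) \<partial>M)"
      using integrable_mult_indicator[OF _ int, of B] hF by (intro nn_integral_eq_integral) (auto intro!: AE_I2)
    have e2: "(\<integral>\<^sup>+w. ennreal (indicator B w * enn2real (?r w)) \<partial>M) = ennreal (\<integral>w. indicator B w * enn2real (?r w) \<partial>M)"
      using integrable_mult_indicator[OF _ i, of B] by (intro nn_integral_eq_integral) auto
    have "(\<integral>\<^sup>+w. ennreal (indicator B w * h (F w)) \<partial>M) = (\<integral>\<^sup>+w. indicator B w * ennreal (h (F w)) \<partial>M)"
      by (intro nn_integral_cong) (auto simp: indicator_def)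
    also have "\<dots> = (\<integral>\<^sup>+w. indicator B w * ?r w \<partial>M)" by (rule dis[OF B])
    also have "\<dots> = (\<integral>\<^sup>+w. ennreal (indicator B w * enn2real (?r w)) \<partial>M)"
      using ae by (intro nn_integral_cong_AE) (auto elim!: eventually_mono simp: indicator_def)
    finally have "ennreal (\<integral>w. indicator B w * h (F w) \<partial>M) = ennreal (\<integral>w. indicator B w * enn2real (?r w) \<partial>M)"
      unfolding e1 e2 .
    moreover have "0 \<le> (\<integral>w. indicator B w * h (F w) \<partial>M)"
      using hF by (intro integral_nonneg_AE AE_I2) auto
    ultimately show "(\<integral>w\<in>B. h (F w) \<partial>M) = (\<integral>w\<in>B. enn2real (?r w) \<partial>M)"
      by (simp add: set_lebesgue_integral_def integral_nonneg_AE)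
  qed
qed

section \<open>Positive semidefiniteness of the posterior covariance\<close>

lemma nonneg_quadratic_discriminant:
  fixes a b c :: real
  assumes q: "\<And>s. 0 \<le> a + 2 * s * b + s\<^sup>2 * c"
  shows "0 \<le> a" "b\<^sup>2 \<le> a * c"
proof -
  show a: "0 \<le> a" using q[of 0] by simp
  show "b\<^sup>2 \<le> a * c"
  proof (cases "c = 0")
    case True
    have "b = 0"
    proof (rule ccontr)
      assume "b \<noteq> 0"
      \<comment> \<open>At this s the expression equals - 1.\<close>
      then show False using q[of "- (a + 1) / (2 * b)"] True by (simp add: field_simps)
    qed
    then show ?thesis using True by simp
  next
    case False
    have "0 < c"
    proof (rule ccontr)
      assume "\<not> 0 < c"
      with False have c: "c < 0" by simp
      \<comment> \<open>Large enough for the negative leading term to outweigh the other two: s |c|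
        exceeds 2 |b| + a, and s is at least 1.\<close>
      define s where "s = 1 + \<bar>b\<bar> * 2 / \<bar>c\<bar> + a / \<bar>c\<bar>"
      have s1: "1 \<le> s" using a by (simp add: s_def)
      have "s * \<bar>c\<bar> = \<bar>c\<bar> + \<bar>b\<bar> * 2 + a" using c by (simp add: s_def field_simps)
      then have "2 * \<bar>b\<bar> + a < s * \<bar>c\<bar>" using c by linarith
      moreover have "2 * s * b \<le> s * (2 * \<bar>b\<bar>)" using s1 by (simp add: mult_left_mono)
      moreover have "a \<le> s * a" using s1 a mult_right_mono[of 1 s a] by simp
      moreover have "s\<^sup>2 * c = - (s * (s * \<bar>c\<bar>))" using c by (simp add: power2_eq_square)
      moreover have "s * (2 * \<bar>b\<bar> + a) < s * (s * \<bar>c\<bar>)" using s1 \<open>2 * \<bar>b\<bar> + a < s * \<bar>c\<bar>\<close> by simp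
      ultimately show False using q[of s] by (simp add: algebra_simps)
    qed
    have "a + 2 * (- b / c) * b + (- b / c)\<^sup>2 * c = a - b\<^sup>2 / c"
      using False by (simp add: power2_eq_square field_simps)
    then have "b\<^sup>2 / c \<le> a" using q[of "- b / c"] by simp
    then show ?thesis using \<open>0 < c\<close> by (simp add: pos_divide_le_eq)
  qed
qed

text \<open>Cauchy-Schwarz between a combination over \<open>J\<close> and the point z, read off
  from the nonnegative quadratic polynomial in the weight s given to z.\<close>

lemma covariance_kernel_extend:
  assumes K: "covariance_kernel A K" and J: "finite J" "J \<subseteq> A" and z: "z \<in> A"
  shows "(\<Sum>p\<in>J. c p * K p z)\<^sup>2 \<le> (\<Sum>p\<in>J. \<Sum>q\<in>J. c p * c q * K p q) * K z z"
proof (rule nonneg_quadratic_discriminant(2))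
  fix s :: real
  \<comment> \<open>Splitting the weights treats z inside and outside \<open>J\<close> at
    once.\<close>
  define c1 where "c1 p = (if p \<in> J then c p else 0)" for p
  define c2 where "c2 p = (if p = z then s else 0)" for p
  have sym: "K z p = K p z" if "p \<in> J" for p using K J z that by (auto simp: covariance_kernel_def)
  let ?J = "insert z J"
  have f: "finite ?J" using J by simp
  have r1: "(\<Sum>p\<in>?J. c1 p * h p) = (\<Sum>p\<in>J. c p * h p)" for h :: "_ \<Rightarrow> real"
    by (rule sum.mono_neutral_cong_right) (use f in \<open>auto simp: c1_def\<close>)
  have r2: "(\<Sum>p\<in>?J. c2 p * h p) = s * h z" for h :: "_ \<Rightarrow> real"
    using f by (simp add: c2_def if_distrib[of "\<lambda>x. x * _"] cong: if_cong)
  have "0 \<le> (\<Sum>p\<in>?J. \<Sum>q\<in>?J. (c1 p + c2 p) * (c1 q + c2 q) * K p q)"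
    using K[unfolded covariance_kernel_def, THEN conjunct2, rule_format, of ?J "\<lambda>p. c1 p + c2 p"] J z by simp
  also have "\<dots> = (\<Sum>p\<in>?J. (c1 p + c2 p) * (\<Sum>q\<in>?J. (c1 q + c2 q) * K p q))"
    by (simp only: sum_distrib_left mult.assoc)
  also have "\<dots> = (\<Sum>p\<in>?J. (c1 p + c2 p) * ((\<Sum>q\<in>J. c q * K p q) + s * K p z))"
    by (simp only: distrib_right sum.distrib r1 r2)
  also have "\<dots> = (\<Sum>p\<in>J. c p * ((\<Sum>q\<in>J. c q * K p q) + s * K p z)) + s * ((\<Sum>q\<in>J. c q * K z q) + s * K z z)"
    by (simp only: distrib_right[of "c1 _" "c2 _"] sum.distrib r1 r2)
  also have "(\<Sum>p\<in>J. c p * ((\<Sum>q\<in>J. c q * K p q) + s * K p z))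
      = (\<Sum>p\<in>J. \<Sum>q\<in>J. c p * c q * K p q) + s * (\<Sum>p\<in>J. c p * K p z)"
  proof -
    have "c p * ((\<Sum>q\<in>J. c q * K p q) + s * K p z) = (\<Sum>q\<in>J. c p * c q * K p q) + s * (c p * K p z)" for p
      by (simp add: distrib_left sum_distrib_left mult_ac)
    then show ?thesis by (simp only: sum.distrib sum_distrib_left)
  qed
  also have "(\<Sum>q\<in>J. c q * K z q) = (\<Sum>p\<in>J. c p * K p z)"
    by (intro sum.cong) (simp_all add: sym)
  also have "Q + s * L + s * (L + s * k) = Q + 2 * s * L + s\<^sup>2 * k" for Q L k
    by (simp add: power2_eq_square algebra_simps)
  finally show "0 \<le> (\<Sum>p\<in>J. \<Sum>q\<in>J. c p * c q * K p q) + 2 * s * (\<Sum>p\<in>J. c p * K p z) + s\<^sup>2 * K z z" .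
qed

lemma covariance_kernel_psd:
  assumes K: "covariance_kernel A K" and xy: "x \<in> A" "y \<in> A"
  shows "K x y = K y x" "0 \<le> K x x" "(K x y)\<^sup>2 \<le> K x x * K y y" "0 \<le> K x x - 2 * K x y + K y y"
proof -
  show sym: "K x y = K y x" using K xy by (auto simp: covariance_kernel_def)
  have Q: "0 \<le> (\<Sum>i\<in>J. \<Sum>j\<in>J. c i * c j * K i j)" if "finite J" "J \<subseteq> A" for J c
    using K that unfolding covariance_kernel_def by blast
  show "0 \<le> K x x" using Q[of "{x}" "\<lambda>_. 1"] xy by simp
  show "(K x y)\<^sup>2 \<le> K x x * K y y"
    using covariance_kernel_extend[OF K, of "{x}" y "\<lambda>_. 1"] xy by simp
  show "0 \<le> K x x - 2 * K x y + K y y"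
  proof (cases "x = y")
    case False
    then show ?thesis using Q[of "{x, y}" "\<lambda>i. if i = x then 1 else -1"] xy sym by simp
  qed simp
qed

text \<open>Conditioning takes a Schur complement: the quadratic form \<open>Q\<close> loses the
  square of \<open>L\<close> divided by variance plus noise, and
  \<open>covariance_kernel_extend\<close> bounds this loss by \<open>Q\<close>.\<close>

lemma covariance_kernel_gp_cov:
  assumes K: "covariance_kernel A K" and x: "\<And>i. i < n \<Longrightarrow> x i \<in> A" and v: "0 \<le> v"
  shows "covariance_kernel A (gp_cov K v x n)"
  using x
proof (induct n)
  case 0 then show ?case using K by simp
next
  case (Suc n)
  let ?k = "gp_cov K v x n" and ?z = "x n"
  have k: "covariance_kernel A ?k" by (rule Suc(1)) (use Suc(2) in auto)
  have z: "?z \<in> A" using Suc(2) by simp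
  have sym: "?k p q = ?k q p" if "p \<in> A" "q \<in> A" for p q using covariance_kernel_psd(1)[OF k that] .
  have kz: "0 \<le> ?k ?z ?z" by (rule covariance_kernel_psd(2)[OF k z z])
  show ?case unfolding covariance_kernel_def
  proof (intro conjI ballI allI impI)
    fix p q assume "p \<in> A" "q \<in> A"
    then show "gp_cov K v x (Suc n) p q = gp_cov K v x (Suc n) q p"
      using sym[of p q] sym[of p ?z] sym[of q ?z] z by (simp add: mult.commute)
  next
    fix J c assume "finite J \<and> J \<subseteq> A"
    then have J: "finite J" "J \<subseteq> A" by auto
    define Q where "Q = (\<Sum>p\<in>J. \<Sum>q\<in>J. c p * c q * ?k p q)"
    define L where "L = (\<Sum>p\<in>J. c p * ?k p ?z)"
    have Q0: "0 \<le> Q" using k J unfolding covariance_kernel_def Q_def by blast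
    have LQ: "L\<^sup>2 \<le> Q * ?k ?z ?z" unfolding L_def Q_def by (rule covariance_kernel_extend[OF k J z])
    have "(\<Sum>p\<in>J. \<Sum>q\<in>J. c p * c q * gp_cov K v x (Suc n) p q)
        = Q - (\<Sum>p\<in>J. \<Sum>q\<in>J. (c p * ?k p ?z) * (c q * ?k q ?z)) / (?k ?z ?z + v)"
    proof -
      have "(\<Sum>p\<in>J. \<Sum>q\<in>J. c p * c q * gp_cov K v x (Suc n) p q)
          = (\<Sum>p\<in>J. \<Sum>q\<in>J. c p * c q * ?k p q - (c p * ?k p ?z) * (c q * ?k q ?z) / (?k ?z ?z + v))"
      proof (intro sum.cong refl)
        fix p q assume "p \<in> J" "q \<in> J"
        then have "?k ?z q = ?k q ?z" using sym[of ?z q] z J by auto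
        then show "c p * c q * gp_cov K v x (Suc n) p q
            = c p * c q * ?k p q - (c p * ?k p ?z) * (c q * ?k q ?z) / (?k ?z ?z + v)"
          by (simp add: right_diff_distrib mult.assoc mult.left_commute)
      qed
      then show ?thesis by (simp only: sum_subtractf Q_def sum_divide_distrib)
    qed
    also have "(\<Sum>p\<in>J. \<Sum>q\<in>J. (c p * ?k p ?z) * (c q * ?k q ?z)) = L\<^sup>2"
      unfolding L_def power2_eq_square sum_product ..
    finally have eq: "(\<Sum>p\<in>J. \<Sum>q\<in>J. c p * c q * gp_cov K v x (Suc n) p q) = Q - L\<^sup>2 / (?k ?z ?z + v)" .
    have "L\<^sup>2 / (?k ?z ?z + v) \<le> Q"
    \<comment> \<open>A redundant noiseless observation has denominator 0 and, by r / 0 = 0,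
      subtracts nothing.\<close>
    proof (cases "?k ?z ?z + v = 0")
      case False
      then have pos: "0 < ?k ?z ?z + v" using kz v by simp
      have "L\<^sup>2 \<le> Q * (?k ?z ?z + v)" using LQ Q0 v by (simp add: distrib_left add_increasing2)
      then show ?thesis using pos by (simp add: pos_divide_le_eq)
    qed (use Q0 in simp)
    then show "0 \<le> (\<Sum>p\<in>J. \<Sum>q\<in>J. c p * c q * gp_cov K v x (Suc n) p q)" unfolding eq by simp
  qed
qed

lemma borel_measurable_gp_mean:
  fixes K :: "'a::euclidean_space \<Rightarrow> 'a \<Rightarrow> real"
  assumes K: "continuous_on (U \<times> U) (\<lambda>(x, y). K x y)" and U: "U \<in> sets borel"
    and x: "\<And>i. i < n \<Longrightarrow> x i \<in> borel_measurable N" "\<And>i w. i < n \<Longrightarrow> w \<in> space N \<Longrightarrow> x i w \<in> U"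
    and y: "\<And>i. i < n \<Longrightarrow> y i \<in> borel_measurable N"
    and "p \<in> borel_measurable N" "\<And>w. w \<in> space N \<Longrightarrow> p w \<in> U"
  shows "(\<lambda>w. gp_mean K v (\<lambda>i. x i w) (\<lambda>i. y i w) n (p w)) \<in> borel_measurable N"
  using x y assms(6-)
proof (induct n arbitrary: p)
  case 0 then show ?case by simp
next
  case (Suc n)
  have IH: "(\<lambda>w. gp_mean K v (\<lambda>i. x i w) (\<lambda>i. y i w) n (p w)) \<in> borel_measurable N"
    if "p \<in> borel_measurable N" "\<And>w. w \<in> space N \<Longrightarrow> p w \<in> U" for p
    by (rule Suc(1)) (use Suc(2-4) that in auto)
  have C: "(\<lambda>w. gp_cov K v (\<lambda>i. x i w) n (p w) (q w)) \<in> borel_measurable N"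
    if "p \<in> borel_measurable N" "q \<in> borel_measurable N"
     "\<And>w. w \<in> space N \<Longrightarrow> p w \<in> U" "\<And>w. w \<in> space N \<Longrightarrow> q w \<in> U" for p q
    by (rule borel_measurable_gp_cov[OF K U]) (use Suc(2,3) that in auto)
  have xn: "x n \<in> borel_measurable N" "\<And>w. w \<in> space N \<Longrightarrow> x n w \<in> U" and yn: "y n \<in> borel_measurable N"
    using Suc(2-4) by auto
  show ?case unfolding gp_mean.simps
    by (intro borel_measurable_diff borel_measurable_divide borel_measurable_times borel_measurable_add
        borel_measurable_const IH C xn yn Suc(5-))
qed

section \<open>The sequential design\<close>

lemma sets_generated_by: "sets (generated_by M I X) = sigma_sets (space M) (\<Union>i\<in>I. {X i -` A \<inter> space M | A. A \<in> sets borel})"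
  unfolding generated_by_def by (rule sets_measure_of) auto

lemma space_generated_by [simp]: "space (generated_by M I X) = space M"
  unfolding generated_by_def by (rule space_measure_of) auto

lemma subalgebra_generated_by:
  assumes "\<And>i. i \<in> I \<Longrightarrow> X i \<in> borel_measurable M"
  shows "subalgebra M (generated_by M I X)"
  unfolding subalgebra_def sets_generated_by
  by (intro conjI sets.sigma_sets_subset) (use assms in \<open>auto intro: measurable_sets\<close>)

lemma generated_by_mono: "I \<subseteq> I' \<Longrightarrow> sets (generated_by M I X) \<subseteq> sets (generated_by M I' X)"
  unfolding sets_generated_by by (intro sigma_sets_mono') auto

lemma measurable_generated_by: "i \<in> I \<Longrightarrow> X i \<in> borel_measurable (generated_by M I X)"
  by (rule measurableI) (auto simp: sets_generated_by intro!: sigma_sets.Basic)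

lemma C2_on_zero: "C2_on (U :: (real^'m::finite) set) (\<lambda>x. 0)"
proof -
  have "partial j (\<lambda>x. 0) = (\<lambda>x. 0)" for j :: 'm by (simp add: partial_def fun_eq_iff)
  then show ?thesis by (simp add: C2_on_def C1_on_def)
qed

section \<open>The design as a smooth Gaussian field with histories and posterior laws\<close>

locale design_model =
  fixes S :: "('w, 'n::finite) design"
  assumes standing: "standing_setup S"
    and latent_C2: "AE w in prb S. C2_on (nbhd S) (latent S w)"
begin

abbreviation "M \<equiv> prb S"
abbreviation "D \<equiv> region S"
abbreviation "U \<equiv> nbhd S"
abbreviation "K \<equiv> cov_kernel S"

lemma
  shows region: "regular_region D" and obs_model: "gp_observation_model S" and exact: "exact_posterior S"
    and smooth: "smooth_prior S"
  using standing by (auto simp: standing_setup_def)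

lemma prob_M: "prob_space M"
  using obs_model by (simp add: gp_observation_model_def)

lemma open_U: "open U" and D_sub_U: "D \<subseteq> U" and covariance_K: "covariance_kernel U K"
  and bdd_K: "bdd_above ((\<lambda>x. K x x) ` D)"
  and latent_gp: "gaussian_process M U (\<lambda>x w. latent S w x) (\<lambda>_. 0) K"
  using smooth by (auto simp: smooth_prior_def)

lemma compact_D: "compact D" and noise_nonneg: "0 \<le> noise_var S"
  and input_measurable: "input S i \<in> borel_measurable M" and input_in_D: "w \<in> space M \<Longrightarrow> input S i w \<in> D"
  and obs_measurable: "obs S i \<in> borel_measurable M" and alg_sub: "subalgebra M (alg S t)"
  using obs_model region by (auto simp: gp_observation_model_def regular_region_def)

lemma input_in_U: "w \<in> space M \<Longrightarrow> input S i w \<in> U"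
  using input_in_D D_sub_U by blast

text \<open>
  Replacing the latent field by \<open>0\<close> on a null set makes every path smooth, so that limits of
  difference quotients exist everywhere and are measurable.
\<close>

definition exceptional :: "'w set" where
  "exceptional = (SOME N. N \<in> null_sets M \<and> (\<forall>w\<in>space M - N. C2_on U (latent S w)))"

lemma exceptional: "exceptional \<in> null_sets M" "w \<in> space M \<Longrightarrow> w \<notin> exceptional \<Longrightarrow> C2_on U (latent S w)"
proof -
  obtain N where "\<And>w. w \<in> space M - N \<Longrightarrow> C2_on U (latent S w)" "N \<in> null_sets M"
    using AE_E3[OF latent_C2] by blast
  then have "\<exists>N. N \<in> null_sets M \<and> (\<forall>w\<in>space M - N. C2_on U (latent S w))" by blast
  from someI_ex[OF this] show "exceptional \<in> null_sets M"
    "w \<in> space M \<Longrightarrow> w \<notin> exceptional \<Longrightarrow> C2_on U (latent S w)"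
    by (auto simp: exceptional_def)
qed

definition path :: "'w \<Rightarrow> real^'n \<Rightarrow> real" where
  "path w x = (if w \<in> exceptional then 0 else latent S w x)"

lemma path_eq_latent: "AE w in M. path w = latent S w"
  using AE_not_in[OF exceptional(1)] by eventually_elim (simp add: path_def fun_eq_iff)

lemma path_C2: "w \<in> space M \<Longrightarrow> C2_on U (path w)"
  using exceptional(2)[of w] C2_on_zero[of U] by (cases "w \<in> exceptional") (auto simp: path_def[abs_def])

lemma latent_measurable: "x \<in> U \<Longrightarrow> (\<lambda>w. latent S w x) \<in> borel_measurable M"
  using latent_gp by (auto simp: gaussian_process_def)

lemma path_measurable: "x \<in> U \<Longrightarrow> (\<lambda>w. path w x) \<in> borel_measurable M"
  unfolding path_def using latent_measurable exceptional(1) by (intro measurable_If_set) auto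

sublocale gaussian_field M "\<lambda>x w. path w x" U K
proof -
  interpret prob_space M by (rule prob_M)
  have "gaussian_process M U (\<lambda>x w. path w x) (\<lambda>_. 0) K"
    unfolding gaussian_process_def
  proof (intro conjI ballI allI impI)
    fix J c assume J: "finite J \<and> J \<subseteq> U"
    show "0 \<le> (\<Sum>i\<in>J. \<Sum>j\<in>J. c i * c j * K i j)" using latent_gp J unfolding gaussian_process_def by blast
    have "distr M borel (\<lambda>w. \<Sum>i\<in>J. c i * path w i) = distr M borel (\<lambda>w. \<Sum>i\<in>J. c i * latent S w i)"
    proof (rule distr_cong_AE)
      show "AE w in M. (\<Sum>i\<in>J. c i * path w i) = (\<Sum>i\<in>J. c i * latent S w i)"
        using path_eq_latent by eventually_elim simp
    qed (use J in \<open>auto intro!: borel_measurable_sum borel_measurable_times path_measurable latent_measurable\<close>)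
    then show "distr M borel (\<lambda>w. \<Sum>i\<in>J. c i * path w i) = normal_law (\<Sum>i\<in>J. c i * 0) (\<Sum>i\<in>J. \<Sum>j\<in>J. c i * c j * K i j)"
      using latent_gp J unfolding gaussian_process_def by simp
  next
    fix i j assume "i \<in> U" "j \<in> U"
    then show "K i j = K j i" using latent_gp by (auto simp: gaussian_process_def)
  qed (rule path_measurable)
  then show "gaussian_field M (\<lambda>x w. path w x) U K"
    by unfold_locales (auto simp: open_U path_C2)
qed

text \<open>Elements of \<open>path_space\<close> are functions restricted to \<open>U\<close>, so
  it is the restricted path that is measurable into this space.\<close>

definition pathr :: "'w \<Rightarrow> real^'n \<Rightarrow> real" where
  "pathr w = restrict (path w) U"

lemma pathr_measurable: "pathr \<in> M \<rightarrow>\<^sub>M path_space U"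
  unfolding pathr_def[abs_def]
  by (rule measurable_into_path_space) (auto intro: path_measurable path_continuous)

lemma pathr_apply: "x \<in> U \<Longrightarrow> pathr w x = path w x"
  by (simp add: pathr_def)

abbreviation "H \<equiv> history S"

lemma pair_obs_measurable: "(\<lambda>w. (input S i w, obs S i w)) \<in> borel_measurable M"
  by (intro borel_measurable_Pair input_measurable obs_measurable)

lemma subalgebra_H: "subalgebra M (H t)"
  unfolding history_def by (rule subalgebra_generated_by) (rule pair_obs_measurable)

lemma H_mono: "s \<le> t \<Longrightarrow> sets (H s) \<subseteq> sets (H t)"
  unfolding history_def by (rule generated_by_mono) auto

lemma space_H [simp]: "space (H t) = space M"
  by (simp add: history_def)

sublocale filtered_prob_space M H
  by unfold_locales (auto simp: subalgebra_H dest: H_mono)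

lemma input_H: "i < n_init S + t \<Longrightarrow> input S i \<in> borel_measurable (H t)"
  and obs_H: "i < n_init S + t \<Longrightarrow> obs S i \<in> borel_measurable (H t)"
proof -
  assume "i < n_init S + t"
  then have p: "(\<lambda>w. (input S i w, obs S i w)) \<in> borel_measurable (H t)"
    unfolding history_def by (intro measurable_generated_by[where X="\<lambda>i w. (input S i w, obs S i w)"]) auto
  have "fst \<in> borel_measurable (borel :: ((real^'n) \<times> real) measure)" "snd \<in> borel_measurable (borel :: ((real^'n) \<times> real) measure)"
    by (auto intro!: borel_measurable_continuous_onI continuous_intros)
  with p show "input S i \<in> borel_measurable (H t)" "obs S i \<in> borel_measurable (H t)"
    using measurable_compose[OF p, of fst borel] measurable_compose[OF p, of snd borel] by simp_all
qed

abbreviation "G \<equiv> pre_branch_history S"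

lemma sets_G: "sets (G t) = sigma_sets (space M) (sets (H t) \<union> (\<Union>s<t. sets (alg S s)))"
  unfolding pre_branch_history_def
  using sets.space_closed[of "H t"] sets.space_closed[of "alg S _"] alg_sub
  by (intro sets_measure_of) (auto simp: subalgebra_def)

lemma subalgebra_G: "subalgebra M (G t)"
  unfolding subalgebra_def sets_G
proof
  show "space (G t) = space M" by (simp add: pre_branch_history_def space_measure_of_conv)
  show "sigma_sets (space M) (sets (H t) \<union> (\<Union>s<t. sets (alg S s))) \<subseteq> sets M"
    using alg_sub subalgebra_H by (intro sets.sigma_sets_subset) (auto simp: subalgebra_def)
qed

lemma G_mono: "s \<le> t \<Longrightarrow> sets (G s) \<subseteq> sets (G t)"
  unfolding sets_G using H_mono[of s t] by (intro sigma_sets_mono') fastforce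

lemma H_sub_G: "sets (H t) \<subseteq> sets (G t)"
  unfolding sets_G by auto

text \<open>Places the branch taken at iteration t in the pre-branch history of iteration t + 1:
  this is the adaptedness that \<open>cond_prob_slln\<close> asks for.\<close>

lemma step_sub_G: "sets (step_sigma S t) \<subseteq> sets (G (Suc t))"
proof -
  have "sets (step_sigma S t) = sigma_sets (space M) (sets (H t) \<union> sets (alg S t))"
    unfolding step_sigma_def
    using sets.space_closed[of "H t"] sets.space_closed[of "alg S t"] alg_sub[of t]
    by (intro sets_measure_of) (auto simp: subalgebra_def)
  also have "\<dots> \<subseteq> sets (G (Suc t))"
    unfolding sets_G using H_mono[of t "Suc t"] by (intro sigma_sets_mono') auto
  finally show ?thesis .
qed

abbreviation "P \<equiv> post_law S"

lemma P_kernel: "P t \<in> H t \<rightarrow>\<^sub>M prob_algebra (path_space U)"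
  using exact by (simp add: exact_posterior_def)

lemma P_space: "w \<in> space M \<Longrightarrow> P t w \<in> space (prob_algebra (path_space U))"
  using measurable_space[OF P_kernel] by simp

text \<open>Two changes with respect to \<open>exact_posterior\<close>: the latent field becomes the
  everywhere smooth version, equal to it outside a null set, and events of the product space become
  their traces on continuous functions.\<close>

lemma P_conditional:
  assumes A': "A' \<in> sets (path_space U)"
  shows "AE w in M. real_cond_exp M (H t) (indicat_real {w \<in> space M. pathr w \<in> A'}) w = measure (P t w) A'"
proof -
  interpret Ht: sigma_finite_subalgebra M "H t" by (rule sigma_finite_subalgebraI[OF subalgebra_H])
  obtain A where A: "A \<in> sets (PiM U (\<lambda>_. borel))" and A'_eq: "A' = A \<inter> {g. continuous_on U g}"
    using A' by (auto simp: path_space_def sets_restrict_space)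
  have sp: "A \<inter> space (path_space U) = A'"
    using sets.sets_into_space[OF A] by (auto simp: A'_eq path_space_def space_restrict_space)
  have 1: "AE w in M. real_cond_exp M (H t) (indicat_real {w \<in> space M. restrict (latent S w) U \<in> A}) w
      = measure (P t w) A'"
    using exact[unfolded exact_posterior_def, THEN conjunct2, THEN conjunct1, rule_format, OF A, of t]
    unfolding sp .
  have lm: "(\<lambda>w. restrict (latent S w) U) \<in> M \<rightarrow>\<^sub>M PiM U (\<lambda>_. borel)"
    by (rule measurable_restrict) (rule latent_measurable)
  have "AE w in M. real_cond_exp M (H t) (indicat_real {w \<in> space M. pathr w \<in> A'}) w
      = real_cond_exp M (H t) (indicat_real {w \<in> space M. restrict (latent S w) U \<in> A}) w"
  proof (rule Ht.real_cond_exp_cong)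
    show "AE w in M. indicat_real {w \<in> space M. pathr w \<in> A'} w = indicat_real {w \<in> space M. restrict (latent S w) U \<in> A} w"
      using path_eq_latent AE_space
    proof eventually_elim
      case (elim w)
      have "continuous_on U (pathr w)" using path_space_continuous[OF measurable_space[OF pathr_measurable elim(2)]] .
      then show ?case using elim by (auto simp: indicator_def A'_eq pathr_def)
    qed
    show "indicat_real {w \<in> space M. pathr w \<in> A'} \<in> borel_measurable M"
      using measurable_sets[OF pathr_measurable A'] by (simp add: vimage_def Int_def conj_commute)
    show "indicat_real {w \<in> space M. restrict (latent S w) U \<in> A} \<in> borel_measurable M"
      using measurable_sets[OF lm A] by (simp add: vimage_def Int_def conj_commute)
  qed
  with 1 show ?thesis by eventually_elim simp
qed

lemmas P_disintegration = disintegration[OF subalgebra_H P_kernel pathr_measurable P_conditional]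
lemmas P_cond_exp = cond_exp_kernel[OF subalgebra_H P_kernel pathr_measurable P_conditional]

lemma P_gp: "AE w in M. \<forall>t. gaussian_process (P t w) U (\<lambda>x g. g x) (post_mean S t w) (post_cov S t w)"
  using exact by (simp add: exact_posterior_def AE_all_countable)

lemma post_covariance: "w \<in> space M \<Longrightarrow> covariance_kernel U (post_cov S t w)"
  unfolding post_cov_def by (rule covariance_kernel_gp_cov[OF covariance_K input_in_U noise_nonneg])

lemmas post_cov_psd = covariance_kernel_psd[OF post_covariance]

lemma post_var_nonneg: "w \<in> space M \<Longrightarrow> x \<in> U \<Longrightarrow> 0 \<le> post_var S t w x"
  unfolding post_var_def by (rule post_cov_psd(2))

lemma post_var_Suc:
  assumes w: "w \<in> space M" and x: "x \<in> U"
  shows "post_var S (Suc t) w x = post_var S t w x -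
    (post_cov S t w x (input S (n_init S + t) w))\<^sup>2 / (post_var S t w (input S (n_init S + t) w) + noise_var S)"
  using post_cov_psd(1)[OF w input_in_U[OF w] x, of t "n_init S + t"]
  by (simp add: post_var_def post_cov_def power2_eq_square)

lemma gp_var_decreasing:
  assumes w: "w \<in> space M" and x: "x \<in> U" and "m \<le> n"
  shows "gp_cov K (noise_var S) (\<lambda>i. input S i w) n x x \<le> gp_cov K (noise_var S) (\<lambda>i. input S i w) m x x"
  using \<open>m \<le> n\<close>
proof (induct n rule: dec_induct)
  case (step n)
  let ?k = "gp_cov K (noise_var S) (\<lambda>i. input S i w) n"
  have k: "covariance_kernel U ?k" by (rule covariance_kernel_gp_cov[OF covariance_K input_in_U[OF w] noise_nonneg])
  have "0 \<le> (?k x (input S n w))\<^sup>2 / (?k (input S n w) (input S n w) + noise_var S)"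
    using covariance_kernel_psd(2)[OF k input_in_U[OF w] input_in_U[OF w]] noise_nonneg by simp
  then show ?case using step covariance_kernel_psd(1)[OF k input_in_U[OF w] x] by (simp add: power2_eq_square)
qed simp

lemma post_var_antimono: "w \<in> space M \<Longrightarrow> x \<in> U \<Longrightarrow> s \<le> t \<Longrightarrow> post_var S t w x \<le> post_var S s w x"
  unfolding post_var_def post_cov_def by (rule gp_var_decreasing) auto

lemma post_var_le_prior: "w \<in> space M \<Longrightarrow> x \<in> U \<Longrightarrow> post_var S t w x \<le> K x x"
  unfolding post_var_def post_cov_def using gp_var_decreasing[of w x 0 "n_init S + t"] by simp

lemma U_borel: "U \<in> sets borel" using open_U by simp

lemma post_cov_measurable:
  assumes "p \<in> borel_measurable N" "q \<in> borel_measurable N"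
    "\<And>z. z \<in> space N \<Longrightarrow> p z \<in> U" "\<And>z. z \<in> space N \<Longrightarrow> q z \<in> U"
    and W: "W \<in> N \<rightarrow>\<^sub>M H t"
  shows "(\<lambda>z. post_cov S t (W z) (p z) (q z)) \<in> borel_measurable N"
  unfolding post_cov_def
proof (rule borel_measurable_gp_cov[OF kernel_continuous U_borel])
  fix i assume i: "i < n_init S + t"
  show "(\<lambda>z. input S i (W z)) \<in> borel_measurable N"
    by (rule measurable_compose[OF W input_H[OF i]])
  fix z assume "z \<in> space N"
  then show "input S i (W z) \<in> U" using measurable_space[OF W] input_in_U by simp
qed (use assms in auto)

lemma post_mean_measurable: "x \<in> U \<Longrightarrow> (\<lambda>w. post_mean S t w x) \<in> borel_measurable (H t)"
  unfolding post_mean_def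
  by (rule borel_measurable_gp_mean[OF kernel_continuous U_borel])
     (auto intro: input_H obs_H input_in_U)

lemma post_mean_twice_differentiable:
  "w \<in> space M \<Longrightarrow> twice_differentiable_on U (post_mean S t w)"
  unfolding post_mean_def
  by (rule twice_differentiable_on_gp_mean[OF open_U kernel_twice_differentiable]) (auto intro: input_in_U)

lemma post_var_measurable: "x \<in> U \<Longrightarrow> (\<lambda>w. post_var S t w x) \<in> borel_measurable (H t)"
  unfolding post_var_def by (rule post_cov_measurable) (auto simp: measurable_ident_sets)

end

section \<open>Bounded Hessians of the posterior means\<close>

text \<open>Lets an uncountable family of quotients be tested on a countable set of parameters, as
  measurability of the path events requires.\<close>

lemma dense_subset_gt:
  fixes h :: "'b::metric_space \<Rightarrow> real"
  assumes h: "continuous_on W h" and Q: "Q \<subseteq> W" "W \<subseteq> closure Q" and z: "z \<in> W" "m < h z"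
  shows "\<exists>q\<in>Q. m < h q"
proof -
  obtain x where x: "\<And>n. x n \<in> Q" "x \<longlonglongrightarrow> z"
    using Q(2) z(1) closure_sequential[of z Q] by auto
  have "(h \<circ> x) \<longlonglongrightarrow> h z"
    using h[unfolded continuous_on_sequentially, rule_format, of z x] x Q(1) z(1) by auto
  then have "\<forall>\<^sub>F n in sequentially. m < (h \<circ> x) n" using z(2) by (rule order_tendstoD)
  then obtain n where "m < h (x n)" by (auto simp: eventually_sequentially)
  then show ?thesis using x by blast
qed

text \<open>
  Under the posterior law a mixed difference quotient is Gaussian with the corresponding quotient
  of the posterior mean as median. If the latter exceeds \<open>m\<close>, the event that some quotient of the
  path exceeds \<open>m\<close> has posterior probability at least 1/2; this turns a tail bound for the
  path into a bound on all posterior Hessians, without any estimate of Gaussian suprema.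
\<close>

lemma mixed_quotient_gaussian:
  assumes gp: "gaussian_process P U (\<lambda>x g. g x) \<mu> \<kappa>"
    and pts: "x + h *\<^sub>R axis r 1 + k *\<^sub>R axis s 1 \<in> U" "x + h *\<^sub>R axis r 1 \<in> U" "x + k *\<^sub>R axis s 1 \<in> U" "x \<in> U"
  shows "mixed_quotient r s (x, h, k) \<in> borel_measurable P"
    and "\<exists>v\<ge>0. distr P borel (mixed_quotient r s (x, h, k)) = normal_law (mixed_quotient r s (x, h, k) \<mu>) v"
proof -
  \<comment> \<open>The four corners, with signs in \<open>b\<close>; corners may coincide, which
    \<open>gaussian_process_combination\<close> permits.\<close>
  define p where "p a = [x + h *\<^sub>R axis r 1 + k *\<^sub>R axis s 1, x + h *\<^sub>R axis r 1, x + k *\<^sub>R axis s 1, x] ! a" for a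
  define b where "b a = [1, -1, -1, 1 :: real] ! a / (h * k)" for a
  have four: "{..<4} = {0, 1, 2, 3::nat}" by auto
  have e: "(\<Sum>a\<in>{..<4}. b a * g (p a)) = mixed_quotient r s (x, h, k) g" for g
    unfolding four by (simp add: b_def p_def mixed_quotient_def numeral_2_eq_2 numeral_3_eq_3 add_divide_distrib diff_divide_distrib)
  have m: "(\<lambda>g. g y) \<in> borel_measurable P" if "y \<in> U" for y
    using gp that by (auto simp: gaussian_process_def)
  show "mixed_quotient r s (x, h, k) \<in> borel_measurable P"
    unfolding mixed_quotient_def[abs_def] prod.case
    by (intro borel_measurable_divide borel_measurable_add borel_measurable_diff borel_measurable_const m pts)
  have "p ` {..<4} \<subseteq> U" unfolding four using pts by (auto simp: p_def numeral_2_eq_2 numeral_3_eq_3)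
  from gaussian_process_combination[OF gp _ this, of b]
  show "\<exists>v\<ge>0. distr P borel (mixed_quotient r s (x, h, k)) = normal_law (mixed_quotient r s (x, h, k) \<mu>) v"
    unfolding e by simp
qed

context design_model
begin

text \<open>Split according to the first t at which the conditional probability reaches 1/2. This
  event is known at time t, so the path lies in \<open>A\<close> on at least half of it; the events
  are disjoint, and summation gives the factor 2.\<close>

lemma posterior_maximal_inequality:
  assumes A: "A \<in> sets (path_space U)"
  shows "emeasure M {w \<in> space M. \<exists>t. 1/2 \<le> measure (P t w) A} \<le> 2 * emeasure M {w \<in> space M. pathr w \<in> A}"
proof -
  let ?q = "\<lambda>t w. measure (P t w) A"
  have qm: "?q t \<in> borel_measurable (H t)" for t
    using measurable_compose[OF measurable_prob_algebraD[OF P_kernel] measurable_measure_subprob_algebra[OF A]] .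
  define F where "F t = {w \<in> space M. 1/2 \<le> ?q t w \<and> (\<forall>s\<in>{..<t}. ?q s w < 1/2)}" for t
  have FH: "F t \<in> sets (H t)" for t
  proof -
    have q: "?q s \<in> borel_measurable (H t)" if "s \<le> t" for s using measurable_F_mono[OF qm that] .
    have "{w \<in> space (H t). 1/2 \<le> ?q t w} \<in> sets (H t)"
      by (rule borel_measurable_le[OF borel_measurable_const q]) simp
    moreover have "{w \<in> space (H t). \<forall>s\<in>{..<t}. ?q s w < 1/2} \<in> sets (H t)"
    proof (rule sets.sets_Collect_finite_All)
      fix s assume "s \<in> {..<t}"
      then show "{w \<in> space (H t). ?q s w < 1/2} \<in> sets (H t)"
        by (intro borel_measurable_less borel_measurable_const q) simp
    qed simp
    ultimately have "{w \<in> space (H t). 1/2 \<le> ?q t w} \<inter> {w \<in> space (H t). \<forall>s\<in>{..<t}. ?q s w < 1/2} \<in> sets (H t)"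
      by (rule sets.Int)
    also have "{w \<in> space (H t). 1/2 \<le> ?q t w} \<inter> {w \<in> space (H t). \<forall>s\<in>{..<t}. ?q s w < 1/2} = F t"
      by (auto simp: F_def)
    finally show ?thesis .
  qed
  have FM: "F t \<in> sets M" for t using FH sets_F_subset by blast
  define B where "B = {w \<in> space M. pathr w \<in> A}"
  have B: "B \<in> sets M" using measurable_sets[OF pathr_measurable A] by (simp add: B_def vimage_def Int_def conj_commute)
  have U: "{w \<in> space M. \<exists>t. 1/2 \<le> ?q t w} = (\<Union>t. F t)"
  proof (intro set_eqI iffI)
    fix w assume w: "w \<in> {w \<in> space M. \<exists>t. 1/2 \<le> ?q t w}"
    define t where "t = (LEAST t. 1/2 \<le> ?q t w)"
    have "1/2 \<le> ?q t w" using w unfolding t_def by (auto intro: LeastI)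
    moreover have "?q s w < 1/2" if "s < t" for s using not_less_Least[OF that[unfolded t_def]] by simp
    ultimately show "w \<in> (\<Union>t. F t)" using w by (auto simp: F_def)
  qed (auto simp: F_def)
  have disj: "disjoint_family F"
    unfolding disjoint_family_on_def
  proof (intro ballI impI)
    fix s t :: nat assume "s \<noteq> t"
    then consider "s < t" | "t < s" by linarith
    then show "F s \<inter> F t = {}" by cases (force simp: F_def)+
  qed
  have le: "emeasure M (F t) \<le> 2 * emeasure M (F t \<inter> B)" for t
  proof -
    note FH[measurable] A[measurable]
    have "(\<lambda>z. indicator (F t) (fst z) * indicator A (snd z) :: ennreal) \<in> borel_measurable (H t \<Otimes>\<^sub>M path_space U)"
      by measurable
    from P_disintegration[OF _ this]
    have "(\<integral>\<^sup>+w. indicator (F t) w * indicator A (pathr w) \<partial>M) = (\<integral>\<^sup>+w. \<integral>\<^sup>+g. indicator (F t) w * indicator A g \<partial>P t w \<partial>M)"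
      by simp
    also have "(\<integral>\<^sup>+w. indicator (F t) w * indicator A (pathr w) \<partial>M) = (\<integral>\<^sup>+w. indicator (F t \<inter> B) w \<partial>M)"
      by (intro nn_integral_cong) (auto simp: indicator_def B_def)
    also have "\<dots> = emeasure M (F t \<inter> B)" using FM B by simp
    finally have e: "emeasure M (F t \<inter> B) = (\<integral>\<^sup>+w. \<integral>\<^sup>+g. indicator (F t) w * indicator A g \<partial>P t w \<partial>M)" .
    have "emeasure M (F t) = (\<integral>\<^sup>+w. indicator (F t) w \<partial>M)" using FM by simp
    also have "\<dots> \<le> (\<integral>\<^sup>+w. 2 * (\<integral>\<^sup>+g. indicator (F t) w * indicator A g \<partial>P t w) \<partial>M)"
    proof (rule nn_integral_mono)
      fix w assume w: "w \<in> space M"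
      have sA: "A \<in> sets (P t w)" using P_space[OF w] A by (simp add: space_prob_algebra)
      interpret Pw: prob_space "P t w" using P_space[OF w] by (simp add: space_prob_algebra)
      show "indicator (F t) w \<le> 2 * (\<integral>\<^sup>+g. indicator (F t) w * indicator A g \<partial>P t w)"
      proof (cases "w \<in> F t")
        case True
        then have "1 \<le> 2 * ?q t w" by (auto simp: F_def)
        then have "ennreal 1 \<le> ennreal (2 * ?q t w)" by (rule ennreal_leI)
        also have "\<dots> = 2 * emeasure (P t w) A" by (simp add: Pw.emeasure_eq_measure ennreal_mult')
        finally show ?thesis using True sA by simp
      qed simp
    qed
    also have "\<dots> = 2 * emeasure M (F t \<inter> B)"
      unfolding e
    proof (rule nn_integral_cmult)
      have "(\<lambda>w. \<integral>\<^sup>+g. indicator (F t) w * indicator A g \<partial>P t w) \<in> borel_measurable (H t)"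
        by (rule nn_integral_measurable_subprob_algebra2[OF _ measurable_prob_algebraD[OF P_kernel]])
           (use FH A in measurable)
      then show "(\<lambda>w. \<integral>\<^sup>+g. indicator (F t) w * indicator A g \<partial>P t w) \<in> borel_measurable M"
        by (rule measurable_from_subalg[OF subalgebra_H])
    qed
    finally show ?thesis .
  qed
  have "emeasure M (\<Union>t. F t) = (\<Sum>t. emeasure M (F t))"
    using FM disj by (intro suminf_emeasure[symmetric]) auto
  also have "\<dots> \<le> (\<Sum>t. 2 * emeasure M (F t \<inter> B))" by (intro suminf_le le) auto
  also have "\<dots> = 2 * (\<Sum>t. emeasure M (F t \<inter> B))" by simp
  also have "(\<Sum>t. emeasure M (F t \<inter> B)) = emeasure M (\<Union>t. F t \<inter> B)"
    using FM B disj by (intro suminf_emeasure) (auto simp: disjoint_family_on_def)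
  also have "2 * emeasure M (\<Union>t. F t \<inter> B) \<le> 2 * emeasure M B"
    using B by (intro mult_left_mono emeasure_mono) auto
  finally show ?thesis unfolding U B_def .
qed

text \<open>The random bound comes from continuity of measure: the path events shrink to the empty
  set as the level grows, and the maximal inequality transfers this to the posterior laws of all
  iterations at once.\<close>

lemma hessian_entry_bound:
  "\<exists>R :: 'w \<Rightarrow> nat. R \<in> M \<rightarrow>\<^sub>M count_space UNIV \<and>
    (AE w in M. \<forall>t. \<forall>x\<in>D. \<bar>partial r (partial s (post_mean S t w)) x\<bar> \<le> real (R w))"
proof -
  obtain \<epsilon> D' where \<epsilon>: "0 < \<epsilon>" and D': "compact D'" "D' \<subseteq> U"
    and near: "\<And>x h k r s. x \<in> D \<Longrightarrow> 0 \<le> h \<Longrightarrow> h < \<epsilon> \<Longrightarrow> 0 \<le> k \<Longrightarrow> k < \<epsilon> \<Longrightarrow> x + h *\<^sub>R axis r 1 + k *\<^sub>R axis s 1 \<in> D'"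
    using compact_neighbourhood[OF compact_D open_U D_sub_U] by blast
  define W where "W = D \<times> ({0<..<\<epsilon>} \<times> {0<..<\<epsilon>})"
  have pts: "x + h *\<^sub>R axis r 1 + k *\<^sub>R axis s 1 \<in> U" "x + h *\<^sub>R axis r 1 \<in> U" "x + k *\<^sub>R axis s 1 \<in> U" "x \<in> U"
    if "(x, h, k) \<in> W" for x h k
    using that near[of x h k r s] near[of x h 0 r s] near[of x 0 k r s] D' D_sub_U by (auto simp: W_def)
  \<comment> \<open>Countably many parameters, so that the path events \<open>A m\<close> below are
    measurable.\<close>
  obtain Q where Q: "countable Q" "Q \<subseteq> W" "W \<subseteq> closure Q" by (rule separable)
  have mqc: "continuous_on W (\<lambda>z. \<bar>mixed_quotient r s z g\<bar>)" if g: "continuous_on U g" for g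
  proof -
    have pz: "fst z + fst (snd z) *\<^sub>R axis r 1 + snd (snd z) *\<^sub>R axis s 1 \<in> U" "fst z + fst (snd z) *\<^sub>R axis r 1 \<in> U"
      "fst z + snd (snd z) *\<^sub>R axis s 1 \<in> U" "fst z \<in> U" "fst (snd z) * snd (snd z) \<noteq> 0" if "z \<in> W" for z
      using pts[of "fst z" "fst (snd z)" "snd (snd z)"] that by (auto simp: W_def)
    have "continuous_on W (\<lambda>z. \<bar>(g (fst z + fst (snd z) *\<^sub>R axis r 1 + snd (snd z) *\<^sub>R axis s 1) - g (fst z + fst (snd z) *\<^sub>R axis r 1)
        - g (fst z + snd (snd z) *\<^sub>R axis s 1) + g (fst z)) / (fst (snd z) * snd (snd z))\<bar>)"
      by (intro continuous_on_rabs continuous_on_divide continuous_on_add continuous_on_diff continuous_on_mult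
          continuous_on_compose2[OF g] continuous_intros)
         (use pz in auto)
    then show ?thesis by (simp add: mixed_quotient_def case_prod_beta)
  qed
  define A where "A m = {g \<in> space (path_space U). \<exists>q\<in>Q. real m < \<bar>mixed_quotient r s q g\<bar>}" for m :: nat
  have mqm: "mixed_quotient r s q \<in> borel_measurable (path_space U)" if "q \<in> W" for q
  proof -
    obtain x h k where q: "q = (x, h, k)" by (cases q)
    show ?thesis unfolding q mixed_quotient_def[abs_def] prod.case
      using that pts[of x h k] unfolding q
      by (intro borel_measurable_divide borel_measurable_add borel_measurable_diff borel_measurable_const
          path_space_coordinate) auto
  qed
  have As: "A m \<in> sets (path_space U)" for m
  proof -
    have "A m = (\<Union>q\<in>Q. {g \<in> space (path_space U). real m < \<bar>mixed_quotient r s q g\<bar>})" by (auto simp: A_def)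
    also have "\<dots> \<in> sets (path_space U)"
      using Q by (intro sets.countable_UN'' borel_measurable_less borel_measurable_const borel_measurable_abs mqm) auto
    finally show ?thesis .
  qed
  define E where "E m = {w \<in> space M. \<exists>t. 1/2 \<le> measure (P t w) (A m)}" for m
  define B where "B m = {w \<in> space M. pathr w \<in> A m}" for m
  have Bs: "B m \<in> sets M" for m
    using measurable_sets[OF pathr_measurable As] by (simp add: B_def vimage_def Int_def conj_commute)
  have qM: "(\<lambda>w. measure (P t w) (A m)) \<in> borel_measurable M" for t m
    using measurable_compose[OF measurable_prob_algebraD[OF P_kernel] measurable_measure_subprob_algebra[OF As]]
    by (rule measurable_from_subalg[OF subalgebra_H])
  have Es: "E m \<in> sets M" for m
    unfolding E_def by (intro sets.sets_Collect_countable_Ex borel_measurable_le borel_measurable_const qM)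
  have "decseq B"
  proof (rule decseq_SucI)
    fix m
    have "real m < y" if "real (Suc m) < y" for y using that by simp
    then show "B (Suc m) \<subseteq> B m" unfolding B_def A_def by blast
  qed
  then have "(\<lambda>m. prob (B m)) \<longlonglongrightarrow> prob (\<Inter>m. B m)"
    using Bs by (intro finite_Lim_measure_decseq) auto
  \<comment> \<open>Each smooth path has bounded quotients on the compact neighbourhood, so no path
    stays in all \<open>B m\<close>.\<close>
  moreover have "(\<Inter>m. B m) = {}"
  proof (rule ccontr)
    assume "(\<Inter>m. B m) \<noteq> {}"
    then obtain w where w: "\<And>m. w \<in> B m" by auto
    then have wM: "w \<in> space M" by (auto simp: B_def)
    obtain b where b: "\<And>x h k. 0 < h \<Longrightarrow> 0 < k \<Longrightarrow>
      (\<And>u v. 0 \<le> u \<Longrightarrow> u \<le> h \<Longrightarrow> 0 \<le> v \<Longrightarrow> v \<le> k \<Longrightarrow> x + u *\<^sub>R axis r 1 + v *\<^sub>R axis s 1 \<in> D') \<Longrightarrow>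
      \<bar>mixed_quotient r s (x, h, k) (path w)\<bar> \<le> b"
      using mixed_quotient_bounded[OF path_C2[OF wM] open_U D'] by metis
    obtain m :: nat where m: "b < real m" using reals_Archimedean2 by blast
    obtain q where q: "q \<in> Q" "real m < \<bar>mixed_quotient r s q (pathr w)\<bar>"
      using w[of m] by (auto simp: B_def A_def)
    obtain x h k where qx: "q = (x, h, k)" by (cases q)
    have qW: "(x, h, k) \<in> W" using q(1) Q(2) qx by auto
    have "mixed_quotient r s q (pathr w) = mixed_quotient r s q (path w)"
      using pts[OF qW] by (simp add: qx mixed_quotient_def pathr_apply)
    moreover have "\<bar>mixed_quotient r s q (path w)\<bar> \<le> b"
      unfolding qx by (rule b) (use qW in \<open>auto simp: W_def intro!: near\<close>)
    ultimately show False using q(2) m by simp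
  qed
  ultimately have Blim: "(\<lambda>m. prob (B m)) \<longlonglongrightarrow> 0" by simp
  have "prob (\<Inter>m. E m) \<le> 2 * prob (B m)" for m
  proof -
    have "emeasure M (\<Inter>m. E m) \<le> emeasure M (E m)" using Es by (intro emeasure_mono) auto
    also have "\<dots> \<le> 2 * emeasure M (B m)" unfolding E_def B_def by (rule posterior_maximal_inequality[OF As])
    finally have "ennreal (prob (\<Inter>m. E m)) \<le> ennreal (2 * prob (B m))"
      by (simp add: emeasure_eq_measure ennreal_mult')
    then show ?thesis by (subst (asm) ennreal_le_iff) auto
  qed
  moreover have "(\<lambda>m. 2 * prob (B m)) \<longlonglongrightarrow> 2 * 0" by (intro tendsto_intros Blim)
  ultimately have "prob (\<Inter>m. E m) \<le> 0" by (intro LIMSEQ_le_const[of "\<lambda>m. 2 * prob (B m)"]) auto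
  then have "prob (\<Inter>m. E m) = 0" using measure_nonneg[of M "\<Inter>m. E m"] by linarith
  then have notall: "AE w in M. w \<notin> (\<Inter>m. E m)"
    using Es by (intro prob_eq_0[THEN iffD1]) auto
  \<comment> \<open>The first level whose exceptional event is avoided. On the null set where none
    is avoided, \<open>LEAST\<close> has an unspecified value, but \<open>R\<close> stays
    measurable.\<close>
  define R where "R w = (LEAST m. w \<notin> E m)" for w
  have "R \<in> M \<rightarrow>\<^sub>M count_space UNIV"
    unfolding R_def using Es by (intro measurable_Least) (auto simp: pred_def)
  moreover have "AE w in M. \<forall>t. \<forall>x\<in>D. \<bar>partial r (partial s (post_mean S t w)) x\<bar> \<le> real (R w)"
    using notall P_gp AE_space
  proof eventually_elim
    case (elim w)
    have wM: "w \<in> space M" by fact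
    have "\<exists>m. w \<notin> E m" using elim(1) by auto
    then have Rw: "w \<notin> E (R w)" unfolding R_def by (rule LeastI_ex)
    \<comment> \<open>A Hessian entry above \<open>R w\<close> gives a quotient of the posterior
      mean above \<open>R w\<close>, then one with parameters in \<open>Q\<close>; the median
      property puts w into \<open>E (R w)\<close>, against the choice of \<open>R\<close>.\<close>
    show ?case
    proof (intro allI ballI, rule ccontr)
      fix t x assume x: "x \<in> D" and "\<not> \<bar>partial r (partial s (post_mean S t w)) x\<bar> \<le> real (R w)"
      then have gt: "real (R w) < \<bar>partial r (partial s (post_mean S t w)) x\<bar>" by simp
      let ?\<mu> = "post_mean S t w"
      have td: "twice_differentiable_on U ?\<mu>" by (rule post_mean_twice_differentiable[OF wM])
      obtain h k where hk: "0 < h" "h < \<epsilon>" "0 < k" "k < \<epsilon>" "real (R w) < \<bar>mixed_quotient r s (x, h, k) ?\<mu>\<bar>"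
        using mixed_quotient_gt[OF td gt open_U _ \<epsilon>] x D_sub_U by blast
      have \<mu>c: "continuous_on U ?\<mu>"
        using td by (intro differentiable_imp_continuous_on)
          (auto simp: twice_differentiable_on_def differentiable_on_def intro: differentiable_at_withinI)
      have zW: "(x, h, k) \<in> W" using x hk by (simp add: W_def)
      obtain q where q: "q \<in> Q" "real (R w) < \<bar>mixed_quotient r s q ?\<mu>\<bar>"
        using dense_subset_gt[OF mqc[OF \<mu>c] Q(2,3) zW hk(5)] by blast
      obtain y h k where qy: "q = (y, h, k)" by (cases q)
      have qW: "(y, h, k) \<in> W" using q(1) Q(2) qy by auto
      have gp: "gaussian_process (P t w) U (\<lambda>x g. g x) ?\<mu> (post_cov S t w)" using elim(2) by blast
      obtain v where v: "0 \<le> v"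
        "distr (P t w) borel (mixed_quotient r s (y, h, k)) = normal_law (mixed_quotient r s (y, h, k) ?\<mu>) v"
        using mixed_quotient_gaussian(2)[OF gp pts[OF qW]] by blast
      have "1/2 \<le> measure (P t w) {g \<in> space (P t w). real (R w) < \<bar>mixed_quotient r s (y, h, k) g\<bar>}"
        by (rule normal_law_tail_half[OF mixed_quotient_gaussian(1)[OF gp pts[OF qW]] v]) (use q(2) qy in simp)
      also have "\<dots> \<le> measure (P t w) (A (R w))"
      proof -
        interpret Pw: prob_space "P t w" using P_space[OF wM] by (simp add: space_prob_algebra)
        have "sets (P t w) = sets (path_space U)" using P_space[OF wM] by (simp add: space_prob_algebra)
        then show ?thesis using As q(1) qy
          by (intro Pw.finite_measure_mono) (auto simp: A_def dest: sets_eq_imp_space_eq)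
      qed
      finally show False using Rw wM by (auto simp: E_def)
    qed
  qed
  ultimately show ?thesis by blast
qed

text \<open>The bounds for the finitely many entries are chosen and summed, which gives one
  measurable bound for all of them.\<close>

lemma hessian_bound:
  "\<exists>R \<in> borel_measurable M. (\<forall>w. 0 \<le> R w) \<and>
    (AE w in M. \<forall>t. \<forall>x\<in>D. \<forall>r s. \<bar>partial r (partial s (post_mean S t w)) x\<bar> \<le> R w)"
proof -
  define R where "R r s = (SOME R :: 'w \<Rightarrow> nat. R \<in> M \<rightarrow>\<^sub>M count_space UNIV \<and>
    (AE w in M. \<forall>t. \<forall>x\<in>D. \<bar>partial r (partial s (post_mean S t w)) x\<bar> \<le> real (R w)))" for r s
  have Rm: "R r s \<in> M \<rightarrow>\<^sub>M count_space UNIV"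
    and R: "AE w in M. \<forall>t. \<forall>x\<in>D. \<bar>partial r (partial s (post_mean S t w)) x\<bar> \<le> real (R r s w)" for r s
    using someI_ex[OF hessian_entry_bound[of r s]] unfolding R_def by auto
  define R' where "R' w = (\<Sum>r\<in>UNIV. \<Sum>s\<in>UNIV. real (R r s w))" for w
  have "R' \<in> borel_measurable M" unfolding R'_def[abs_def]
    by (intro borel_measurable_sum measurable_compose[OF Rm]) auto
  moreover have "AE w in M. \<forall>t. \<forall>x\<in>D. \<forall>r s. \<bar>partial r (partial s (post_mean S t w)) x\<bar> \<le> R' w"
  proof -
    have "AE w in M. \<forall>r s. \<forall>t. \<forall>x\<in>D. \<bar>partial r (partial s (post_mean S t w)) x\<bar> \<le> real (R r s w)"
      using R unfolding AE_all_countable by blast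
    then show ?thesis
    proof eventually_elim
      case (elim w)
      have "real (R r s w) \<le> R' w" for r s
      proof -
        have "real (R r s w) \<le> (\<Sum>s\<in>UNIV. real (R r s w))" by (rule member_le_sum) auto
        also have "\<dots> \<le> R' w" unfolding R'_def
          by (rule member_le_sum[where f="\<lambda>r. \<Sum>s\<in>UNIV. real (R r s w)"]) (auto intro: sum_nonneg)
        finally show ?thesis .
      qed
      then show ?case using elim order_trans by blast
    qed
  qed
  ultimately show ?thesis by (intro bexI[of _ R']) (auto simp: R'_def intro!: sum_nonneg)
qed

text \<open>The quadratic form of a matrix is at most its operator norm times the squared length of
  the vector, so all proxy distances obey one bound \<open>b\<close>, finite at each w;
  \<open>tanh\<close> maps it strictly below 1.\<close>

lemma alloc_prob_bound:
  assumes k: "1 \<le> k" and a: "0 < a" and sel: "selects_incumbent S sel" and prox: "proxy_smoothness S sel \<M>"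
  shows "\<exists>\<rho> \<in> borel_measurable M. (\<forall>w. \<rho> w < 1) \<and> (AE w in M. \<forall>t. alloc_prob S sel \<M> k a t w \<le> \<rho> w)"
proof -
  obtain R where Rm: "R \<in> borel_measurable M" and R0: "\<And>w. 0 \<le> R w"
    and R: "AE w in M. \<forall>t. \<forall>x\<in>D. \<forall>r s. \<bar>partial r (partial s (post_mean S t w)) x\<bar> \<le> R w"
    using hessian_bound by blast
  obtain C where C: "\<And>H. transpose H = H \<Longrightarrow> onorm ((*v) (\<M> H)) \<le> C * (1 + onorm ((*v) H))"
    using prox by (auto simp: proxy_smoothness_def)
  define n where "n = real CARD('n)"
  \<comment> \<open>The constant \<open>C\<close> comes without a sign, so its modulus is used; n *
    n is the factor between operator norm and entries in
    \<open>onorm_le_matrix_component\<close>.\<close>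
  define b where "b w = sqrt (\<bar>C\<bar> * (1 + n * n * R w)) * diameter D" for w
  have bm: "b \<in> borel_measurable M" unfolding b_def[abs_def] using Rm by measurable
  have b0: "0 \<le> b w" for w unfolding b_def using R0[of w] compact_D
    by (intro mult_nonneg_nonneg diameter_ge_0 compact_imp_bounded) (auto simp: n_def)
  have bound: "local_spread S sel \<M> k t w \<le> b w"
    if w: "w \<in> space M" and Rw: "\<And>x r s. x \<in> D \<Longrightarrow> \<bar>partial r (partial s (post_mean S t w)) x\<bar> \<le> R w" for t w
  proof -
    let ?x = "sel (data S t w)"
    have "?x \<in> (\<lambda>i. input S i w) ` {..<n_init S + t}" using sel w by (simp add: selects_incumbent_def)
    then have xD: "?x \<in> D" using input_in_D[OF w] by auto
    let ?H = "hessian (post_mean S t w) ?x"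
    define Hs where "Hs = - ((1 / 2) *\<^sub>R (?H + transpose ?H))"
    have "transpose Hs = Hs" by (simp add: Hs_def transpose_def vec_eq_iff add.commute)
    note CH = C[OF this]
    have "onorm ((*v) Hs) \<le> real CARD('n) * real CARD('n) * R w"
    proof (rule onorm_le_matrix_component)
      fix i j
      have "\<bar>Hs $ i $ j\<bar> \<le> (\<bar>?H $ i $ j\<bar> + \<bar>?H $ j $ i\<bar>) / 2"
        by (simp add: Hs_def transpose_def abs_triangle_ineq)
      also have "\<dots> \<le> R w" using Rw[OF xD, of i j] Rw[OF xD, of j i] by (simp add: hessian_def)
      finally show "\<bar>Hs $ i $ j\<bar> \<le> R w" .
    qed
    then have onH: "onorm ((*v) Hs) \<le> n * n * R w" by (simp add: n_def)
    have on0: "0 \<le> onorm ((*v) Hs)" by (rule onorm_pos_le) (rule matrix_vector_mul_bounded_linear)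
    let ?C = "proxy_matrix S sel \<M> t w"
    have Ceq: "?C = \<M> Hs" by (simp add: proxy_matrix_def Hs_def Let_def)
    have "onorm ((*v) ?C) \<le> C * (1 + onorm ((*v) Hs))" unfolding Ceq by (rule CH)
    also have "\<dots> \<le> \<bar>C\<bar> * (1 + onorm ((*v) Hs))" using on0 by (intro mult_right_mono) auto
    also have "\<dots> \<le> \<bar>C\<bar> * (1 + n * n * R w)" using onH by (intro mult_left_mono) auto
    finally have onC: "onorm ((*v) ?C) \<le> \<bar>C\<bar> * (1 + n * n * R w)" .
    have dist: "proxy_distance S sel \<M> t w i \<le> b w" for i
    proof -
      define v where "v = input S i w - ?x"
      have nv: "norm v \<le> diameter D"
        using diameter_bounded_bound[OF compact_imp_bounded[OF compact_D] input_in_D[OF w, of i] xD]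
        by (simp add: v_def dist_norm)
      have "v \<bullet> (?C *v v) \<le> norm v * norm (?C *v v)" by (rule norm_cauchy_schwarz)
      also have "\<dots> \<le> norm v * (onorm ((*v) ?C) * norm v)"
        by (intro mult_left_mono onorm matrix_vector_mul_bounded_linear) auto
      also have "\<dots> \<le> norm v * (\<bar>C\<bar> * (1 + n * n * R w) * norm v)"
        by (intro mult_left_mono mult_right_mono onC) auto
      also have "\<dots> = \<bar>C\<bar> * (1 + n * n * R w) * (norm v)\<^sup>2" by (simp add: power2_eq_square)
      finally have "sqrt (v \<bullet> (?C *v v)) \<le> sqrt (\<bar>C\<bar> * (1 + n * n * R w)) * norm v"
        using real_sqrt_le_mono by (fastforce simp: real_sqrt_mult)
      also have "\<dots> \<le> b w" unfolding b_def using R0[of w] by (intro mult_left_mono nv) (auto simp: n_def)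
      finally show ?thesis by (simp add: proxy_distance_def v_def Let_def)
    qed
    define l where "l = take k (sort (filter (\<lambda>r. 0 < r) (map (proxy_distance S sel \<M> t w)
         (filter (\<lambda>i. input S i w \<noteq> ?x) [0..<n_init S + t]))))"
    have "\<forall>y\<in>set l. y \<le> b w"
    proof
      fix y assume "y \<in> set l"
      then have "y \<in> set (sort (filter (\<lambda>r. 0 < r) (map (proxy_distance S sel \<M> t w)
         (filter (\<lambda>i. input S i w \<noteq> ?x) [0..<n_init S + t]))))"
        unfolding l_def by (rule in_set_takeD)
      then show "y \<le> b w" using dist by auto
    qed
    then have "sum_list l \<le> real (length l) * b w" by (induct l) (auto simp: algebra_simps)
    \<comment> \<open>\<open>take k\<close> leaves at most k terms, and \<open>b\<close> is
      nonnegative; division by k then gives back \<open>b\<close>.\<close>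
    also have "\<dots> \<le> real k * b w" using b0 by (intro mult_right_mono) (auto simp: l_def)
    finally have "sum_list l / real k \<le> b w" using k by (simp add: pos_divide_le_eq mult.commute)
    then show ?thesis by (simp add: local_spread_def l_def)
  qed
  define \<rho> where "\<rho> w = tanh ((ln 3 / 2) * b w / a)" for w
  have "\<rho> \<in> borel_measurable M" unfolding \<rho>_def[abs_def]
    by (rule measurable_compose[of "\<lambda>w. (ln 3 / 2) * b w / a" M borel tanh])
       (use bm in \<open>auto intro!: borel_measurable_continuous_onI continuous_intros\<close>)
  moreover have "AE w in M. \<forall>t. alloc_prob S sel \<M> k a t w \<le> \<rho> w"
    using R AE_space
  proof eventually_elim
    case (elim w)
    show ?case
    proof
      fix t
      have "local_spread S sel \<M> k t w \<le> b w" by (rule bound) (use elim in auto)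
      then show "alloc_prob S sel \<M> k a t w \<le> \<rho> w"
        unfolding alloc_prob_def \<rho>_def tanh_real_le_iff using a by (intro divide_right_mono mult_left_mono) auto
    qed
  qed
  ultimately show ?thesis by (intro bexI[of _ \<rho>]) (auto simp: \<rho>_def tanh_real_lt_1)
qed

text \<open>The law of large numbers replaces the branch indicators by their conditional
  probabilities in Cesaro mean, and these are at most \<rho>.\<close>

lemma ur_count_liminf:
  assumes br: "bernoulli_branching S p" and p: "AE w in M. \<forall>t. p t w \<le> \<rho> w"
  shows "AE w in M. ereal (1 - \<rho> w) \<le> liminf (\<lambda>T. ereal (real (ur_count S T w) / real T))"
proof -
  define E where "E t = {w \<in> space M. branch S t w}" for t
  have EG: "E t \<in> sets (G (Suc t))" for t
    using br step_sub_G by (auto simp: E_def bernoulli_branching_def)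
  have ae: "AE w in M. \<forall>t. real_cond_exp M (G t) (indicat_real (E t)) w = p t w"
    using br unfolding bernoulli_branching_def E_def by (simp add: AE_all_countable)
  have "AE w in M. (\<lambda>T. (\<Sum>t<T. indicat_real (E t) w - real_cond_exp M (G t) (indicat_real (E t)) w) / real T) \<longlonglongrightarrow> 0"
    by (rule cond_prob_slln[where G=G and E=E, OF subalgebra_G G_mono EG])
  then show ?thesis using ae p AE_space
  proof eventually_elim
    case (elim w)
    let ?c = "\<lambda>T. (\<Sum>t<T. indicat_real (E t) w - p t w) / real T"
    have lim: "?c \<longlonglongrightarrow> 0" using elim(1,2) by simp
    have "(\<lambda>T. 1 - \<rho> w - ?c T) \<longlonglongrightarrow> 1 - \<rho> w - 0" by (intro tendsto_intros lim)
    then have "(\<lambda>T. ereal (1 - \<rho> w - ?c T)) \<longlonglongrightarrow> ereal (1 - \<rho> w)" by simp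
    then have "ereal (1 - \<rho> w) = liminf (\<lambda>T. ereal (1 - \<rho> w - ?c T))"
      by (rule lim_imp_Liminf[OF trivial_limit_sequentially, symmetric])
    also have "\<dots> \<le> liminf (\<lambda>T. ereal (real (ur_count S T w) / real T))"
    proof (rule Liminf_mono, rule eventually_sequentiallyI[of 1])
      fix T :: nat assume T: "1 \<le> T"
      have "real (ur_count S T w) = (\<Sum>t<T. 1 - indicat_real (E t) w)"
        unfolding ur_count_def using elim(4) by (auto simp: E_def indicator_def intro!: sum.cong)
      also have "\<dots> = real T - (\<Sum>t<T. p t w) - (\<Sum>t<T. indicat_real (E t) w - p t w)"
        by (simp add: sum_subtractf)
      also have "\<dots> \<ge> real T - real T * \<rho> w - (\<Sum>t<T. indicat_real (E t) w - p t w)"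
        using sum_bounded_above[of "{..<T}" "\<lambda>t. p t w" "\<rho> w"] elim(3) by simp
      finally have "(real T - real T * \<rho> w - (\<Sum>t<T. indicat_real (E t) w - p t w)) / real T \<le> real (ur_count S T w) / real T"
        by (intro divide_right_mono) auto
      also have "(real T - real T * \<rho> w - (\<Sum>t<T. indicat_real (E t) w - p t w)) / real T = 1 - \<rho> w - ?c T"
        using T by (simp add: diff_divide_distrib)
      finally show "ereal (1 - \<rho> w - ?c T) \<le> ereal (real (ur_count S T w) / real T)" by simp
    qed
    finally show ?case .
  qed
qed

end

section \<open>Vanishing posterior variance\<close>

text \<open>Each update subtracts a square, over a nonnegative denominator, from the squared
  canonical distance. The prior therefore supplies a modulus of continuity valid for all iterations
  and all designs.\<close>

lemma gp_cov_increment_le: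
  assumes K: "covariance_kernel A K" and x: "\<And>i. i < n \<Longrightarrow> x i \<in> A" and v: "0 \<le> v" and pq: "p \<in> A" "q \<in> A"
  shows "gp_cov K v x n p p - 2 * gp_cov K v x n p q + gp_cov K v x n q q \<le> K p p - 2 * K p q + K q q"
  using x
proof (induct n)
  case (Suc n)
  let ?k = "gp_cov K v x n" and ?z = "x n"
  have k: "covariance_kernel A ?k" by (rule covariance_kernel_gp_cov[OF K _ v]) (use Suc(2) in auto)
  have z: "?z \<in> A" using Suc(2) by simp
  have sym: "?k ?z p = ?k p ?z" "?k ?z q = ?k q ?z" using covariance_kernel_psd(1)[OF k z] pq by auto
  have "0 \<le> (?k p ?z - ?k q ?z)\<^sup>2 / (?k ?z ?z + v)" using covariance_kernel_psd(2)[OF k z z] v by simp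
  moreover have "gp_cov K v x (Suc n) p p - 2 * gp_cov K v x (Suc n) p q + gp_cov K v x (Suc n) q q
      = ?k p p - 2 * ?k p q + ?k q q - (?k p ?z - ?k q ?z)\<^sup>2 / (?k ?z ?z + v)"
    by (simp add: sym power2_eq_square diff_divide_distrib add_divide_distrib algebra_simps)
  ultimately show ?case using Suc(1)[OF Suc(2)] by simp
qed simp

text \<open>Cauchy-Schwarz for the increment between x and y against the value at y; it serves to
  compare a covariance with a variance.\<close>

lemma covariance_kernel_increment:
  assumes K: "covariance_kernel A K" and xy: "x \<in> A" "y \<in> A"
  shows "(K x y - K y y)\<^sup>2 \<le> (K x x - 2 * K x y + K y y) * K y y"
proof (cases "x = y")
  case False
  show ?thesis
    using covariance_kernel_extend[OF K, of "{x, y}" y "\<lambda>i. if i = x then 1 else -1"] xy False covariance_kernel_psd(1)[OF K xy]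
    by (simp add: algebra_simps)
qed simp

section \<open>Bounds on the posterior variance and its decrements\<close>

context design_model
begin

abbreviation "\<sigma>2 \<equiv> post_var S"
abbreviation "L \<equiv> lebesgue_region D"
abbreviation "mix t w \<equiv> mixture_posterior D (P t w)"

lemma ball_pos:
  assumes "\<theta> \<in> D" "0 < r"
  shows "0 < measure lborel (ball \<theta> r \<inter> D)"
proof -
  obtain c r0 where c: "0 < c" "0 < r0"
    and le: "\<And>x r. x \<in> D \<Longrightarrow> 0 < r \<Longrightarrow> r \<le> r0 \<Longrightarrow> c * r ^ CARD('n) \<le> measure lborel (ball x r \<inter> D)"
    using region unfolding regular_region_def by blast
  \<comment> \<open>(A1) speaks of radii up to a bound of its own.\<close>
  define r' where "r' = min r r0"
  have r': "0 < r'" "r' \<le> r0" "r' \<le> r" using assms c by (auto simp: r'_def)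
  have "0 < c * r' ^ CARD('n)" using c r' by simp
  also have "\<dots> \<le> measure lborel (ball \<theta> r' \<inter> D)" by (rule le[OF assms(1) r'(1,2)])
  also have "\<dots> \<le> measure lborel (ball \<theta> r \<inter> D)"
  proof (rule measure_mono_fmeasurable)
    show "ball \<theta> r \<inter> D \<in> fmeasurable lborel"
      using compact_D emeasure_bounded_finite[of "ball \<theta> r \<inter> D"]
      by (intro fmeasurableI) (auto simp: borel_compact bounded_Int)
  qed (use r' compact_D in \<open>auto simp: borel_compact\<close>)
  finally show ?thesis .
qed

lemma D_nonempty: "D \<noteq> {}"
  using region interior_subset[of D] by (auto simp: regular_region_def)

lemma measure_D_pos: "0 < measure lborel D"
proof -
  obtain \<theta> where \<theta>: "\<theta> \<in> D" using D_nonempty by blast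
  have "0 < measure lborel (ball \<theta> 1 \<inter> D)" by (rule ball_pos[OF \<theta>]) simp
  also have "\<dots> \<le> measure lborel D"
    using compact_D emeasure_bounded_finite[OF compact_imp_bounded[OF compact_D]]
    by (intro measure_mono_fmeasurable fmeasurableI) (auto simp: borel_compact)
  finally show ?thesis .
qed

lemmas Dc = compact_D measure_D_pos

lemma space_L: "space L = D" by (simp add: space_restrict_space)

lemma finite_L: "finite_measure L" by (rule finite_measure_lebesgue_region[OF compact_D])

lemma id_L: "(\<lambda>u. u) \<in> borel_measurable L"
  by (simp add: measurable_restrict_space1)

lemma post_cov_measurable_L:
  assumes "w \<in> space M" "y \<in> U"
  shows "(\<lambda>u. post_cov S t w u y) \<in> borel_measurable L" "(\<lambda>u. \<sigma>2 t w u) \<in> borel_measurable L"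
  unfolding post_var_def
  by (rule post_cov_measurable[where W="\<lambda>_. w" and t=t and N=L];
      use assms D_sub_U id_L in \<open>auto simp: space_L\<close>)+

lemma post_var_measurable_pair: "(\<lambda>z. \<sigma>2 t (fst z) (snd z)) \<in> borel_measurable (M \<Otimes>\<^sub>M L)"
proof -
  have "(\<lambda>w. w) \<in> M \<rightarrow>\<^sub>M H t" using measurable_from_subalg[OF subalgebra_H measurable_id, of t] by (simp add: id_def)
  then show ?thesis unfolding post_var_def
    by (intro post_cov_measurable measurable_compose[OF measurable_snd id_L] measurable_compose[OF measurable_fst])
       (use D_sub_U in \<open>auto simp: space_pair_measure space_L\<close>)
qed

definition Kmax :: real where "Kmax = (SUP x\<in>D. K x x)"

lemma K_le_Kmax: "x \<in> D \<Longrightarrow> K x x \<le> Kmax"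
  unfolding Kmax_def using bdd_K by (rule cSUP_upper2) auto

lemma post_var_bounds: "w \<in> space M \<Longrightarrow> x \<in> D \<Longrightarrow> 0 \<le> \<sigma>2 t w x \<and> \<sigma>2 t w x \<le> Kmax"
  using post_var_nonneg[of w x t] post_var_le_prior[of w x t] K_le_Kmax[of x] D_sub_U by auto

lemma Kmax_nonneg: "0 \<le> Kmax"
  using D_nonempty post_var_bounds not_empty by (meson all_not_in_conv order_trans)

text \<open>By \<open>post_var_Suc\<close> this is the integrand of the variance reduction at the
  query actually made.\<close>

definition decrement :: "nat \<Rightarrow> 'w \<Rightarrow> real^'n \<Rightarrow> real" where
  "decrement t w u = \<sigma>2 t w u - \<sigma>2 (Suc t) w u"

lemma decrement_bounds:
  "w \<in> space M \<Longrightarrow> x \<in> D \<Longrightarrow> 0 \<le> decrement t w x \<and> decrement t w x \<le> Kmax"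
  using post_var_bounds[of w x t] post_var_bounds[of w x "Suc t"] post_var_antimono[of w x t "Suc t"] D_sub_U
  by (auto simp: decrement_def)

text \<open>Telescoping: the mean total variance over the region is finite and nonincreasing in t,
  and these integrals are its successive differences.\<close>

lemma integrated_decrement_tendsto_0:
  "(\<lambda>t. \<integral>\<^sup>+w. \<integral>\<^sup>+u. ennreal (decrement t w u) \<partial>L \<partial>M) \<longlonglongrightarrow> 0"
proof -
  interpret L: finite_measure L by (rule finite_L)
  interpret prod: pair_sigma_finite M L ..
  note [measurable] = post_var_measurable_pair
  define V where "V t = (\<integral>\<^sup>+w. \<integral>\<^sup>+u. ennreal (\<sigma>2 t w u) \<partial>L \<partial>M)" for t
  define a where "a t = (\<integral>\<^sup>+w. \<integral>\<^sup>+u. ennreal (decrement t w u) \<partial>L \<partial>M)" for t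
  have inner: "(\<lambda>w. \<integral>\<^sup>+u. ennreal (\<sigma>2 t w u) \<partial>L) \<in> borel_measurable M" "(\<lambda>w. \<integral>\<^sup>+u. ennreal (decrement t w u) \<partial>L) \<in> borel_measurable M" for t
    unfolding decrement_def by (rule L.borel_measurable_nn_integral; simp add: case_prod_beta)+
  have "V t \<le> (\<integral>\<^sup>+w. \<integral>\<^sup>+u. ennreal Kmax \<partial>L \<partial>M)" for t
    unfolding V_def using post_var_bounds by (intro nn_integral_mono ennreal_leI) (auto simp: space_L)
  also have "(\<integral>\<^sup>+w. \<integral>\<^sup>+u. ennreal Kmax \<partial>L \<partial>M) < \<infinity>"
    using L.emeasure_finite[of "space L"] by (simp add: emeasure_space_1 ennreal_mult_eq_top_iff less_top[symmetric])
  finally have Vfin: "V t < \<infinity>" for t .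
  have VS: "V t = a t + V (Suc t)" for t
  proof -
    have "V t = (\<integral>\<^sup>+w. (\<integral>\<^sup>+u. ennreal (decrement t w u) \<partial>L) + (\<integral>\<^sup>+u. ennreal (\<sigma>2 (Suc t) w u) \<partial>L) \<partial>M)"
      unfolding V_def
    proof (rule nn_integral_cong)
      fix w assume w: "w \<in> space M"
      obtain y where y: "y \<in> U" using D_nonempty D_sub_U by blast
      have "(\<integral>\<^sup>+u. ennreal (\<sigma>2 t w u) \<partial>L) = (\<integral>\<^sup>+u. ennreal (decrement t w u) + ennreal (\<sigma>2 (Suc t) w u) \<partial>L)"
        using decrement_bounds[OF w] post_var_bounds[OF w]
        by (intro nn_integral_cong) (auto simp: space_L decrement_def simp flip: ennreal_plus)
      also have "\<dots> = (\<integral>\<^sup>+u. ennreal (decrement t w u) \<partial>L) + (\<integral>\<^sup>+u. ennreal (\<sigma>2 (Suc t) w u) \<partial>L)"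
      proof -
        have e: "(\<lambda>u. ennreal (h u)) \<in> borel_measurable L" if "h \<in> borel_measurable L" for h :: "_ \<Rightarrow> real"
          using that by measurable
        show ?thesis unfolding decrement_def
          by (intro nn_integral_add e borel_measurable_diff post_cov_measurable_L(2)[OF w y])
      qed
      finally show "(\<integral>\<^sup>+u. ennreal (\<sigma>2 t w u) \<partial>L) = (\<integral>\<^sup>+u. ennreal (decrement t w u) \<partial>L) + (\<integral>\<^sup>+u. ennreal (\<sigma>2 (Suc t) w u) \<partial>L)" .
    qed
    also have "\<dots> = a t + V (Suc t)"
      unfolding a_def V_def using inner by (intro nn_integral_add)
    finally show ?thesis .
  qed
  \<comment> \<open>Finiteness permits subtraction, hence the passage to real numbers.\<close>
  have afin: "a t < \<infinity>" for t using VS[of t] Vfin[of t] by (metis ennreal_add_eq_top infinity_ennreal_def less_top)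
  have real: "enn2real (V t) = enn2real (a t) + enn2real (V (Suc t))" for t
    unfolding VS[of t] using afin Vfin by (intro enn2real_plus) auto
  have diff: "enn2real (V t) - enn2real (V (Suc t)) = enn2real (a t)" for t using real[of t] by linarith
  have "decseq (\<lambda>t. enn2real (V t))"
  proof (rule decseq_SucI)
    fix t show "enn2real (V (Suc t)) \<le> enn2real (V t)" using real[of t] enn2real_nonneg[of "a t"] by linarith
  qed
  then obtain l where l: "(\<lambda>t. enn2real (V t)) \<longlonglongrightarrow> l"
    by (rule decseq_convergent[where B=0]) auto
  have "(\<lambda>t. enn2real (V t) - enn2real (V (Suc t))) \<longlonglongrightarrow> l - l"
    by (intro tendsto_diff l LIMSEQ_Suc)
  then have "(\<lambda>t. enn2real (a t)) \<longlonglongrightarrow> 0" unfolding diff by simp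
  then have "(\<lambda>t. ennreal (enn2real (a t))) \<longlonglongrightarrow> ennreal 0" by (rule tendsto_ennrealI)
  moreover have "ennreal (enn2real (a t)) = a t" for t using afin[of t] by simp
  ultimately show ?thesis by (simp add: a_def)
qed

lemma post_density_path_measurable:
  "(\<lambda>z. post_density D (pathr (fst z)) (snd z)) \<in> borel_measurable (M \<Otimes>\<^sub>M L)"
  and pathr_density_pos: "w \<in> space M \<Longrightarrow> 0 < post_density D (pathr w) x"
  and pathr_density_integral: "w \<in> space M \<Longrightarrow> (\<integral>\<^sup>+x. ennreal (post_density D (pathr w) x) \<partial>L) = 1"
proof -
  have m: "(\<lambda>w. pathr w x) \<in> borel_measurable M" if "x \<in> D" for x
    by (rule measurable_compose[OF pathr_measurable path_space_coordinate]) (use that D_sub_U in auto)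
  have c: "continuous_on D (pathr w)" if "w \<in> space M" for w
    using path_space_continuous[OF measurable_space[OF pathr_measurable that]] D_sub_U by (rule continuous_on_subset)
  show "(\<lambda>z. post_density D (pathr (fst z)) (snd z)) \<in> borel_measurable (M \<Otimes>\<^sub>M L)"
    by (rule borel_measurable_post_density(1)[OF Dc m c])
  show "w \<in> space M \<Longrightarrow> 0 < post_density D (pathr w) x"
    by (rule post_density_pos[OF Dc m c])
  show "w \<in> space M \<Longrightarrow> (\<integral>\<^sup>+x. ennreal (post_density D (pathr w) x) \<partial>L) = 1"
    by (rule post_density_integral(3)[OF Dc m c])
qed

text \<open>Truncation error at level m. In \<open>ennreal\<close> a negative difference counts as
  0, so for each path and point the excess vanishes for large m; the density itself, of total mass
  1, dominates.\<close>

lemma density_excess_tendsto_0: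
  "(\<lambda>m. \<integral>\<^sup>+w. \<integral>\<^sup>+u. ennreal (post_density D (pathr w) u - real m) \<partial>L \<partial>M) \<longlonglongrightarrow> 0"
proof -
  interpret L: finite_measure L by (rule finite_L)
  interpret prod: pair_sigma_finite M L ..
  note [measurable] = post_density_path_measurable
  let ?p = "\<lambda>z. post_density D (pathr (fst z)) (snd z)"
  have "(\<lambda>m. \<integral>\<^sup>+z. ennreal (?p z - real m) \<partial>(M \<Otimes>\<^sub>M L)) \<longlonglongrightarrow> (\<integral>\<^sup>+z. 0 \<partial>(M \<Otimes>\<^sub>M L))"
  proof (rule nn_integral_dominated_convergence[where w="\<lambda>z. ennreal (?p z)"])
    have "(\<integral>\<^sup>+z. ennreal (?p z) \<partial>(M \<Otimes>\<^sub>M L)) = (\<integral>\<^sup>+w. \<integral>\<^sup>+u. ennreal (post_density D (pathr w) u) \<partial>L \<partial>M)"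
      by (subst L.nn_integral_fst[symmetric]) auto
    also have "\<dots> = (\<integral>\<^sup>+w. 1 \<partial>M)" by (intro nn_integral_cong pathr_density_integral)
    finally show "(\<integral>\<^sup>+z. ennreal (?p z) \<partial>(M \<Otimes>\<^sub>M L)) < \<infinity>" by (simp add: emeasure_space_1)
    show "AE z in M \<Otimes>\<^sub>M L. (\<lambda>m. ennreal (?p z - real m)) \<longlonglongrightarrow> 0"
    proof (rule AE_I2)
      fix z
      obtain k :: nat where "?p z \<le> real k" using real_arch_simple by blast
      then have "ennreal (?p z - real m) = 0" if "k \<le> m" for m using that by (simp add: ennreal_neg)
      then have "\<forall>\<^sub>F m in sequentially. ennreal (?p z - real m) = 0" by (auto simp: eventually_sequentially)
      then show "(\<lambda>m. ennreal (?p z - real m)) \<longlonglongrightarrow> 0" by (rule tendsto_eventually)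
    qed
  qed (auto intro!: AE_I2 ennreal_leI)
  then show ?thesis by (subst (asm) L.nn_integral_fst[symmetric]) auto
qed

text \<open>The density is at most m plus its excess over m, and a decrement is at most
  \<open>Kmax\<close>. This splits the integral into m times a Lebesgue integral, which vanishes as
  t grows, and a truncation error made small beforehand by the choice of m.\<close>

lemma mixture_decrement_tendsto_0:
  "(\<lambda>t. \<integral>\<^sup>+w. \<integral>\<^sup>+u. ennreal (decrement t w u) \<partial>mix t w \<partial>M) \<longlonglongrightarrow> 0"
proof -
  interpret L: finite_measure L by (rule finite_L)
  let ?a = "\<lambda>t. \<integral>\<^sup>+w. \<integral>\<^sup>+u. ennreal (decrement t w u) \<partial>L \<partial>M"
  let ?e = "\<lambda>m. \<integral>\<^sup>+w. \<integral>\<^sup>+u. ennreal (post_density D (pathr w) u - real m) \<partial>L \<partial>M"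
  let ?b = "\<lambda>t. \<integral>\<^sup>+w. \<integral>\<^sup>+u. ennreal (decrement t w u) \<partial>mix t w \<partial>M"
  have dm: "(\<lambda>u. decrement t w u) \<in> borel_measurable L" if "w \<in> space M" for t w
  proof -
    obtain y where y: "y \<in> U" using D_nonempty D_sub_U by blast
    show ?thesis unfolding decrement_def using post_cov_measurable_L(2)[OF that y] by measurable
  qed
  have em: "(\<lambda>g. \<integral>\<^sup>+u. ennreal (post_density D g u - real m) \<partial>L) \<in> borel_measurable (path_space U)" for m
  proof -
    have c: "continuous_on D g" if "g \<in> space (path_space U)" for g
      using path_space_continuous[OF that] D_sub_U by (rule continuous_on_subset)
    have "(\<lambda>z. post_density D (fst z) (snd z)) \<in> borel_measurable (path_space U \<Otimes>\<^sub>M L)"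
      by (rule borel_measurable_post_density(1)[OF Dc _ c]) (use D_sub_U path_space_coordinate in auto)
    then show ?thesis by (intro L.borel_measurable_nn_integral) (simp add: case_prod_beta)
  qed
  have le: "?b t \<le> ennreal (real m) * ?a t + ennreal Kmax * ?e m" for t m
  proof -
    have "?b t \<le> (\<integral>\<^sup>+w. ennreal (real m) * (\<integral>\<^sup>+u. ennreal (decrement t w u) \<partial>L)
        + ennreal Kmax * (\<integral>\<^sup>+g. \<integral>\<^sup>+u. ennreal (post_density D g u - real m) \<partial>L \<partial>P t w) \<partial>M)"
    proof (rule nn_integral_mono)
      fix w assume w: "w \<in> space M"
      note Pw = P_space[OF w]
      interpret Pw: prob_space "P t w" using Pw by (simp add: space_prob_algebra)
      have [measurable]: "(\<lambda>u. decrement t w u) \<in> borel_measurable L" by (rule dm[OF w])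
      have emP: "(\<lambda>g. \<integral>\<^sup>+u. ennreal (post_density D g u - real m) \<partial>L) \<in> borel_measurable (P t w)"
        using em[of m] sets_mixture[OF Dc D_sub_U Pw] by (simp cong: measurable_cong_sets)
      have "(\<integral>\<^sup>+u. ennreal (decrement t w u) \<partial>mix t w)
          = (\<integral>\<^sup>+g. \<integral>\<^sup>+u. ennreal (post_density D g u) * ennreal (decrement t w u) \<partial>L \<partial>P t w)"
        by (rule nn_integral_mixture_posterior[OF Dc D_sub_U Pw]) measurable
      also have "\<dots> \<le> (\<integral>\<^sup>+g. ennreal (real m) * (\<integral>\<^sup>+u. ennreal (decrement t w u) \<partial>L)
          + ennreal Kmax * (\<integral>\<^sup>+u. ennreal (post_density D g u - real m) \<partial>L) \<partial>P t w)"
      proof (rule nn_integral_mono)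
        fix g assume g: "g \<in> space (P t w)"
        have [measurable]: "post_density D g \<in> borel_measurable L"
          using path_density_integral(1)[OF Dc D_sub_U Pw _ _ g] by auto
        have "(\<integral>\<^sup>+u. ennreal (post_density D g u) * ennreal (decrement t w u) \<partial>L)
            \<le> (\<integral>\<^sup>+u. ennreal (real m) * ennreal (decrement t w u) + ennreal Kmax * ennreal (post_density D g u - real m) \<partial>L)"
        proof (rule nn_integral_mono)
          fix u assume "u \<in> space L"
          then have d: "0 \<le> decrement t w u" "decrement t w u \<le> Kmax" using decrement_bounds[OF w] by (auto simp: space_L)
          have "ennreal (post_density D g u) \<le> ennreal (real m) + ennreal (post_density D g u - real m)"
            by (cases "real m \<le> post_density D g u") (auto simp: ennreal_neg simp flip: ennreal_plus intro: ennreal_leI)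
          then have "ennreal (post_density D g u) * ennreal (decrement t w u)
              \<le> (ennreal (real m) + ennreal (post_density D g u - real m)) * ennreal (decrement t w u)"
            by (rule mult_right_mono) simp
          also have "\<dots> = ennreal (real m) * ennreal (decrement t w u) + ennreal (decrement t w u) * ennreal (post_density D g u - real m)"
            by (simp add: algebra_simps)
          also have "\<dots> \<le> ennreal (real m) * ennreal (decrement t w u) + ennreal Kmax * ennreal (post_density D g u - real m)"
            using d(2) by (intro add_left_mono mult_right_mono ennreal_leI) auto
          finally show "ennreal (post_density D g u) * ennreal (decrement t w u)
              \<le> ennreal (real m) * ennreal (decrement t w u) + ennreal Kmax * ennreal (post_density D g u - real m)" .
        qed
        also have "\<dots> = ennreal (real m) * (\<integral>\<^sup>+u. ennreal (decrement t w u) \<partial>L)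
            + ennreal Kmax * (\<integral>\<^sup>+u. ennreal (post_density D g u - real m) \<partial>L)"
          by (simp add: nn_integral_add nn_integral_cmult)
        finally show "(\<integral>\<^sup>+u. ennreal (post_density D g u) * ennreal (decrement t w u) \<partial>L)
          \<le> ennreal (real m) * (\<integral>\<^sup>+u. ennreal (decrement t w u) \<partial>L) + ennreal Kmax * (\<integral>\<^sup>+u. ennreal (post_density D g u - real m) \<partial>L)" .
      qed
      also have "\<dots> = ennreal (real m) * (\<integral>\<^sup>+u. ennreal (decrement t w u) \<partial>L)
          + ennreal Kmax * (\<integral>\<^sup>+g. \<integral>\<^sup>+u. ennreal (post_density D g u - real m) \<partial>L \<partial>P t w)"
        using emP by (simp add: nn_integral_add nn_integral_cmult Pw.emeasure_space_1)
      finally show "(\<integral>\<^sup>+u. ennreal (decrement t w u) \<partial>mix t w) \<le> ennreal (real m) * (\<integral>\<^sup>+u. ennreal (decrement t w u) \<partial>L)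
          + ennreal Kmax * (\<integral>\<^sup>+g. \<integral>\<^sup>+u. ennreal (post_density D g u - real m) \<partial>L \<partial>P t w)" .
    qed
    also have "\<dots> = ennreal (real m) * ?a t + ennreal Kmax * (\<integral>\<^sup>+w. \<integral>\<^sup>+g. \<integral>\<^sup>+u. ennreal (post_density D g u - real m) \<partial>L \<partial>P t w \<partial>M)"
    proof -
      have "(\<lambda>w. \<integral>\<^sup>+u. ennreal (decrement t w u) \<partial>L) \<in> borel_measurable M"
        unfolding decrement_def using post_var_measurable_pair
        by (intro L.borel_measurable_nn_integral) (simp add: case_prod_beta)
      moreover have "(\<lambda>w. \<integral>\<^sup>+g. \<integral>\<^sup>+u. ennreal (post_density D g u - real m) \<partial>L \<partial>P t w) \<in> borel_measurable M"
        by (rule measurable_from_subalg[OF subalgebra_H],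
            rule measurable_compose[OF measurable_prob_algebraD[OF P_kernel] nn_integral_measurable_subprob_algebra[OF em]])
      ultimately show ?thesis by (simp add: nn_integral_add nn_integral_cmult)
    qed
    \<comment> \<open>Disintegration: the excess averaged over the posterior law and then over
      \<open>M\<close> is that of the path itself, free of t.\<close>
    also have "(\<integral>\<^sup>+w. \<integral>\<^sup>+g. \<integral>\<^sup>+u. ennreal (post_density D g u - real m) \<partial>L \<partial>P t w \<partial>M) = ?e m"
    proof -
      have "(\<lambda>z. \<integral>\<^sup>+u. ennreal (post_density D (snd z) u - real m) \<partial>L) \<in> borel_measurable (H t \<Otimes>\<^sub>M path_space U)"
        by (rule measurable_compose[OF measurable_snd em])
      from P_disintegration[OF _ this] show ?thesis by simp
    qed
    finally show ?thesis .
  qed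
  show ?thesis
  proof (rule order_tendstoI)
    fix c :: ennreal assume "0 < c"
    obtain c' where c': "0 < c'" "c' < c" using dense[OF \<open>0 < c\<close>] by blast
    obtain r where r: "c' = ennreal r" "0 < r"
    proof (cases c')
      case (real r)
      with c'(1) show ?thesis by (intro that[of r]) auto
    next
      case top
      with c'(2) show ?thesis by simp
    qed
    have c2: "0 < ennreal (r / 2)" using r by simp
    have "(\<lambda>m. ennreal Kmax * ?e m) \<longlonglongrightarrow> ennreal Kmax * 0"
      by (intro ennreal_tendsto_cmult density_excess_tendsto_0) auto
    then have "\<forall>\<^sub>F m in sequentially. ennreal Kmax * ?e m < ennreal (r / 2)" using c2 by (intro order_tendstoD(2)) auto
    then obtain m where m: "ennreal Kmax * ?e m < ennreal (r / 2)" by (auto simp: eventually_sequentially)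
    have "(\<lambda>t. ennreal (real m) * ?a t) \<longlonglongrightarrow> ennreal (real m) * 0"
      by (intro ennreal_tendsto_cmult integrated_decrement_tendsto_0) auto
    then have "\<forall>\<^sub>F t in sequentially. ennreal (real m) * ?a t < ennreal (r / 2)" using c2 by (intro order_tendstoD(2)) auto
    then show "\<forall>\<^sub>F t in sequentially. ?b t < c"
    proof eventually_elim
      case (elim t)
      have "?b t \<le> ennreal (r / 2) + ennreal (r / 2)"
        using le[of t m] elim m by (meson add_mono less_imp_le order_trans)
      also have "\<dots> = ennreal r" using r by (simp flip: ennreal_plus)
      finally show ?case using c' r by simp
    qed
  qed auto
qed

end

lemma (in prob_space) integral_tendsto_0_imp_AE:
  fixes Z :: "'a \<Rightarrow> real"
  assumes Z: "integrable M Z" "AE w in M. 0 \<le> Z w"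
    and a: "\<And>n. (\<integral>w. Z w \<partial>M) \<le> a n" "a \<longlonglongrightarrow> 0"
  shows "AE w in M. Z w = 0"
proof -
  have "(\<integral>w. Z w \<partial>M) \<le> 0" by (rule LIMSEQ_le_const[OF a(2)]) (use a(1) in auto)
  moreover have "0 \<le> (\<integral>w. Z w \<partial>M)" by (rule integral_nonneg_AE[OF Z(2)])
  ultimately have "(\<integral>w. Z w \<partial>M) = 0" by simp
  then show ?thesis using integral_nonneg_eq_0_iff_AE[OF Z] by simp
qed

section \<open>Mass of the expected posterior near a point, and the variance in the limit\<close>

context design_model
begin

lemma continuous_pathr: "w \<in> space M \<Longrightarrow> continuous_on D (pathr w)"
  using path_space_continuous[OF measurable_space[OF pathr_measurable]] D_sub_U by (blast intro: continuous_on_subset)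

lemma posterior_mass_measurable:
  assumes A: "A \<in> sets L"
  shows "(\<lambda>g. measure (posterior D g) A) \<in> borel_measurable (path_space U)"
proof -
  have c: "continuous_on D g" if "g \<in> space (path_space U)" for g
    using path_space_continuous[OF that] D_sub_U by (rule continuous_on_subset)
  have "posterior D \<in> path_space U \<rightarrow>\<^sub>M subprob_algebra (restrict_space borel D)"
    by (rule posterior_kernel[where G="\<lambda>g. g", OF Dc _ c]) (use D_sub_U path_space_coordinate in auto)
  then show ?thesis
    using A by (intro measurable_compose[OF _ measurable_measure_subprob_algebra]) (auto simp: sets_lebesgue_region)
qed

text \<open>The density is strictly positive everywhere, so vanishing mass would force vanishing
  Lebesgue measure.\<close>

lemma posterior_mass_pos:
  assumes g: "continuous_on D g" and A: "A \<in> sets L" "0 < measure L A"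
  shows "0 < measure (posterior D g) A" "measure (posterior D g) A \<le> 1"
proof -
  note m = post_density_measurable_x[where N="count_space UNIV" and G="\<lambda>_::unit. g" and D=D, OF Dc]
  have pm [measurable]: "post_density D g \<in> borel_measurable L" using m g by auto
  have pos: "0 < post_density D g x" for x
    using post_density_pos[where N="count_space UNIV" and G="\<lambda>_::unit. g" and D=D, OF Dc] g by auto
  have "(\<lambda>_::unit. posterior D g) \<in> count_space UNIV \<rightarrow>\<^sub>M subprob_algebra (restrict_space borel D)"
    using posterior_kernel[where N="count_space UNIV" and G="\<lambda>_::unit. g" and D=D, OF Dc] g by auto
  then interpret Q: subprob_space "posterior D g"
    using measurable_space[of "\<lambda>_::unit. posterior D g" "count_space UNIV" "subprob_algebra (restrict_space borel D)" "()"]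
    by (simp add: space_subprob_algebra)
  show "measure (posterior D g) A \<le> 1" by (rule Q.subprob_measure_le_1)
  have "emeasure (posterior D g) A \<noteq> 0"
  proof
    assume "emeasure (posterior D g) A = 0"
    then have "(\<integral>\<^sup>+x. ennreal (post_density D g x) * indicator A x \<partial>L) = 0"
      using A(1) unfolding posterior_eq by (simp add: emeasure_density)
    then have "AE x in L. ennreal (post_density D g x) * indicator A x = 0"
      using A(1) by (subst (asm) nn_integral_0_iff_AE) auto
    moreover have "ennreal (post_density D g x) * indicator A x \<noteq> 0" if "x \<in> A" for x
      using pos[of x] that by (simp add: ennreal_eq_0_iff not_le)
    ultimately have "AE x in L. x \<notin> A" by (auto elim: eventually_mono)
    then have "emeasure L A = 0"
      using A(1) by (subst (asm) AE_iff_measurable[OF A(1)]) (auto dest: sets.sets_into_space)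
    then show False using A(2) by (simp add: measure_def)
  qed
  then show "0 < measure (posterior D g) A"
    by (simp add: Q.emeasure_eq_measure zero_less_measure_iff)
qed

text \<open>As a conditional expectation of one fixed variable, the mass that the expected posterior
  puts on \<open>A\<close> will converge in mean by Levy's theorem.\<close>

lemma mixture_mass_cond_exp:
  assumes A: "A \<in> sets L" "0 < measure L A"
  shows "AE w in M. real_cond_exp M (H t) (\<lambda>w. measure (posterior D (pathr w)) A) w = measure (mix t w) A"
    and "integrable M (\<lambda>w. measure (posterior D (pathr w)) A)"
proof -
  have hm: "(\<lambda>w. measure (posterior D (pathr w)) A) \<in> borel_measurable M"
    by (rule measurable_compose[OF pathr_measurable posterior_mass_measurable[OF A(1)]])
  show int: "integrable M (\<lambda>w. measure (posterior D (pathr w)) A)"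
    using posterior_mass_pos[OF continuous_pathr A]
    by (intro integrable_const_bound[where B=1] AE_I2 hm) auto
  have "AE w in M. real_cond_exp M (H t) (\<lambda>w. measure (posterior D (pathr w)) A) w
      = enn2real (\<integral>\<^sup>+g. ennreal (measure (posterior D g) A) \<partial>P t w)"
    by (rule P_cond_exp[OF _ posterior_mass_measurable[OF A(1)] _ int]) auto
  then show "AE w in M. real_cond_exp M (H t) (\<lambda>w. measure (posterior D (pathr w)) A) w = measure (mix t w) A"
    using AE_space
  proof eventually_elim
    case (elim w)
    note Pw = P_space[OF elim(2)]
    have "emeasure (mix t w) A = (\<integral>\<^sup>+g. emeasure (posterior D g) A \<partial>P t w)"
      unfolding mixture_eq_bind[OF Dc D_sub_U Pw]
      using A(1) prob_space.not_empty[OF mixture_prob[OF Dc D_sub_U Pw]]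
      by (intro emeasure_bind[OF _ path_posterior_kernel[OF Dc D_sub_U Pw]]) (auto simp: sets_lebesgue_region)
    also have "\<dots> = (\<integral>\<^sup>+g. ennreal (measure (posterior D g) A) \<partial>P t w)"
    proof (rule nn_integral_cong)
      fix g assume "g \<in> space (P t w)"
      then have "posterior D g \<in> space (subprob_algebra (restrict_space borel D))"
        using measurable_space[OF path_posterior_kernel[OF Dc D_sub_U Pw]] by auto
      then interpret Q: subprob_space "posterior D g" by (simp add: space_subprob_algebra)
      show "emeasure (posterior D g) A = ennreal (measure (posterior D g) A)" by (rule Q.emeasure_eq_measure)
    qed
    finally show ?case using elim(1) by (simp add: measure_def)
  qed
qed

lemma variance_reduction_at_query:
  assumes w: "w \<in> space M"
  shows "ennreal (variance_reduction S t w (input S (n_init S + t) w)) = (\<integral>\<^sup>+u. ennreal (decrement t w u) \<partial>mix t w)"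
proof -
  let ?x = "input S (n_init S + t) w"
  note Pw = P_space[OF w]
  interpret Q: prob_space "mix t w" by (rule prob_space_mixture_posterior[OF Dc D_sub_U Pw])
  have sp: "space (mix t w) = D" by (rule space_mixture_posterior[OF Dc D_sub_U Pw])
  have eq: "(post_cov S t w u ?x)\<^sup>2 / (\<sigma>2 t w ?x + noise_var S) = decrement t w u" if "u \<in> D" for u
    using post_var_Suc[OF w, of u t] that D_sub_U by (auto simp: decrement_def)
  have "decrement t w \<in> borel_measurable L"
    unfolding decrement_def[abs_def] using post_cov_measurable_L(2)[OF w input_in_U[OF w]] by measurable
  then have dm: "decrement t w \<in> borel_measurable (mix t w)"
    using sets_mixture_posterior[OF Dc D_sub_U Pw] by (simp cong: measurable_cong_sets)
  have int: "integrable (mix t w) (decrement t w)"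
    using decrement_bounds[OF w] dm by (intro Q.integrable_const_bound[where B=Kmax] AE_I2) (auto simp: sp)
  have "variance_reduction S t w ?x = (\<integral>u. decrement t w u \<partial>mix t w)"
    unfolding variance_reduction_def expected_posterior_eq
    by (rule Bochner_Integration.integral_cong) (auto simp: sp eq)
  moreover have "AE u in mix t w. 0 \<le> decrement t w u"
    by (rule AE_I2) (use decrement_bounds[OF w] in \<open>auto simp: sp\<close>)
  ultimately show ?thesis using nn_integral_eq_integral[OF int] by simp
qed

text \<open>For u in \<open>A\<close> the posterior covariance of u and \<theta> differs from the
  posterior variance at \<theta> by at most \<epsilon>, because increments only shrink under
  conditioning. Where that variance exceeds \<epsilon> the integrand is bounded below; elsewhere the
  truncation makes the bound 0.\<close>

lemma variance_reduction_lower: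
  assumes w: "w \<in> space M" and \<theta>: "\<theta> \<in> D" and A: "A \<in> sets L" and "0 < \<epsilon>"
    and near: "\<And>u. u \<in> A \<Longrightarrow> (K u u - 2 * K u \<theta> + K \<theta> \<theta>) * K \<theta> \<theta> \<le> \<epsilon>\<^sup>2"
  shows "(max 0 (\<sigma>2 t w \<theta> - \<epsilon>))\<^sup>2 / (Kmax + noise_var S + 1) * measure (mix t w) A \<le> variance_reduction S t w \<theta>"
proof -
  note Pw = P_space[OF w]
  interpret Q: prob_space "mix t w" by (rule prob_space_mixture_posterior[OF Dc D_sub_U Pw])
  have sp: "space (mix t w) = D" by (rule space_mixture_posterior[OF Dc D_sub_U Pw])
  have \<theta>U: "\<theta> \<in> U" using \<theta> D_sub_U by auto
  have AD: "A \<subseteq> D" using sets.sets_into_space[OF A] by (simp add: space_L)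
  have Amix: "A \<in> sets (mix t w)" using A by (simp add: sets_mixture_posterior[OF Dc D_sub_U Pw])
  let ?f = "\<lambda>u. (post_cov S t w u \<theta>)\<^sup>2 / (\<sigma>2 t w \<theta> + noise_var S)"
  \<comment> \<open>An upper bound for every denominator; the 1 makes it positive.\<close>
  define b where "b = Kmax + noise_var S + 1"
  have b: "0 < b" using Kmax_nonneg noise_nonneg by (simp add: b_def)
  have \<sigma>b: "0 \<le> \<sigma>2 t w \<theta>" "\<sigma>2 t w \<theta> + noise_var S \<le> b" using post_var_bounds[OF w \<theta>, of t] by (auto simp: b_def)
  have f0: "0 \<le> ?f u" for u using \<sigma>b noise_nonneg by simp
  have fK: "?f u \<le> Kmax" if "u \<in> D" for u
  proof -
    have uU: "u \<in> U" using that D_sub_U by auto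
    have "(post_cov S t w u \<theta>)\<^sup>2 \<le> \<sigma>2 t w u * \<sigma>2 t w \<theta>"
      using post_cov_psd(3)[OF w uU \<theta>U] by (simp add: post_var_def)
    also have "\<dots> \<le> Kmax * (\<sigma>2 t w \<theta> + noise_var S)"
      using post_var_bounds[OF w that, of t] \<sigma>b(1) noise_nonneg by (intro mult_mono) auto
    finally have le: "(post_cov S t w u \<theta>)\<^sup>2 \<le> Kmax * (\<sigma>2 t w \<theta> + noise_var S)" .
    show ?thesis
    proof (cases "\<sigma>2 t w \<theta> + noise_var S = 0")
      case False
      then have "0 < \<sigma>2 t w \<theta> + noise_var S" using \<sigma>b(1) noise_nonneg by linarith
      then show ?thesis using le by (simp add: pos_divide_le_eq)
    qed (use Kmax_nonneg in simp)
  qed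
  have fA: "(max 0 (\<sigma>2 t w \<theta> - \<epsilon>))\<^sup>2 / b \<le> ?f u" if u: "u \<in> A" for u
  proof (cases "\<sigma>2 t w \<theta> \<le> \<epsilon>")
    case True
    then show ?thesis using f0[of u] by (simp add: max_def)
  next
    case False
    then have pos: "0 < \<sigma>2 t w \<theta> + noise_var S" using \<open>0 < \<epsilon>\<close> noise_nonneg by simp
    have uU: "u \<in> U" using u AD D_sub_U by auto
    have "(post_cov S t w u \<theta> - \<sigma>2 t w \<theta>)\<^sup>2 \<le> (post_cov S t w u u - 2 * post_cov S t w u \<theta> + post_cov S t w \<theta> \<theta>) * \<sigma>2 t w \<theta>"
      unfolding post_var_def by (rule covariance_kernel_increment[OF post_covariance[OF w] uU \<theta>U])
    also have "\<dots> \<le> (K u u - 2 * K u \<theta> + K \<theta> \<theta>) * K \<theta> \<theta>"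
    proof (rule mult_mono)
      show "post_cov S t w u u - 2 * post_cov S t w u \<theta> + post_cov S t w \<theta> \<theta> \<le> K u u - 2 * K u \<theta> + K \<theta> \<theta>"
        unfolding post_cov_def by (rule gp_cov_increment_le[OF covariance_K input_in_U[OF w] noise_nonneg uU \<theta>U])
      show "\<sigma>2 t w \<theta> \<le> K \<theta> \<theta>" by (rule post_var_le_prior[OF w \<theta>U])
      show "0 \<le> K u u - 2 * K u \<theta> + K \<theta> \<theta>" by (rule covariance_kernel_psd(4)[OF covariance_K uU \<theta>U])
    qed (rule \<sigma>b)
    also have "\<dots> \<le> \<epsilon>\<^sup>2" by (rule near[OF u])
    finally have "\<bar>post_cov S t w u \<theta> - \<sigma>2 t w \<theta>\<bar> \<le> \<epsilon>" using \<open>0 < \<epsilon>\<close> by (simp add: abs_le_square_iff[symmetric])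
    then have "\<sigma>2 t w \<theta> - \<epsilon> \<le> post_cov S t w u \<theta>" by linarith
    then have "(\<sigma>2 t w \<theta> - \<epsilon>)\<^sup>2 \<le> (post_cov S t w u \<theta>)\<^sup>2" using False by (intro power_mono) auto
    then have "(\<sigma>2 t w \<theta> - \<epsilon>)\<^sup>2 / b \<le> ?f u" using \<sigma>b pos by (intro frac_le) auto
    then show ?thesis using False by (simp add: max_def)
  qed
  have "(\<lambda>u. ?f u) \<in> borel_measurable L"
    using post_cov_measurable_L(1)[OF w \<theta>U] by measurable
  then have fm: "?f \<in> borel_measurable (mix t w)"
    using sets_mixture_posterior[OF Dc D_sub_U Pw] by (simp cong: measurable_cong_sets)
  have int: "integrable (mix t w) ?f"
  proof (rule Q.integrable_const_bound[where B=Kmax])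
    show "AE u in mix t w. norm (?f u) \<le> Kmax"
    proof (rule AE_I2)
      fix u assume "u \<in> space (mix t w)"
      then show "norm (?f u) \<le> Kmax" using fK[of u] unfolding real_norm_def abs_of_nonneg[OF f0] sp by blast
    qed
  qed (rule fm)
  have "(max 0 (\<sigma>2 t w \<theta> - \<epsilon>))\<^sup>2 / b * measure (mix t w) A = (\<integral>u. (max 0 (\<sigma>2 t w \<theta> - \<epsilon>))\<^sup>2 / b * indicator A u \<partial>mix t w)"
    using Amix by simp
  also have "\<dots> \<le> (\<integral>u. ?f u \<partial>mix t w)"
  proof (rule integral_mono[OF _ int])
    show "integrable (mix t w) (\<lambda>u. (max 0 (\<sigma>2 t w \<theta> - \<epsilon>))\<^sup>2 / b * indicator A u)"
      using Amix by (intro integrable_mult_right integrable_real_indicator) (auto simp: less_top[symmetric])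
    fix u
    show "(max 0 (\<sigma>2 t w \<theta> - \<epsilon>))\<^sup>2 / b * indicator A u \<le> ?f u"
      using f0[of u] fA[of u] by (cases "u \<in> A") auto
  qed
  finally show ?thesis by (simp add: variance_reduction_def expected_posterior_eq b_def)
qed

text \<open>The expression vanishes at \<theta> and is continuous by
  \<open>kernel_continuous\<close>; by (A1) small balls around \<theta> meet the region in positive
  measure.\<close>

lemma near_ball:
  assumes \<theta>: "\<theta> \<in> D" and "0 < \<epsilon>"
  shows "\<exists>A\<in>sets L. 0 < measure L A \<and> (\<forall>u\<in>A. (K u u - 2 * K u \<theta> + K \<theta> \<theta>) * K \<theta> \<theta> \<le> \<epsilon>\<^sup>2)"
proof -
  have \<theta>U: "\<theta> \<in> U" using \<theta> D_sub_U by auto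
  have cK: "continuous_on U (\<lambda>u. K (f u) (g u))" if "continuous_on U f" "continuous_on U g" "f ` U \<subseteq> U" "g ` U \<subseteq> U" for f g
    using continuous_on_compose2[OF kernel_continuous continuous_on_Pair[OF that(1,2)]] that(3,4) by auto
  define h where "h u = (K u u - 2 * K u \<theta> + K \<theta> \<theta>) * K \<theta> \<theta>" for u
  have h0: "h \<theta> = 0" by (simp add: h_def)
  have "continuous_on U h"
    unfolding h_def[abs_def] using \<theta>U by (intro continuous_intros cK) auto
  then have "\<exists>d>0. \<forall>u\<in>U. dist u \<theta> < d \<longrightarrow> dist (h u) (h \<theta>) < \<epsilon>\<^sup>2"
    using \<theta>U zero_less_power[OF \<open>0 < \<epsilon>\<close>, of 2] unfolding continuous_on_iff by blast
  then obtain d where d: "0 < d" "\<And>u. u \<in> U \<Longrightarrow> dist u \<theta> < d \<Longrightarrow> \<bar>h u\<bar> < \<epsilon>\<^sup>2"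
    by (auto simp: dist_real_def h0)
  define A where "A = ball \<theta> d \<inter> D"
  have "A \<in> sets L" using compact_D by (auto simp: A_def sets_restrict_space borel_compact)
  moreover have "measure L A = measure lborel A"
    using compact_D by (intro measure_restrict_space) (auto simp: A_def borel_compact)
  moreover have "\<forall>u\<in>A. (K u u - 2 * K u \<theta> + K \<theta> \<theta>) * K \<theta> \<theta> \<le> \<epsilon>\<^sup>2"
  proof
    fix u assume "u \<in> A"
    then have "u \<in> U" "dist u \<theta> < d" using D_sub_U by (auto simp: A_def dist_commute)
    from d(2)[OF this] have "h u \<le> \<epsilon>\<^sup>2" by linarith
    then show "(K u u - 2 * K u \<theta> + K \<theta> \<theta>) * K \<theta> \<theta> \<le> \<epsilon>\<^sup>2" by (simp only: h_def)
  qed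
  ultimately show ?thesis using ball_pos[OF \<theta> d(1)] by (intro bexI[of _ A]) (auto simp: A_def)
qed

text \<open>Along UR steps the bound of \<open>variance_reduction_lower\<close> tends to 0 in mean.
  Three replacements turn it into a statement about one fixed variable \<open>Z\<close>: the UR
  indicator becomes its conditional probability, at least \<eta>; the truncated variance becomes its
  limit, which is not larger; the posterior mass becomes its limit \<open>Y\<close>, at a cost that
  vanishes. So \<open>Z\<close> has mean 0, and as \<eta> and \<open>Y\<close> are positive the
  truncated limit variance is 0.\<close>

lemma post_var_limit_le:
  assumes ur: "ur_queries S" and br: "bernoulli_branching S p"
    and p: "AE w in M. \<forall>t. p t w \<le> \<rho> w" and \<rho>: "\<rho> \<in> borel_measurable M" "\<And>w. w \<in> space M \<Longrightarrow> \<rho> w < 1"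
    and \<theta>: "\<theta> \<in> D" and "0 < \<epsilon>"
  shows "AE w in M. lim (\<lambda>t. \<sigma>2 t w \<theta>) \<le> \<epsilon>"
proof -
  have \<theta>U: "\<theta> \<in> U" using \<theta> D_sub_U by auto
  obtain A where A: "A \<in> sets L" "0 < measure L A"
    and near: "\<And>u. u \<in> A \<Longrightarrow> (K u u - 2 * K u \<theta> + K \<theta> \<theta>) * K \<theta> \<theta> \<le> \<epsilon>\<^sup>2"
    using near_ball[OF \<theta> \<open>0 < \<epsilon>\<close>] by blast
  define E where "E t = {w \<in> space M. branch S t w}" for t
  have EG: "E t \<in> sets (G (Suc t))" for t
    using br step_sub_G by (auto simp: E_def bernoulli_branching_def)
  have EM [measurable]: "E t \<in> sets M" for t
    using EG[of t] subalgebra_G[of "Suc t"] by (auto simp: subalgebra_def)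
  define q where "q t = real_cond_exp M (G t) (indicat_real (E t))" for t
  have [measurable]: "q t \<in> borel_measurable M" for t by (simp add: q_def)
  have qp: "AE w in M. \<forall>t. q t w = p t w"
    using br unfolding bernoulli_branching_def E_def q_def by (simp add: AE_all_countable)
  have q01: "AE w in M. 0 \<le> q t w \<and> q t w \<le> 1" for t
    unfolding q_def by (rule cond_prob_bounds[OF subalgebra_G EM])
  \<comment> \<open>\<open>\<rho>\<close> may be arbitrarily negative; the truncation keeps the weights bounded.\<close>
  define \<eta> where "\<eta> w = min 1 (1 - \<rho> w)" for w
  have \<eta>m [measurable]: "\<eta> \<in> borel_measurable M" unfolding \<eta>_def[abs_def] using \<rho>(1) by measurable
  have \<eta>: "0 < \<eta> w" "\<eta> w \<le> 1" if "w \<in> space M" for w using \<rho>(2)[OF that] by (auto simp: \<eta>_def)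
  define X where "X w = measure (posterior D (pathr w)) A" for w
  have Xi: "integrable M X" unfolding X_def by (rule mixture_mass_cond_exp(2)[OF A])
  have X: "0 < X w" "X w \<le> 1" if "w \<in> space M" for w
    unfolding X_def by (intro posterior_mass_pos continuous_pathr that A)+
  define c where "c t = real_cond_exp M (H t) X" for t
  have cH: "c t \<in> borel_measurable (H t)" for t by (simp add: c_def)
  have [measurable]: "c t \<in> borel_measurable M" for t by (simp add: c_def)
  have cmix: "AE w in M. c t w = measure (mix t w) A" for t
    unfolding c_def X_def by (rule mixture_mass_cond_exp(1)[OF A])
  have c01: "AE w in M. 0 \<le> c t w \<and> c t w \<le> 1" for t
  proof -
    interpret Ht: sigma_finite_subalgebra M "H t" by (rule sigma_finite_subalgebraI[OF subalgebra_H])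
    have "AE w in M. 0 \<le> c t w" unfolding c_def
      by (rule Ht.real_cond_exp_ge_c[OF Xi]) (use X in \<open>auto intro!: AE_I2 less_imp_le\<close>)
    moreover have "AE w in M. c t w \<le> 1" unfolding c_def
      by (rule Ht.real_cond_exp_le_c[OF Xi]) (use X in \<open>auto intro!: AE_I2\<close>)
    ultimately show ?thesis by eventually_elim simp
  qed
  interpret Lim: sigma_finite_subalgebra M "limit_algebra M H"
    by (rule sigma_finite_subalgebraI[OF subalgebra_limit])
  define Y where "Y = real_cond_exp M (limit_algebra M H) X"
  have [measurable]: "Y \<in> borel_measurable M" by (simp add: Y_def)
  \<comment> \<open>Strict positivity passes to the conditional expectation and lets
    \<open>Y\<close> be divided out at the end.\<close>
  have Ypos: "AE w in M. 0 < Y w" unfolding Y_def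
    by (rule Lim.real_cond_exp_gr_c[OF Xi]) (use X in \<open>auto intro!: AE_I2\<close>)
  have Yle: "AE w in M. Y w \<le> 1" unfolding Y_def
    by (rule Lim.real_cond_exp_le_c[OF Xi]) (use X in \<open>auto intro!: AE_I2\<close>)
  have cY: "(\<lambda>t. \<integral>w. \<bar>c t w - Y w\<bar> \<partial>M) \<longlonglongrightarrow> 0"
    unfolding c_def Y_def by (rule levy_upward_L1_cond_exp[OF Xi])
  define b where "b = Kmax + noise_var S + 1"
  have b: "0 < b" using Kmax_nonneg noise_nonneg by (simp add: b_def)
  define s where "s t w = (max 0 (\<sigma>2 t w \<theta> - \<epsilon>))\<^sup>2 / b" for t w
  have sH: "s t \<in> borel_measurable (H t)" for t
    unfolding s_def[abs_def] using post_var_measurable[OF \<theta>U, of t] by measurable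
  have [measurable]: "s t \<in> borel_measurable M" for t by (rule measurable_from_subalg[OF subalgebra_H sH])
  define C where "C = Kmax\<^sup>2 / b"
  have s0: "0 \<le> s t w" for t w using b by (simp add: s_def)
  have sC: "s t w \<le> C" if "w \<in> space M" for t w
    unfolding s_def C_def using post_var_bounds[OF that \<theta>, of t] b \<open>0 < \<epsilon>\<close>
    by (intro divide_right_mono power_mono) auto
  \<comment> \<open>The sequence is nonincreasing and nonnegative on \<open>space M\<close>, so
    \<open>lim\<close> is its true limit there.\<close>
  define \<sigma>i where "\<sigma>i w = lim (\<lambda>t. \<sigma>2 t w \<theta>)" for w
  have \<sigma>M: "(\<lambda>w. \<sigma>2 t w \<theta>) \<in> borel_measurable M" for t
    by (rule measurable_from_subalg[OF subalgebra_H post_var_measurable[OF \<theta>U]])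
  have \<sigma>im [measurable]: "\<sigma>i \<in> borel_measurable M"
    unfolding \<sigma>i_def[abs_def] by (rule borel_measurable_lim_metric[OF \<sigma>M])
  have \<sigma>i: "\<sigma>i w \<le> \<sigma>2 t w \<theta>" if w: "w \<in> space M" for w t
  proof -
    have dec: "decseq (\<lambda>t. \<sigma>2 t w \<theta>)" using post_var_antimono[OF w \<theta>U] by (auto simp: decseq_def)
    obtain l where l: "(\<lambda>t. \<sigma>2 t w \<theta>) \<longlonglongrightarrow> l"
      using decseq_convergent[OF dec, of 0] post_var_bounds[OF w \<theta>] by blast
    then show ?thesis using decseq_ge[OF dec l, of t] limI[OF l] by (simp add: \<sigma>i_def)
  qed
  define si where "si w = (max 0 (\<sigma>i w - \<epsilon>))\<^sup>2 / b" for w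
  have sim [measurable]: "si \<in> borel_measurable M" unfolding si_def[abs_def] by measurable
  have si0: "0 \<le> si w" for w using b by (simp add: si_def)
  have sis: "si w \<le> s t w" if "w \<in> space M" for w t
    unfolding si_def s_def using \<sigma>i[OF that, of t] b by (intro divide_right_mono power_mono) auto
  have siC: "si w \<le> C" if "w \<in> space M" for w using sis[OF that, of 0] sC[OF that, of 0] by simp
  have C0: "0 \<le> C" using b by (simp add: C_def)
  \<comment> \<open>Stated for general h because it is used with h equal to 1, to the branch
    indicator, to its complement and to \<open>1 - q t\<close>.\<close>
  have sc_int: "integrable M (\<lambda>w. h w * (s t w * c t w))"
    if [measurable]: "h \<in> borel_measurable M" and h: "AE w in M. \<bar>h w\<bar> \<le> 1" for h t
  proof (rule integrable_const_bound[where B=C])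
    show "AE w in M. norm (h w * (s t w * c t w)) \<le> C"
      using h c01[of t] AE_space
    proof eventually_elim
      case (elim w)
      have "\<bar>h w\<bar> * (s t w * c t w) \<le> 1 * (C * 1)"
        using elim s0 sC C0 by (intro mult_mono) auto
      then show ?case using elim s0[of t w] by (simp add: abs_mult)
    qed
  qed measurable
  define r where "r t = (\<integral>w. (1 - indicat_real (E t) w) * (s t w * c t w) \<partial>M)" for t
  have rint: "integrable M (\<lambda>w. (1 - indicat_real (E t) w) * (s t w * c t w))" for t
    by (rule sc_int) (auto simp: indicator_def)
  have rnn: "AE w in M. 0 \<le> (1 - indicat_real (E t) w) * (s t w * c t w)" for t
    using c01[of t] by eventually_elim (use s0 in \<open>auto simp: indicator_def\<close>)
  have r_le: "ennreal (r t) \<le> (\<integral>\<^sup>+w. \<integral>\<^sup>+u. ennreal (decrement t w u) \<partial>mix t w \<partial>M)" for t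
  proof -
    have "ennreal (r t) = (\<integral>\<^sup>+w. ennreal ((1 - indicat_real (E t) w) * (s t w * c t w)) \<partial>M)"
      unfolding r_def by (rule nn_integral_eq_integral[OF rint rnn, symmetric])
    also have "\<dots> \<le> (\<integral>\<^sup>+w. \<integral>\<^sup>+u. ennreal (decrement t w u) \<partial>mix t w \<partial>M)"
    proof (rule nn_integral_mono_AE)
      have "AE w in M. \<not> branch S t w \<longrightarrow> (\<forall>x\<in>D. variance_reduction S t w x \<le> variance_reduction S t w (input S (n_init S + t) w))"
        using ur by (simp add: ur_queries_def)
      then show "AE w in M. ennreal ((1 - indicat_real (E t) w) * (s t w * c t w)) \<le> (\<integral>\<^sup>+u. ennreal (decrement t w u) \<partial>mix t w)"
        using cmix[of t] AE_space
      proof eventually_elim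
        case (elim w)
        show ?case
        proof (cases "w \<in> E t")
          case False
          then have "\<not> branch S t w" using elim(3) by (simp add: E_def)
          have "s t w * c t w \<le> variance_reduction S t w \<theta>"
            unfolding elim(2) s_def b_def
            using variance_reduction_lower[OF elim(3) \<theta> A(1) \<open>0 < \<epsilon>\<close> near] by simp
          also have "\<dots> \<le> variance_reduction S t w (input S (n_init S + t) w)"
            using elim(1) \<open>\<not> branch S t w\<close> \<theta> by blast
          finally have "ennreal (s t w * c t w) \<le> ennreal (variance_reduction S t w (input S (n_init S + t) w))"
            by (rule ennreal_leI)
          then show ?thesis using False unfolding variance_reduction_at_query[OF elim(3)] by simp
        qed simp
      qed
    qed
    finally show ?thesis .
  qed
  have r0: "0 \<le> r t" for t unfolding r_def by (rule integral_nonneg_AE[OF rnn])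
  have "(\<lambda>t. ennreal (r t)) \<longlonglongrightarrow> 0"
    by (rule tendsto_sandwich[OF _ _ tendsto_const mixture_decrement_tendsto_0]) (use r_le in auto)
  then have rlim: "r \<longlonglongrightarrow> 0" using r0 by (simp add: ennreal_tendsto_0_iff)
  \<comment> \<open>The remaining factors are measurable with respect to \<open>H t\<close>, hence
    \<open>G t\<close>, so integration turns the branch indicator into its conditional
    probability.\<close>
  have rq: "r t = (\<integral>w. (1 - q t w) * (s t w * c t w) \<partial>M)" for t
  proof -
    interpret Gt: sigma_finite_subalgebra M "G t" by (rule sigma_finite_subalgebraI[OF subalgebra_G])
    have scG: "(\<lambda>w. s t w * c t w) \<in> borel_measurable (G t)"
    proof (rule measurable_from_subalg[of "G t" "H t"])
      show "subalgebra (G t) (H t)"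
        using H_sub_G subalgebra_G[of t] by (auto simp: subalgebra_def)
      show "(\<lambda>w. s t w * c t w) \<in> borel_measurable (H t)" using sH cH by measurable
    qed
    have i1: "integrable M (\<lambda>w. s t w * c t w)" using sc_int[of "\<lambda>_. 1"] by simp
    have i2: "integrable M (\<lambda>w. (s t w * c t w) * indicat_real (E t) w)"
      using sc_int[of "indicat_real (E t)" t] by (simp add: mult.commute)
    note ce = Gt.real_cond_exp_intg[OF i2 scG borel_measurable_indicator[OF EM]]
    have "r t = (\<integral>w. s t w * c t w \<partial>M) - (\<integral>w. (s t w * c t w) * indicat_real (E t) w \<partial>M)"
      unfolding r_def Bochner_Integration.integral_diff[OF i1 i2, symmetric]
      by (rule Bochner_Integration.integral_cong) (auto simp: algebra_simps)
    also have "\<dots> = (\<integral>w. s t w * c t w \<partial>M) - (\<integral>w. (s t w * c t w) * q t w \<partial>M)"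
      unfolding q_def ce(2) ..
    also have "\<dots> = (\<integral>w. (1 - q t w) * (s t w * c t w) \<partial>M)"
      unfolding Bochner_Integration.integral_diff[OF i1 ce(1)[folded q_def], symmetric]
      by (rule Bochner_Integration.integral_cong) (auto simp: algebra_simps)
    finally show ?thesis .
  qed
  define Z where "Z w = \<eta> w * (si w * Y w)" for w
  have int1: "integrable M (\<lambda>w. \<eta> w * (si w * h w))" and bd1: "AE w in M. \<bar>\<eta> w * (si w * h w)\<bar> \<le> C * \<bar>h w\<bar>"
    if [measurable]: "h \<in> borel_measurable M" and h: "AE w in M. \<bar>h w\<bar> \<le> 1" for h
  proof -
    show bd: "AE w in M. \<bar>\<eta> w * (si w * h w)\<bar> \<le> C * \<bar>h w\<bar>"
    proof (rule AE_I2)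
      fix w assume w: "w \<in> space M"
      have "\<eta> w * (si w * \<bar>h w\<bar>) \<le> 1 * (C * \<bar>h w\<bar>)"
        using \<eta>[OF w] si0[of w] siC[OF w] C0 by (intro mult_mono) auto
      then show "\<bar>\<eta> w * (si w * h w)\<bar> \<le> C * \<bar>h w\<bar>" using \<eta>[OF w] si0[of w] by (simp add: abs_mult)
    qed
    show "integrable M (\<lambda>w. \<eta> w * (si w * h w))"
    proof (rule integrable_const_bound[where B=C])
      show "AE w in M. norm (\<eta> w * (si w * h w)) \<le> C"
        using bd h
      proof eventually_elim
        case (elim w)
        have "C * \<bar>h w\<bar> \<le> C * 1" using elim(2) C0 by (intro mult_left_mono)
        then show ?case using elim(1) by simp
      qed
    qed measurable
  qed
  have Y1: "AE w in M. \<bar>Y w\<bar> \<le> 1" using Ypos Yle by eventually_elim simp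
  have c1: "AE w in M. \<bar>c t w\<bar> \<le> 1" for t using c01[of t] by eventually_elim simp
  have ci: "integrable M (c t)" for t by (rule integrable_const_bound[where B=1]) (use c1 in auto)
  have Yi: "integrable M Y" by (rule integrable_const_bound[where B=1]) (use Y1 in auto)
  \<comment> \<open>The last term is the price of exchanging the mass at time t for its limit;
    \<eta> is at most 1 and the truncated limit variance at most \<open>C\<close>.\<close>
  have "(\<integral>w. Z w \<partial>M) \<le> r t + C * (\<integral>w. \<bar>c t w - Y w\<bar> \<partial>M)" for t
  proof -
    have "(\<integral>w. \<eta> w * (si w * c t w) \<partial>M) \<le> r t"
      unfolding rq
    proof (rule integral_mono_AE[OF int1])
      show "AE w in M. \<bar>c t w\<bar> \<le> 1" by (rule c1)
      have q1: "AE w in M. \<bar>1 - q t w\<bar> \<le> 1" using q01[of t] by eventually_elim auto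
      show "integrable M (\<lambda>w. (1 - q t w) * (s t w * c t w))" by (rule sc_int[OF _ q1]) measurable
      show "AE w in M. \<eta> w * (si w * c t w) \<le> (1 - q t w) * (s t w * c t w)"
        using qp p c01[of t] q01[of t] AE_space
      proof eventually_elim
        case (elim w)
        have "\<eta> w \<le> 1 - \<rho> w" by (simp add: \<eta>_def)
        also have "\<dots> \<le> 1 - q t w" using elim(1,2) by simp
        finally have "\<eta> w \<le> 1 - q t w" .
        then show ?case using elim sis[of w t] si0[of w] by (intro mult_mono) auto
      qed
    qed measurable
    moreover have "(\<integral>w. Z w \<partial>M) \<le> (\<integral>w. \<eta> w * (si w * c t w) + C * \<bar>c t w - Y w\<bar> \<partial>M)"
      unfolding Z_def
    proof (rule integral_mono_AE)
      show "integrable M (\<lambda>w. \<eta> w * (si w * Y w))" by (rule int1) (use Y1 in auto)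
      show "integrable M (\<lambda>w. \<eta> w * (si w * c t w) + C * \<bar>c t w - Y w\<bar>)"
        by (intro Bochner_Integration.integrable_add int1 c1 integrable_mult_right integrable_abs
            Bochner_Integration.integrable_diff ci Yi) measurable
      show "AE w in M. \<eta> w * (si w * Y w) \<le> \<eta> w * (si w * c t w) + C * \<bar>c t w - Y w\<bar>"
      proof (rule AE_I2)
        fix w assume w: "w \<in> space M"
        have "\<eta> w * (si w * Y w) - \<eta> w * (si w * c t w) = (\<eta> w * si w) * (Y w - c t w)"
          by (simp add: algebra_simps)
        also have "\<dots> \<le> (\<eta> w * si w) * \<bar>c t w - Y w\<bar>"
          using \<eta>[OF w] si0[of w] by (intro mult_left_mono) auto
        also have "\<dots> \<le> (1 * C) * \<bar>c t w - Y w\<bar>"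
          using \<eta>[OF w] si0[of w] siC[OF w] by (intro mult_right_mono mult_mono) auto
        finally show "\<eta> w * (si w * Y w) \<le> \<eta> w * (si w * c t w) + C * \<bar>c t w - Y w\<bar>" by simp
      qed
    qed
    moreover have "(\<integral>w. \<eta> w * (si w * c t w) + C * \<bar>c t w - Y w\<bar> \<partial>M)
        = (\<integral>w. \<eta> w * (si w * c t w) \<partial>M) + C * (\<integral>w. \<bar>c t w - Y w\<bar> \<partial>M)"
      by (subst Bochner_Integration.integral_add)
         (auto intro!: int1 c1 integrable_abs Bochner_Integration.integrable_diff ci Yi)
    ultimately show ?thesis by linarith
  qed
  moreover have "(\<lambda>t. r t + C * (\<integral>w. \<bar>c t w - Y w\<bar> \<partial>M)) \<longlonglongrightarrow> 0 + C * 0"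
    by (intro tendsto_intros rlim cY)
  moreover have Zi: "integrable M Z" unfolding Z_def by (rule int1) (use Y1 in auto)
  moreover have "AE w in M. 0 \<le> Z w"
    using Ypos AE_space
  proof eventually_elim
    case (elim w)
    then show ?case unfolding Z_def using si0[of w] \<eta>(1)[OF elim(2)] by (intro mult_nonneg_nonneg) auto
  qed
  ultimately have "AE w in M. Z w = 0" by (intro integral_tendsto_0_imp_AE) auto
  then show ?thesis
    using Ypos AE_space
  proof eventually_elim
    case (elim w)
    then have "si w = 0" using \<eta>[of w] by (auto simp: Z_def)
    then have "max 0 (\<sigma>i w - \<epsilon>) = 0" using b by (simp add: si_def)
    then show ?case by (simp add: \<sigma>i_def max_def split: if_splits)
  qed
qed

text \<open>\<open>post_var_limit_le\<close> with the levels 1 / (n + 1), then dominated convergence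
  with the bound \<open>Kmax\<close>.\<close>

lemma expected_post_var_tendsto_0:
  assumes ur: "ur_queries S" and br: "bernoulli_branching S p"
    and p: "AE w in M. \<forall>t. p t w \<le> \<rho> w" and \<rho>: "\<rho> \<in> borel_measurable M" "\<And>w. w \<in> space M \<Longrightarrow> \<rho> w < 1"
    and \<theta>: "\<theta> \<in> D"
  shows "(\<lambda>t. \<integral>w. \<sigma>2 t w \<theta> \<partial>M) \<longlonglongrightarrow> 0"
proof -
  have \<theta>U: "\<theta> \<in> U" using \<theta> D_sub_U by auto
  have "AE w in M. \<forall>n. lim (\<lambda>t. \<sigma>2 t w \<theta>) \<le> 1 / real (Suc n)"
    unfolding AE_all_countable by (intro allI post_var_limit_le[OF ur br p \<rho> \<theta>]) simp_all
  then have lim0: "AE w in M. (\<lambda>t. \<sigma>2 t w \<theta>) \<longlonglongrightarrow> 0"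
    using AE_space
  proof eventually_elim
    case (elim w)
    have dec: "decseq (\<lambda>t. \<sigma>2 t w \<theta>)" using post_var_antimono[OF elim(2) \<theta>U] by (auto simp: decseq_def)
    obtain l where l: "(\<lambda>t. \<sigma>2 t w \<theta>) \<longlonglongrightarrow> l"
      using decseq_convergent[OF dec, of 0] post_var_bounds[OF elim(2) \<theta>] by blast
    have "0 \<le> l" by (rule LIMSEQ_le_const[OF l]) (use post_var_bounds[OF elim(2) \<theta>] in auto)
    moreover have "l \<le> 1 / real (Suc n)" for n using elim(1) limI[OF l] by simp
    then have "l \<le> 0"
      by (intro LIMSEQ_le_const[OF LIMSEQ_inverse_real_of_nat]) (auto simp: inverse_eq_divide)
    ultimately show ?case using l by simp
  qed
  have "(\<lambda>t. \<integral>w. \<sigma>2 t w \<theta> \<partial>M) \<longlonglongrightarrow> (\<integral>w. 0 \<partial>M)"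
  proof (rule integral_dominated_convergence[where w="\<lambda>_. Kmax"])
    show "(\<lambda>w. \<sigma>2 t w \<theta>) \<in> borel_measurable M" for t
      by (rule measurable_from_subalg[OF subalgebra_H post_var_measurable[OF \<theta>U]])
    show "AE w in M. norm (\<sigma>2 t w \<theta>) \<le> Kmax" for t
      by (rule AE_I2) (use post_var_bounds[OF _ \<theta>] in auto)
  qed (use lim0 in auto)
  then show ?thesis by simp
qed

end

section \<open>Convergence in total variation\<close>

lemma post_density_restrict:
  assumes "D \<subseteq> U" "x \<in> U"
  shows "post_density D (restrict g U) x = post_density D g x"
proof -
  have "normaliser D (restrict g U) = normaliser D g"
    unfolding normaliser_def using assms(1)
    by (intro Bochner_Integration.integral_cong) (auto simp: space_restrict_space subset_iff)
  then show ?thesis using assms(2) by (simp add: post_density_def)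
qed

context design_model
begin

text \<open>Given the history, the field at x is normal with the posterior mean and variance;
  disintegration averages the squared deviation over histories.\<close>

lemma post_mean_L2_error:
  assumes x: "x \<in> D"
  shows "integrable M (\<lambda>w. (post_mean S t w x - path w x)\<^sup>2)"
    and "(\<integral>w. (post_mean S t w x - path w x)\<^sup>2 \<partial>M) = (\<integral>w. \<sigma>2 t w x \<partial>M)"
proof -
  have xU: "x \<in> U" using x D_sub_U by auto
  note mH = post_mean_measurable[OF xU, of t]
  have mM [measurable]: "(\<lambda>w. post_mean S t w x) \<in> borel_measurable M" by (rule measurable_from_subalg[OF subalgebra_H mH])
  have pM [measurable]: "(\<lambda>w. path w x) \<in> borel_measurable M" by (rule path_measurable[OF xU])
  have \<sigma>M: "(\<lambda>w. \<sigma>2 t w x) \<in> borel_measurable M"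
    by (rule measurable_from_subalg[OF subalgebra_H post_var_measurable[OF xU]])
  have \<sigma>i: "integrable M (\<lambda>w. \<sigma>2 t w x)"
    using post_var_bounds[OF _ x] \<sigma>M by (intro integrable_const_bound[where B=Kmax] AE_I2) auto
  have \<Phi>: "(\<lambda>z. ennreal ((post_mean S t (fst z) x - snd z x)\<^sup>2)) \<in> borel_measurable (H t \<Otimes>\<^sub>M path_space U)"
    using measurable_compose[OF measurable_fst mH] measurable_compose[OF measurable_snd path_space_coordinate[OF xU]]
    by measurable
  have "(\<integral>\<^sup>+w. ennreal ((post_mean S t w x - path w x)\<^sup>2) \<partial>M)
      = (\<integral>\<^sup>+w. \<integral>\<^sup>+g. ennreal ((post_mean S t w x - g x)\<^sup>2) \<partial>P t w \<partial>M)"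
    using P_disintegration[OF _ \<Phi>] xU by (simp add: pathr_apply)
  also have "\<dots> = (\<integral>\<^sup>+w. ennreal (\<sigma>2 t w x) \<partial>M)"
  proof (rule nn_integral_cong_AE)
    show "AE w in M. (\<integral>\<^sup>+g. ennreal ((post_mean S t w x - g x)\<^sup>2) \<partial>P t w) = ennreal (\<sigma>2 t w x)"
      using P_gp AE_space
    proof eventually_elim
      case (elim w)
      note gp = elim(1)[rule_format, of t]
      interpret Pw: prob_space "P t w" using P_space[OF elim(2)] by (simp add: space_prob_algebra)
      let ?m = "post_mean S t w x"
      have Ym: "(\<lambda>g. g x) \<in> borel_measurable (P t w)" using gp xU by (auto simp: gaussian_process_def)
      have "distr (P t w) borel (\<lambda>g. \<Sum>i\<in>{x}. 1 * g i) = normal_law (\<Sum>i\<in>{x}. 1 * post_mean S t w i) (\<Sum>i\<in>{x}. \<Sum>j\<in>{x}. 1 * 1 * post_cov S t w i j)"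
        using gp[unfolded gaussian_process_def, THEN conjunct2, THEN conjunct2, rule_format, of "{x}" "\<lambda>_. 1"] xU by simp
      then have D: "distr (P t w) borel (\<lambda>g. g x) = normal_law ?m (\<sigma>2 t w x)" by (simp add: post_var_def)
      note N = Ym post_var_nonneg[OF elim(2) xU] D
      note i = normal_law_second_moment[OF N] normal_law_first_moment[OF N]
      have e: "(?m - g x)\<^sup>2 = ?m\<^sup>2 - 2 * ?m * g x + (g x)\<^sup>2" for g :: "real^'n \<Rightarrow> real"
        by (simp add: power2_eq_square algebra_simps)
      have int: "integrable (P t w) (\<lambda>g. (?m - g x)\<^sup>2)" unfolding e using i by simp
      have "(\<integral>g. (?m - g x)\<^sup>2 \<partial>P t w) = \<sigma>2 t w x"
        unfolding e using i by (simp add: Pw.prob_space power2_eq_square)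
      then show ?case using nn_integral_eq_integral[OF int] by simp
    qed
  qed
  also have "\<dots> = ennreal (\<integral>w. \<sigma>2 t w x \<partial>M)"
    using post_var_bounds[OF _ x] by (intro nn_integral_eq_integral \<sigma>i AE_I2) auto
  finally have nn: "(\<integral>\<^sup>+w. ennreal ((post_mean S t w x - path w x)\<^sup>2) \<partial>M) = ennreal (\<integral>w. \<sigma>2 t w x \<partial>M)" .
  show int: "integrable M (\<lambda>w. (post_mean S t w x - path w x)\<^sup>2)"
    by (rule integrableI_nonneg) (auto simp: nn)
  have "ennreal (\<integral>w. (post_mean S t w x - path w x)\<^sup>2 \<partial>M) = ennreal (\<integral>w. \<sigma>2 t w x \<partial>M)"
    using nn nn_integral_eq_integral[OF int] by simp
  moreover have "0 \<le> (\<integral>w. \<sigma>2 t w x \<partial>M)"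
    using post_var_bounds[OF _ x] by (intro integral_nonneg_AE AE_I2) auto
  ultimately show "(\<integral>w. (post_mean S t w x - path w x)\<^sup>2 \<partial>M) = (\<integral>w. \<sigma>2 t w x \<partial>M)"
    by (simp add: ennreal_inj integral_nonneg_AE)
qed

text \<open>Fubini reduces the claim to one point u at a time. There the mixture density is the
  conditional expectation of the path density, a variable that is measurable for the limit
  algebra.\<close>

lemma total_variation_tendsto_0:
  assumes var: "\<And>x. x \<in> D \<Longrightarrow> (\<lambda>t. \<integral>w. \<sigma>2 t w x \<partial>M) \<longlonglongrightarrow> 0"
  shows "(\<lambda>t. \<integral>\<^sup>+w. ennreal (total_variation (expected_posterior S t w) (posterior D (latent S w))) \<partial>M) \<longlonglongrightarrow> 0"
proof -
  interpret L: finite_measure L by (rule finite_L)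
  interpret prod: pair_sigma_finite M L ..
  let ?p = "\<lambda>w. post_density D (path w)"
  have peq: "post_density D (pathr w) u = ?p w u" if "u \<in> D" for w u
    unfolding pathr_def using that D_sub_U by (intro post_density_restrict) auto
  \<comment> \<open>The posterior variance is the mean-square error of the posterior mean, so the
    path is a mean-square limit of adapted variables.\<close>
  have pathm: "(\<lambda>w. path w x) \<in> borel_measurable (limit_algebra M H)" if x: "x \<in> D" for x
    using x D_sub_U post_mean_L2_error[OF x] var[OF x]
    by (intro limit_algebra_L2_limit[where Zn="\<lambda>t w. post_mean S t w x"] post_mean_measurable path_measurable) auto
  have pathc: "continuous_on D (path w)" if "w \<in> space M" for w
    using path_continuous[OF that] D_sub_U by (rule continuous_on_subset)
  have pm: "(\<lambda>w. ?p w u) \<in> borel_measurable (limit_algebra M H)" if "u \<in> D" for u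
    using borel_measurable_post_density(2)[where N="limit_algebra M H" and G=path, OF Dc pathm _ that] pathc by simp
  have pmM: "(\<lambda>w. ?p w u) \<in> borel_measurable M" if "u \<in> D" for u
    by (rule measurable_from_subalg[OF subalgebra_limit pm[OF that]])
  have ppos: "0 < ?p w u" if "w \<in> space M" "u \<in> D" for w u
    using pathr_density_pos[OF that(1), of u] peq[OF that(2)] by simp
  have pM [measurable]: "(\<lambda>z. ?p (fst z) (snd z)) \<in> borel_measurable (M \<Otimes>\<^sub>M L)"
    using post_density_path_measurable by (rule measurable_cong[THEN iffD1, rotated]) (auto simp: space_pair_measure space_L peq)
  define m where "m t w u = enn2real (mixture_density D (P t w) u)" for t w u
  \<comment> \<open>The posterior law enters as a kernel in w; this makes the mixture density
    jointly measurable in w and u, as Fubini requires.\<close>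
  have mM [measurable]: "(\<lambda>z. m t (fst z) (snd z)) \<in> borel_measurable (M \<Otimes>\<^sub>M L)" for t
  proof -
    have c: "continuous_on D g" if "g \<in> space (path_space U)" for g
      using path_space_continuous[OF that] D_sub_U by (rule continuous_on_subset)
    have d: "(\<lambda>z. post_density D (fst z) (snd z)) \<in> borel_measurable (path_space U \<Otimes>\<^sub>M L)"
      by (rule borel_measurable_post_density(1)[OF Dc _ c]) (use D_sub_U path_space_coordinate in auto)
    have "(\<lambda>y. (snd y, snd (fst y))) \<in> (M \<Otimes>\<^sub>M L) \<Otimes>\<^sub>M path_space U \<rightarrow>\<^sub>M path_space U \<Otimes>\<^sub>M L" by measurable
    from measurable_compose[OF this d]
    have d': "(\<lambda>y. ennreal (post_density D (snd y) (snd (fst y)))) \<in> borel_measurable ((M \<Otimes>\<^sub>M L) \<Otimes>\<^sub>M path_space U)"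
      by simp
    have k: "(\<lambda>z. P t (fst z)) \<in> M \<Otimes>\<^sub>M L \<rightarrow>\<^sub>M subprob_algebra (path_space U)"
      by (rule measurable_compose[OF measurable_fst measurable_from_subalg[OF subalgebra_H measurable_prob_algebraD[OF P_kernel]]])
    have "(\<lambda>z. \<integral>\<^sup>+g. ennreal (post_density D g (snd z)) \<partial>P t (fst z)) \<in> borel_measurable (M \<Otimes>\<^sub>M L)"
      by (rule nn_integral_measurable_subprob_algebra2[OF _ k]) (use d' in \<open>simp add: case_prod_beta\<close>)
    then show ?thesis unfolding m_def mixture_density_def by measurable
  qed
  define a where "a t u = (\<integral>\<^sup>+w. ennreal \<bar>m t w u - ?p w u\<bar> \<partial>M)" for t u
  have am: "a t \<in> borel_measurable L" for t
  proof -
    have "(\<lambda>z. ennreal \<bar>m t (snd z) (fst z) - ?p (snd z) (fst z)\<bar>) \<in> borel_measurable (L \<Otimes>\<^sub>M M)"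
      using measurable_compose[OF measurable_pair_swap', of "\<lambda>z. ennreal \<bar>m t (fst z) (snd z) - ?p (fst z) (snd z)\<bar>" M L borel]
      by (simp add: case_prod_beta)
    then show ?thesis unfolding a_def[abs_def] by (intro borel_measurable_nn_integral) (simp add: case_prod_beta)
  qed
  have total: "(\<integral>\<^sup>+u. \<integral>\<^sup>+w. ennreal (?p w u) \<partial>M \<partial>L) = 1"
  proof -
    have "(\<integral>\<^sup>+u. \<integral>\<^sup>+w. ennreal (?p w u) \<partial>M \<partial>L) = (\<integral>\<^sup>+w. \<integral>\<^sup>+u. ennreal (?p w u) \<partial>L \<partial>M)"
      by (rule prod.Fubini') (simp add: case_prod_beta)
    also have "\<dots> = (\<integral>\<^sup>+w. \<integral>\<^sup>+u. ennreal (post_density D (pathr w) u) \<partial>L \<partial>M)"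
      by (intro nn_integral_cong) (simp add: space_L peq)
    also have "\<dots> = (\<integral>\<^sup>+w. 1 \<partial>M)" by (intro nn_integral_cong pathr_density_integral)
    finally show ?thesis by (simp add: emeasure_space_1)
  qed
  have Ipm: "(\<lambda>u. \<integral>\<^sup>+w. ennreal (?p w u) \<partial>M) \<in> borel_measurable L"
  proof -
    have "(\<lambda>z. ennreal (?p (snd z) (fst z))) \<in> borel_measurable (L \<Otimes>\<^sub>M M)"
      using measurable_compose[OF measurable_pair_swap', of "\<lambda>z. ennreal (?p (fst z) (snd z))" M L borel]
      by (simp add: case_prod_beta)
    then show ?thesis by (intro borel_measurable_nn_integral) (simp add: case_prod_beta)
  qed
  \<comment> \<open>At a single point the density may fail to be integrable over \<open>M\<close>;
    for the outer integral almost every u is enough.\<close>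
  have fin: "AE u in L. (\<integral>\<^sup>+w. ennreal (?p w u) \<partial>M) \<noteq> \<infinity>"
    using total by (intro nn_integral_PInf_AE Ipm) auto
  have point: "a t u = ennreal (\<integral>w. \<bar>real_cond_exp M (H t) (\<lambda>w. ?p w u) w - ?p w u\<bar> \<partial>M)"
    "integrable M (\<lambda>w. ?p w u)"
    if u: "u \<in> D" and f: "(\<integral>\<^sup>+w. ennreal (?p w u) \<partial>M) \<noteq> \<infinity>" for t u
  proof -
    show int: "integrable M (\<lambda>w. ?p w u)"
      using f pmM[OF u] ppos[OF _ u] by (intro integrableI_nonneg AE_I2) (auto simp: less_top less_imp_le)
    have dm: "(\<lambda>g. post_density D g u) \<in> borel_measurable (path_space U)"
    proof -
      have c: "continuous_on D g" if "g \<in> space (path_space U)" for g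
        using path_space_continuous[OF that] D_sub_U by (rule continuous_on_subset)
      show ?thesis
        by (rule borel_measurable_post_density(2)[OF Dc _ c u]) (use D_sub_U path_space_coordinate in auto)
    qed
    have dp: "0 \<le> post_density D g u" if "g \<in> space (path_space U)" for g
    proof -
      have "continuous_on D g" using path_space_continuous[OF that] D_sub_U by (rule continuous_on_subset)
      then show ?thesis using normaliser_pos[OF Dc] by (simp add: post_density_def less_imp_le)
    qed
    have int': "integrable M (\<lambda>w. post_density D (pathr w) u)" using int by (simp add: peq[OF u])
    have "AE w in M. real_cond_exp M (H t) (\<lambda>w. post_density D (pathr w) u) w = enn2real (\<integral>\<^sup>+g. ennreal (post_density D g u) \<partial>P t w)"
      by (rule P_cond_exp[OF _ dm dp int'])
    then have ae: "AE w in M. real_cond_exp M (H t) (\<lambda>w. ?p w u) w = m t w u"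
      by (simp add: peq[OF u] m_def mixture_density_def)
    interpret Ht: sigma_finite_subalgebra M "H t" by (rule sigma_finite_subalgebraI[OF subalgebra_H])
    have "a t u = (\<integral>\<^sup>+w. ennreal \<bar>real_cond_exp M (H t) (\<lambda>w. ?p w u) w - ?p w u\<bar> \<partial>M)"
      unfolding a_def using ae by (intro nn_integral_cong_AE) (auto elim!: eventually_mono)
    also have "\<dots> = ennreal (\<integral>w. \<bar>real_cond_exp M (H t) (\<lambda>w. ?p w u) w - ?p w u\<bar> \<partial>M)"
      by (intro nn_integral_eq_integral integrable_abs Bochner_Integration.integrable_diff Ht.real_cond_exp_int int) auto
    finally show "a t u = ennreal (\<integral>w. \<bar>real_cond_exp M (H t) (\<lambda>w. ?p w u) w - ?p w u\<bar> \<partial>M)" .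
  qed
  have "(\<lambda>t. \<integral>\<^sup>+u. a t u \<partial>L) \<longlonglongrightarrow> (\<integral>\<^sup>+u. 0 \<partial>L)"
  \<comment> \<open>The distance is at most the sum of both mean densities, and conditioning
    preserves the mean; over the region this dominating function integrates to 2.\<close>
  proof (rule nn_integral_dominated_convergence[where w="\<lambda>u. 2 * (\<integral>\<^sup>+w. ennreal (?p w u) \<partial>M)"])
    show "(\<integral>\<^sup>+u. 2 * (\<integral>\<^sup>+w. ennreal (?p w u) \<partial>M) \<partial>L) < \<infinity>"
      using Ipm by (simp add: nn_integral_cmult total)
    show "AE u in L. (\<lambda>t. a t u) \<longlonglongrightarrow> 0"
      using fin AE_space
    proof eventually_elim
      case (elim u)
      then have u: "u \<in> D" by (simp add: space_L)
      have "(\<lambda>t. \<integral>w. \<bar>real_cond_exp M (H t) (\<lambda>w. ?p w u) w - ?p w u\<bar> \<partial>M) \<longlonglongrightarrow> 0"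
        by (rule levy_upward_L1[OF point(2)[OF u elim(1)] pm[OF u]])
      then have "(\<lambda>t. ennreal (\<integral>w. \<bar>real_cond_exp M (H t) (\<lambda>w. ?p w u) w - ?p w u\<bar> \<partial>M)) \<longlonglongrightarrow> ennreal 0"
        by (rule tendsto_ennrealI)
      then show ?case by (simp add: point(1)[OF u elim(1)])
    qed
    show "AE u in L. a t u \<le> 2 * (\<integral>\<^sup>+w. ennreal (?p w u) \<partial>M)" for t
      using fin AE_space
    proof eventually_elim
      case (elim u)
      then have u: "u \<in> D" by (simp add: space_L)
      interpret Ht: sigma_finite_subalgebra M "H t" by (rule sigma_finite_subalgebraI[OF subalgebra_H])
      note i = point(2)[OF u elim(1)]
      have "(\<integral>w. \<bar>real_cond_exp M (H t) (\<lambda>w. ?p w u) w - ?p w u\<bar> \<partial>M)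
          \<le> (\<integral>w. \<bar>real_cond_exp M (H t) (\<lambda>w. ?p w u) w\<bar> + \<bar>?p w u\<bar> \<partial>M)"
        by (intro integral_mono integrable_abs Bochner_Integration.integrable_diff Bochner_Integration.integrable_add
             Ht.real_cond_exp_int i) auto
      also have "\<dots> = (\<integral>w. \<bar>real_cond_exp M (H t) (\<lambda>w. ?p w u) w\<bar> \<partial>M) + (\<integral>w. \<bar>?p w u\<bar> \<partial>M)"
        by (intro Bochner_Integration.integral_add integrable_abs Ht.real_cond_exp_int i)
      also have "\<dots> \<le> 2 * (\<integral>w. \<bar>?p w u\<bar> \<partial>M)"
        using integral_abs_cond_exp_le[OF subalgebra_H[of t] i] by simp
      also have "(\<integral>w. \<bar>?p w u\<bar> \<partial>M) = (\<integral>w. ?p w u \<partial>M)"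
        using ppos[OF _ u] by (intro Bochner_Integration.integral_cong) (auto simp: less_imp_le)
      finally have "a t u \<le> ennreal (2 * (\<integral>w. ?p w u \<partial>M))"
        unfolding point(1)[OF u elim(1)] by (rule ennreal_leI)
      also have "\<dots> = 2 * ennreal (\<integral>w. ?p w u \<partial>M)" by (simp add: ennreal_mult')
      also have "ennreal (\<integral>w. ?p w u \<partial>M) = (\<integral>\<^sup>+w. ennreal (?p w u) \<partial>M)"
        using ppos[OF _ u] by (intro nn_integral_eq_integral[symmetric] i AE_I2) (auto simp: less_imp_le)
      finally show ?case .
    qed
  qed (use am Ipm in auto)
  then have lim: "(\<lambda>t. \<integral>\<^sup>+u. a t u \<partial>L) \<longlonglongrightarrow> 0" by simp
  have "(\<integral>\<^sup>+w. ennreal (total_variation (expected_posterior S t w) (posterior D (latent S w))) \<partial>M) \<le> (\<integral>\<^sup>+u. a t u \<partial>L)" for t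
  proof -
    have "(\<integral>\<^sup>+w. ennreal (total_variation (expected_posterior S t w) (posterior D (latent S w))) \<partial>M)
        \<le> (\<integral>\<^sup>+w. \<integral>\<^sup>+u. ennreal \<bar>m t w u - ?p w u\<bar> \<partial>L \<partial>M)"
    proof (rule nn_integral_mono_AE)
      show "AE w in M. ennreal (total_variation (expected_posterior S t w) (posterior D (latent S w)))
          \<le> (\<integral>\<^sup>+u. ennreal \<bar>m t w u - ?p w u\<bar> \<partial>L)"
        using path_eq_latent AE_space
      proof eventually_elim
        case (elim w)
        show ?case unfolding expected_posterior_eq m_def elim(1)[symmetric]
          by (rule total_variation_mixture_le[OF Dc D_sub_U P_space[OF elim(2)] pathc[OF elim(2)]])
      qed
    qed
    also have "\<dots> = (\<integral>\<^sup>+u. a t u \<partial>L)"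
      unfolding a_def by (rule prod.Fubini'[symmetric]) (simp add: case_prod_beta)
    finally show ?thesis .
  qed
  then show ?thesis by (intro tendsto_sandwich[OF _ _ tendsto_const lim]) auto
qed

end

theorem corollary15:
  fixes S :: "('w, 'n::finite) design"
    and fam :: kernel_family
    and sel :: "((real^'n) \<times> real) list \<Rightarrow> real^'n"
    and \<M> :: "real^'n^'n \<Rightarrow> real^'n^'n"
    and k :: nat and a :: real
  assumes "standing_setup S"
    and "kernel_assumption fam (region S) (cov_kernel S)"
    and "ur_queries S"
    and "1 \<le> k" and "0 < a"
    and "selects_incumbent S sel"
    and "proxy_smoothness S sel \<M>"
    and "AE w in prb S. k + 1 \<le> card ((\<lambda>i. input S i w) ` {..<n_init S})"
    and "bernoulli_branching S (alloc_prob S sel \<M> k a)"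
  shows "(\<exists>\<rho> \<in> borel_measurable (prb S).
            (\<forall>w\<in>space (prb S). \<rho> w < 1) \<and>
            (AE w in prb S.
               (SUP t. alloc_prob S sel \<M> k a t w) \<le> \<rho> w \<and>
               liminf (\<lambda>T. ereal (real (ur_count S T w) / real T)) \<ge> ereal (1 - \<rho> w) \<and>
               1 - \<rho> w > 0)) \<and>
         (\<forall>\<delta>. 0 < \<delta> \<and> \<delta> < 1 \<longrightarrow>
            (\<exists>C. \<exists>c>0. \<exists>T0. \<forall>T\<ge>T0.
               (\<integral>\<^sup>+w. ennreal (total_variation (expected_posterior S T w)
                                 (posterior (region S) (latent S w))) \<partial>prb S)
                 \<le> ennreal (C * noisy_rate fam CARD('n) T + \<delta>) \<and>
               (noise_var S = 0 \<longrightarrow>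
                  (\<integral>\<^sup>+w. ennreal (total_variation (expected_posterior S T w)
                                    (posterior (region S) (latent S w))) \<partial>prb S)
                    \<le> ennreal (C * noiseless_rate fam CARD('n) c T + \<delta>))))"
proof -
  interpret design_model S
    using assms(1,7) by unfold_locales (auto simp: proxy_smoothness_def)
  \<comment> \<open>The same \<rho> serves both claims: it bounds the frequency of BO steps, and it
    keeps UR steps probable enough for the posterior variance to vanish.\<close>
  obtain \<rho> where \<rho>: "\<rho> \<in> borel_measurable M" "\<And>w. \<rho> w < 1"
    and p: "AE w in M. \<forall>t. alloc_prob S sel \<M> k a t w \<le> \<rho> w"
    using alloc_prob_bound[OF assms(4-7)] by blast
  have lim: "AE w in M. ereal (1 - \<rho> w) \<le> liminf (\<lambda>T. ereal (real (ur_count S T w) / real T))"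
    by (rule ur_count_liminf[OF assms(9) p])
  have "AE w in M. (SUP t. alloc_prob S sel \<M> k a t w) \<le> \<rho> w \<and>
      liminf (\<lambda>T. ereal (real (ur_count S T w) / real T)) \<ge> ereal (1 - \<rho> w) \<and> 1 - \<rho> w > 0"
    using p lim
  proof eventually_elim
    case (elim w)
    have "(SUP t. alloc_prob S sel \<M> k a t w) \<le> \<rho> w" by (rule cSUP_least) (use elim(1) in auto)
    then show ?case using elim(2) \<rho>(2)[of w] by simp
  qed
  moreover have "\<exists>C. \<exists>c>0. \<exists>T0. \<forall>T\<ge>T0.
      (\<integral>\<^sup>+w. ennreal (total_variation (expected_posterior S T w) (posterior D (latent S w))) \<partial>M)
        \<le> ennreal (C * noisy_rate fam CARD('n) T + \<delta>) \<and>
      (noise_var S = 0 \<longrightarrow>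
        (\<integral>\<^sup>+w. ennreal (total_variation (expected_posterior S T w) (posterior D (latent S w))) \<partial>M)
          \<le> ennreal (C * noiseless_rate fam CARD('n) c T + \<delta>))" if "0 < \<delta>" for \<delta>
  proof -
    have "(\<lambda>t. \<integral>\<^sup>+w. ennreal (total_variation (expected_posterior S t w) (posterior D (latent S w))) \<partial>M) \<longlonglongrightarrow> 0"
      by (intro total_variation_tendsto_0 expected_post_var_tendsto_0[OF assms(3) assms(9) p \<rho>])
    then have "\<forall>\<^sub>F T in sequentially.
        (\<integral>\<^sup>+w. ennreal (total_variation (expected_posterior S T w) (posterior D (latent S w))) \<partial>M) < ennreal \<delta>"
      using that by (intro order_tendstoD(2)) auto
    then obtain T0 where "\<And>T. T0 \<le> T \<Longrightarrow>
        (\<integral>\<^sup>+w. ennreal (total_variation (expected_posterior S T w) (posterior D (latent S w))) \<partial>M) < ennreal \<delta>"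
      by (auto simp: eventually_sequentially)
    \<comment> \<open>As \<open>\<delta>\<close> is fixed before \<open>T0\<close>, convergence to 0 gives the bounds even with \<open>C = 0\<close>.\<close>
    then show ?thesis
      by (intro exI[of _ 0] exI[of _ 1] exI[of _ T0] conjI allI impI) (auto intro: less_imp_le)
  qed
  ultimately show ?thesis using \<rho> by blast
qed

end
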